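(* Fix $\theta\in\mathbb{R}$. There exists $a_0>0$ such that for every $0<a<a_0$ the following holds: letting $\alpha^n$ denote the distribution of the rescaled magnetization $\mathcal{Y}^n$ under the stationary measure $\mu^n_{\rm ss}$ of the Markov process with generator $L_n=n^2L_n^{\rm ex}+aL_n^{\rm G}$, the sequence of probability measures $(\alpha^n)_n$ on $\mathbb{R}$ converges weakly, as $n\to\infty$, to the probability measure $$\alpha^*(dy)=Z^{-1}e^{-2V(y)}\,dy,\qquad V(y)=\theta y^2+\tfrac12 y^4,\qquad Z=\int_{\mathbb{R}}e^{-2V(y)}\,dy .$$
   Context: Throughout $n$ ranges over positive integers with $n>\theta^2$. $\mathbb{T}_n=\mathbb{Z}/n\mathbb{Z}$, $\Omega_n=\{0,1\}^{\mathbb{T}_n}$ with elements $\eta=(\eta(x))_{x\in\mathbb{T}_n}$, and $\sigma(x)=2\eta(x)-1$. Let $\gamma=\gamma_n=\frac12\left(1-\frac{\theta}{\sqrt n}\right)\in(0,1)$. For $f:\Omega_n\to\mathbb{R}$, $$L_n^{\rm ex}f(\eta)=\sum_{x\in\mathbb{T}_n}\{f(\eta^{x,x+1})-f(\eta)\},\qquad L_n^{\rm G}f(\eta)=\sum_{x\in\mathbb{T}_n}c_x(\eta)\{f(\eta^x)-f(\eta)\},$$ where $\eta^{x,x+1}$ is $\eta$ with the values at $x$ and $x+1$ exchanged, $\eta^x$ is $\eta$ with the value at $x$ replaced by $1-\eta(x)$, and $$c_x(\eta)=1-\gamma\sigma(x)(\sigma(x-1)+\sigma(x+1))+\gamma^2\sigma(x-1)\sigma(x+1).$$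 For $a>0$, $L_n=n^2L_n^{\rm ex}+aL_n^{\rm G}$ generates an irreducible continuous-time Markov chain on the finite set $\Omega_n$; $\mu^n_{\rm ss}$ denotes its unique invariant probability measure. $\mathcal{Y}^n(\eta)=n^{-3/4}\sum_{x\in\mathbb{T}_n}(\eta(x)-1/2)$, and $\alpha^n(A)=\mu^n_{\rm ss}(\mathcal{Y}^n\in A)$ for Borel $A\subset\mathbb{R}$. *)

theory Defs
  imports "HOL-Probability.Probability"
begin

text \<open>
  The torus \<open>\<int>/n\<int>\<close> is represented by its residues \<open>{..<n}\<close>, with neighbours taken modulo \<open>n\<close>.
  Configurations are extensional functions on \<open>{..<n}\<close>, so that \<open>Omega n\<close> has exactly \<open>2 ^ n\<close> elements.
\<close>

definition Omega :: "nat \<Rightarrow> (nat \<Rightarrow> nat) set" where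
  "Omega n = ({..<n} \<rightarrow>\<^sub>E {0, 1})"

definition right_nb :: "nat \<Rightarrow> nat \<Rightarrow> nat" where
  "right_nb n x = (x + 1) mod n"

definition left_nb :: "nat \<Rightarrow> nat \<Rightarrow> nat" where
  "left_nb n x = (x + n - 1) mod n"

definition spin :: "(nat \<Rightarrow> nat) \<Rightarrow> nat \<Rightarrow> real" where
  "spin \<eta> x = 2 * real (\<eta> x) - 1"

definition exchange :: "nat \<Rightarrow> nat \<Rightarrow> (nat \<Rightarrow> nat) \<Rightarrow> (nat \<Rightarrow> nat)" where
  "exchange n x \<eta> = \<eta>(x := \<eta> (right_nb n x), right_nb n x := \<eta> x)"

definition flip :: "nat \<Rightarrow> (nat \<Rightarrow> nat) \<Rightarrow> (nat \<Rightarrow> nat)" where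
  "flip x \<eta> = \<eta>(x := 1 - \<eta> x)"

definition gam :: "real \<Rightarrow> nat \<Rightarrow> real" where
  "gam \<theta> n = (1 / 2) * (1 - \<theta> / sqrt (real n))"

definition rate :: "real \<Rightarrow> nat \<Rightarrow> nat \<Rightarrow> (nat \<Rightarrow> nat) \<Rightarrow> real" where
  "rate \<theta> n x \<eta> =
     1 - gam \<theta> n * spin \<eta> x * (spin \<eta> (left_nb n x) + spin \<eta> (right_nb n x))
       + (gam \<theta> n)\<^sup>2 * spin \<eta> (left_nb n x) * spin \<eta> (right_nb n x)"

definition L_ex :: "nat \<Rightarrow> ((nat \<Rightarrow> nat) \<Rightarrow> real) \<Rightarrow> (nat \<Rightarrow> nat) \<Rightarrow> real" where
  "L_ex n f \<eta> = (\<Sum>x<n. f (exchange n x \<eta>) - f \<eta>)"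

definition L_G :: "real \<Rightarrow> nat \<Rightarrow> ((nat \<Rightarrow> nat) \<Rightarrow> real) \<Rightarrow> (nat \<Rightarrow> nat) \<Rightarrow> real" where
  "L_G \<theta> n f \<eta> = (\<Sum>x<n. rate \<theta> n x \<eta> * (f (flip x \<eta>) - f \<eta>))"

definition generator :: "real \<Rightarrow> real \<Rightarrow> nat \<Rightarrow> ((nat \<Rightarrow> nat) \<Rightarrow> real) \<Rightarrow> (nat \<Rightarrow> nat) \<Rightarrow> real" where
  "generator \<theta> a n f \<eta> = (real n)\<^sup>2 * L_ex n f \<eta> + a * L_G \<theta> n f \<eta>"

text \<open>
  The transition semigroup, i.e. the exponential of \<open>t\<close> times the generator as a power series.
  On \<open>Omega n\<close>, which is finite and preserved by exchanges and flips, it converges absolutely.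
\<close>

definition markov_semigroup ::
    "real \<Rightarrow> real \<Rightarrow> nat \<Rightarrow> real \<Rightarrow> ((nat \<Rightarrow> nat) \<Rightarrow> real) \<Rightarrow> (nat \<Rightarrow> nat) \<Rightarrow> real" where
  "markov_semigroup \<theta> a n t f \<eta> = (\<Sum>k. t ^ k / fact k * (generator \<theta> a n ^^ k) f \<eta>)"

definition invariant_pmf :: "real \<Rightarrow> real \<Rightarrow> nat \<Rightarrow> (nat \<Rightarrow> nat) pmf \<Rightarrow> bool" where
  "invariant_pmf \<theta> a n p \<longleftrightarrow>
     set_pmf p \<subseteq> Omega n \<and>
     (\<forall>t\<ge>0. \<forall>f. measure_pmf.expectation p (markov_semigroup \<theta> a n t f) = measure_pmf.expectation p f)"

text \<open>
  For \<open>a > 0\<close> and \<open>n > \<theta>\<^sup>2\<close> (hence \<open>n \<ge> 1\<close> and \<open>0 < gam \<theta> n < 1\<close>) the chain is irreducible, so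
  exactly one \<open>p\<close> satisfies the description. The finitely many smaller \<open>n\<close> carry no meaning.
\<close>

definition mu_ss :: "real \<Rightarrow> real \<Rightarrow> nat \<Rightarrow> (nat \<Rightarrow> nat) pmf" where
  "mu_ss \<theta> a n = (THE p. invariant_pmf \<theta> a n p)"

definition magnetization :: "nat \<Rightarrow> (nat \<Rightarrow> nat) \<Rightarrow> real" where
  "magnetization n \<eta> = real n powr (- 3 / 4) * (\<Sum>x<n. real (\<eta> x) - 1 / 2)"

definition alpha :: "real \<Rightarrow> real \<Rightarrow> nat \<Rightarrow> real measure" where
  "alpha \<theta> a n = distr (measure_pmf (mu_ss \<theta> a n)) borel (magnetization n)"

definition potential :: "real \<Rightarrow> real \<Rightarrow> real" where
  "potential \<theta> y = \<theta> * y\<^sup>2 + (1 / 2) * y ^ 4"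

definition partition_const :: "real \<Rightarrow> real" where
  "partition_const \<theta> = (\<integral>y. exp (- 2 * potential \<theta> y) \<partial>lborel)"

definition alpha_star :: "real \<Rightarrow> real measure" where
  "alpha_star \<theta> = density lborel (\<lambda>y. ennreal (exp (- 2 * potential \<theta> y) / partition_const \<theta>))"

lemma integrable_exp_potential: "integrable lborel (\<lambda>y. exp (- 2 * potential \<theta> y))"
proof -
  let ?C = "exp ((\<theta> - 1/2)\<^sup>2) * sqrt (2 * pi)"
  have "integrable lborel (\<lambda>y::real. ?C * std_normal_density y)"
    by (intro integrable_mult_right) (use integrable_std_normal_moment[of 0] in simp)
  then show ?thesis
  proof (rule Bochner_Integration.integrable_bound)
    show "(\<lambda>y. exp (- 2 * potential \<theta> y)) \<in> borel_measurable lborel"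
      unfolding potential_def by measurable
    have "exp (- 2 * potential \<theta> y) \<le> ?C * std_normal_density y" for y
    proof -
      have "0 \<le> (y\<^sup>2 + (\<theta> - 1/2))\<^sup>2 + y\<^sup>2 / 2" by simp
      then have "- 2 * potential \<theta> y \<le> (\<theta> - 1/2)\<^sup>2 + - y\<^sup>2 / 2"
        unfolding potential_def by (simp add: power2_eq_square power4_eq_xxxx algebra_simps)
      then have "exp (- 2 * potential \<theta> y) \<le> exp ((\<theta> - 1/2)\<^sup>2) * exp (- y\<^sup>2 / 2)"
        by (simp only: exp_add[symmetric] exp_le_cancel_iff)
      then show ?thesis by (simp add: std_normal_density_def)
    qed
    then show "AE y in lborel. norm (exp (- 2 * potential \<theta> y)) \<le> norm (?C * std_normal_density y)"
      by (intro AE_I2) (simp add: order_trans[OF _ abs_ge_self])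
  qed
qed

lemma partition_const_pos: "0 < partition_const \<theta>"
proof -
  have "0 \<le> partition_const \<theta>" unfolding partition_const_def by (intro integral_nonneg_AE) simp
  moreover have "partition_const \<theta> \<noteq> 0"
  proof
    assume "partition_const \<theta> = 0"
    then have "AE y::real in lborel. exp (- 2 * potential \<theta> y) = 0"
      using integral_nonneg_eq_0_iff_AE[OF integrable_exp_potential[of \<theta>]] by (simp add: partition_const_def)
    then have "AE y::real in lborel. False" by simp
    then show False
      using ae_filter_eq_bot_iff[of "lborel :: real measure"] by (simp add: trivial_limit_def)
  qed
  ultimately show ?thesis by simp
qed

lemma prob_space_alpha_star: "prob_space (alpha_star \<theta>)"
proof
  have m: "(\<lambda>y. ennreal (exp (- 2 * potential \<theta> y) / partition_const \<theta>)) \<in> borel_measurable lborel"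
    unfolding potential_def by measurable
  have "emeasure (alpha_star \<theta>) (space (alpha_star \<theta>)) =
      (\<integral>\<^sup>+y. ennreal (exp (- 2 * potential \<theta> y) / partition_const \<theta>) \<partial>lborel)"
    using m by (simp add: alpha_star_def emeasure_density)
  also have "\<dots> = ennreal (\<integral>y. exp (- 2 * potential \<theta> y) / partition_const \<theta> \<partial>lborel)"
    using integrable_exp_potential[of \<theta>] partition_const_pos[of \<theta>]
    by (intro nn_integral_eq_integral) (auto intro: less_imp_le)
  also have "(\<integral>y. exp (- 2 * potential \<theta> y) / partition_const \<theta> \<partial>lborel) = partition_const \<theta> / partition_const \<theta>"
    using integrable_exp_potential[of \<theta>] by (simp add: partition_const_def)
  also have "ennreal (partition_const \<theta> / partition_const \<theta>) = 1" using partition_const_pos[of \<theta>] by simp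
  finally show "emeasure (alpha_star \<theta>) (space (alpha_star \<theta>)) = 1" .
qed

end

theory Submission
  imports Defs "HOL-Real_Asymp.Real_Asymp"
begin

text \<open>
  Tested against functions of \<open>\<Y>\<close>, stationarity says that the expectation of
  \<open>f (4 \<theta> \<Y> + 2 n\<^bsup>-1/4\<^esup> \<gamma>\<^sup>2 \<Sum>\<sigma>\<sigma>\<sigma>) - f'\<close> is almost \<open>0\<close>. Replacing the sums of products of neighbouring
  spins by their averages given the magnetization turns this into the equation
  \<open>\<integral> (f (4 \<theta> y + 4 y\<^sup>3) - f') = 0\<close>, which characterizes \<open>\<alpha>\<^sup>*\<close>.

  The replacement costs \<open>C (1 + n\<^sup>2 D)\<close>, where \<open>D\<close> is the Dirichlet form of the exchange dynamics at the square
  root of the stationary weight. It rests on writing the centred sums as \<open>\<Sum> (\<sigma> (z + 1) - \<sigma> z) \<Phi> z\<close> with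
  \<open>\<Phi> z\<close> unaffected by the exchange at \<open>z\<close>, integrating by parts, and bounding the second moments of the
  \<open>\<Phi> z\<close> by the same device; there the crude bound \<open>\<bar>\<Phi> z\<bar> \<le> K n\<close> is enough to close the estimate.
  Finally \<open>n\<^sup>2 D\<close> is bounded by the entropy production relative to a weight that depends on the number of
  particles only and for which the Glauber part has conditional mean zero. That production is itself
  \<open>a\<close> times a replacement error, so that \<open>n\<^sup>2 D \<le> a C (1 + n\<^sup>2 D)\<close> and \<open>n\<^sup>2 D \<le> 1\<close> for small \<open>a\<close>.
\<close>

section \<open>Periodic sums and exchanges\<close>

text \<open>No formula for the stationary weight is available. The replacement estimates are
  therefore proved for an arbitrary nonnegative weight on configurations, in terms of its total mass
  and its exchange Dirichlet form alone. The size of a matters at one point, the closing inequality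
  for the Dirichlet form, and the threshold 1/62000000 is what the explicit replacement constants
  give there. In the identity for functions of the magnetization a is only a common factor, because
  exchanges preserve the magnetization; hence the limit does not depend on it. The scaling is
  critical: the sum S of the spins has size n^(3/4), and the linear drift (1 - 2 gam) S and the
  cubic drift of size S^3 / n^2 both have size n^(1/4).\<close>

definition periodic :: "nat \<Rightarrow> (int \<Rightarrow> 'a) \<Rightarrow> bool" where
  "periodic n f \<longleftrightarrow> (\<forall>i. f (i + int n) = f i)"

lemma periodicD: "periodic n f \<Longrightarrow> f (i + int n) = f i"
  by (simp add: periodic_def)

lemma periodic_mod:
  assumes "periodic n f" "i mod int n = j mod int n"
  shows "f i = f j"
proof -
  have nat: "f (i + int k * int n) = f i" for i k
  proof (induction k)
    case (Suc k)
    have "f (i + int (Suc k) * int n) = f ((i + int k * int n) + int n)" by (simp add: algebra_simps)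
    then show ?case using Suc periodicD[OF assms(1)] by metis
  qed simp
  have "f (i + k * int n) = f i" for i k
  proof (cases "k \<ge> 0")
    case True then show ?thesis using nat[of i "nat k"] by simp
  next
    case False then show ?thesis using nat[of "i + k * int n" "nat (- k)"] by simp
  qed
  moreover obtain k where "i = j + k * int n"
    using assms(2) by (metis mod_eqE mult.commute)
  ultimately show ?thesis by simp
qed

lemma periodic_shift: "periodic n f \<Longrightarrow> periodic n (\<lambda>i. f (i + k))"
  unfolding periodic_def by (metis add.assoc add.commute)

lemma periodic_mult: "periodic n f \<Longrightarrow> periodic n g \<Longrightarrow> periodic n (\<lambda>i. f i * g i)"
  by (simp add: periodic_def)

lemma sum_period_shift:
  fixes f :: "int \<Rightarrow> 'a::comm_monoid_add"
  assumes "periodic n f"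
  shows "(\<Sum>i\<in>{0..<int n}. f (i + k)) = (\<Sum>i\<in>{0..<int n}. f i)"
proof (cases "n = 0")
  case False
  then have n: "int n > 0" by simp
  have "bij_betw (\<lambda>i. (i + k) mod int n) {0..<int n} {0..<int n}"
    by (rule bij_betw_byWitness[where f' = "\<lambda>i. (i - k) mod int n"])
       (use n in \<open>auto simp: mod_diff_left_eq mod_add_left_eq\<close>)
  then have "(\<Sum>i\<in>{0..<int n}. f ((i + k) mod int n)) = (\<Sum>i\<in>{0..<int n}. f i)"
    by (rule sum.reindex_bij_betw)
  moreover have "f ((i + k) mod int n) = f (i + k)" for i
    by (rule periodic_mod[OF assms]) simp
  ultimately show ?thesis by simp
qed simp

text \<open>Indicator of the residue class of \<open>z\<close>. Exchanges and flips change the spin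
  field by multiples of it, so \<open>sum_kron\<close> evaluates the resulting changes of periodic
  sums.\<close>

definition kron :: "nat \<Rightarrow> int \<Rightarrow> int \<Rightarrow> real" where
  "kron n z i = (if i mod int n = z mod int n then 1 else 0)"

lemma sum_kron:
  assumes "periodic n g" "n > 0"
  shows "(\<Sum>i\<in>{0..<int n}. g i * kron n z i) = g z"
proof -
  have "(\<Sum>i\<in>{0..<int n}. g i * kron n z i) = (\<Sum>i\<in>{0..<int n}. if i = z mod int n then g i else 0)"
    by (rule sum.cong) (auto simp: kron_def)
  also have "\<dots> = g (z mod int n)" using assms(2) by (simp add: sum.delta)
  also have "\<dots> = g z" by (rule periodic_mod[OF assms(1)]) simp
  finally show ?thesis .
qed

lemma kron_shift: "kron n z (i + k) = kron n (z - k) i"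
proof -
  have "(i + k) mod int n = z mod int n \<longleftrightarrow> i mod int n = (z - k) mod int n"
    by (simp add: mod_eq_dvd_iff algebra_simps)
  then show ?thesis by (simp add: kron_def)
qed

lemma kron_mult_neq:
  assumes "0 < k" "k < int n"
  shows "kron n z i * kron n (z + k) i = 0"
proof -
  have "\<not> (z mod int n = (z + k) mod int n)"
  proof
    assume "z mod int n = (z + k) mod int n"
    then have "int n dvd k" by (simp add: mod_eq_dvd_iff)
    then show False using assms by (simp add: zdvd_not_zless)
  qed
  then show ?thesis by (auto simp: kron_def)
qed

lemma kron_idem: "kron n z i * kron n z i = kron n z i"
  by (simp add: kron_def)

text \<open>Summation by parts: the weight \<open>(N - j) / N\<close> loses \<open>1 / N\<close> at
  each step, so the differences leave the first value minus the average.\<close>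

lemma sum_abel_linear_weights:
  fixes C :: "nat \<Rightarrow> real"
  assumes "N \<ge> 1"
  shows "(\<Sum>j\<in>{1..<N}. (real N - real j) / real N * (C j - C (Suc j))) = C 1 - (\<Sum>j=1..N. C j) / real N"
proof -
  have "(\<Sum>j\<in>{1..<M}. (real N - real j) * (C j - C (Suc j)))
      = real N * C 1 - (real N - real M) * C M - (\<Sum>j=1..M. C j)" if "M \<ge> 1" for M
    using that
  proof (induction M rule: dec_induct)
    case (step m)
    then show ?case by (simp add: algebra_simps)
  qed (simp add: algebra_simps)
  from this[OF assms] have "(\<Sum>j\<in>{1..<N}. (real N - real j) * (C j - C (Suc j))) / real N
      = (real N * C 1 - (\<Sum>j=1..N. C j)) / real N" by simp
  moreover have "(\<Sum>j\<in>{1..<N}. (real N - real j) / real N * (C j - C (Suc j)))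
      = (\<Sum>j\<in>{1..<N}. (real N - real j) * (C j - C (Suc j))) / real N"
    unfolding sum_divide_distrib by (rule sum.cong) auto
  moreover have "(real N * C 1 - (\<Sum>j=1..N. C j)) / real N = C 1 - (\<Sum>j=1..N. C j) / real N"
    using assms by (simp add: diff_divide_distrib)
  ultimately show ?thesis by (metis (no_types))
qed

text \<open>Origin of the fields \<open>\<Phi> z\<close>. With \<open>C j\<close> the correlation of
  \<open>s\<close> and \<open>q\<close> at distance \<open>j\<close>, a gradient in the first factor
  produces \<open>C j - C (Suc j)\<close>, and linear weights turn these differences into the
  nearest-neighbour correlation minus its spatial average. The coefficient of the gradient at
  \<open>z\<close> reads \<open>q\<close> only from \<open>z + 2\<close> on; for suitable
  \<open>N\<close> it is therefore unaffected by the exchange at \<open>z\<close>.\<close>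

lemma correlation_identity:
  fixes s q :: "int \<Rightarrow> real"
  assumes s: "periodic n s" and q: "periodic n q" and N: "N \<ge> 1"
  shows "(\<Sum>z\<in>{0..<int n}. (s (z + 1) - s z) * (\<Sum>j\<in>{1..<N}. (real N - real j) / real N * q (z + 1 + int j)))
    = (\<Sum>z\<in>{0..<int n}. s z * q (z + 1))
      - (\<Sum>j=1..N. \<Sum>z\<in>{0..<int n}. s z * q (z + int j)) / real N"
proof -
  define C where "C j = (\<Sum>z\<in>{0..<int n}. s z * q (z + int j))" for j :: nat
  have per: "periodic n (\<lambda>z. s z * q (z + int j))" for j
    by (intro periodic_mult s periodic_shift q)
  have diff: "(\<Sum>z\<in>{0..<int n}. (s (z + 1) - s z) * q (z + 1 + int j)) = C j - C (Suc j)" for j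
  proof -
    have "(\<Sum>z\<in>{0..<int n}. s (z + 1) * q (z + 1 + int j)) = C j"
      using sum_period_shift[OF per, of 1 j] by (simp add: C_def)
    moreover have "(\<Sum>z\<in>{0..<int n}. s z * q (z + 1 + int j)) = C (Suc j)"
      by (simp add: C_def algebra_simps)
    ultimately show ?thesis by (simp add: left_diff_distrib sum_subtractf)
  qed
  have "(\<Sum>z\<in>{0..<int n}. (s (z + 1) - s z) * (\<Sum>j\<in>{1..<N}. (real N - real j) / real N * q (z + 1 + int j)))
      = (\<Sum>j\<in>{1..<N}. (real N - real j) / real N * (\<Sum>z\<in>{0..<int n}. (s (z + 1) - s z) * q (z + 1 + int j)))"
    unfolding sum_distrib_left by (subst sum.swap) (simp add: mult_ac)
  also have "\<dots> = C 1 - (\<Sum>j=1..N. C j) / real N"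
    unfolding diff by (rule sum_abel_linear_weights[OF N])
  finally show ?thesis by (simp add: C_def)
qed

section \<open>Configurations as periodic spin fields on the integers, and the effect of an
  exchange\<close>

definition spin_at :: "nat \<Rightarrow> (nat \<Rightarrow> nat) \<Rightarrow> int \<Rightarrow> real" where
  "spin_at n \<eta> i = spin \<eta> (nat (i mod int n))"

definition exch :: "nat \<Rightarrow> int \<Rightarrow> (nat \<Rightarrow> nat) \<Rightarrow> (nat \<Rightarrow> nat)" where
  "exch n z \<eta> = exchange n (nat (z mod int n)) \<eta>"

lemma finite_Omega [simp]: "finite (Omega n)"
  unfolding Omega_def by (intro finite_PiE) auto

lemma Omega_values: "\<eta> \<in> Omega n \<Longrightarrow> x < n \<Longrightarrow> \<eta> x = 0 \<or> \<eta> x = 1"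
  by (auto simp: Omega_def PiE_def Pi_def)

lemma periodic_spin_at: "periodic n (spin_at n \<eta>)"
  by (simp add: periodic_def spin_at_def)

lemma spin_at_values:
  assumes "\<eta> \<in> Omega n" "n > 0"
  shows "spin_at n \<eta> i = 1 \<or> spin_at n \<eta> i = -1"
proof -
  have "nat (i mod int n) < n" using assms(2) by (simp add: nat_less_iff)
  from Omega_values[OF assms(1) this] show ?thesis by (auto simp: spin_at_def spin_def)
qed

lemma spin_at_sq:
  assumes "\<eta> \<in> Omega n" "n > 0"
  shows "spin_at n \<eta> i * spin_at n \<eta> i = 1"
  using spin_at_values[OF assms, of i] by auto

lemma abs_spin_at:
  assumes "\<eta> \<in> Omega n" "n > 0"
  shows "\<bar>spin_at n \<eta> i\<bar> = 1"
  using spin_at_values[OF assms, of i] by auto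

lemma right_nb_mod:
  assumes "n > 0"
  shows "right_nb n (nat (z mod int n)) = nat ((z + 1) mod int n)"
proof -
  have "int (right_nb n (nat (z mod int n))) = (z mod int n + 1) mod int n"
    using assms by (simp add: right_nb_def zmod_int add.commute)
  also have "\<dots> = (z + 1) mod int n" by (simp add: mod_add_left_eq)
  finally show ?thesis by linarith
qed

lemma exch_in_Omega:
  assumes "\<eta> \<in> Omega n" "n > 0"
  shows "exch n z \<eta> \<in> Omega n"
proof -
  have a: "nat (i mod int n) < n" for i using assms(2) by (simp add: nat_less_iff)
  have "exch n z \<eta> x \<in> {0,1}" if "x < n" for x
    using Omega_values[OF assms(1)] that a right_nb_mod[OF assms(2), of z]
    by (auto simp: exch_def exchange_def)
  moreover have "exch n z \<eta> x = undefined" if "\<not> x < n" for x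
    using assms(1) that a right_nb_mod[OF assms(2), of z]
    by (auto simp: exch_def exchange_def Omega_def PiE_def extensional_def)
  ultimately show ?thesis unfolding Omega_def PiE_def extensional_def by auto
qed

lemma exch_exch: "exch n z (exch n z \<eta>) = \<eta>"
  by (auto simp: exch_def exchange_def)

lemma sum_exch:
  assumes "n > 0"
  shows "(\<Sum>\<eta>\<in>Omega n. g (exch n z \<eta>)) = (\<Sum>\<eta>\<in>Omega n. g \<eta>)"
  by (rule sum.reindex_bij_witness[where i = "exch n z" and j = "exch n z"])
     (use assms in \<open>auto simp: exch_exch exch_in_Omega\<close>)

lemma spin_at_exch:
  assumes "n \<ge> 2"
  shows "spin_at n (exch n z \<eta>) i
    = spin_at n \<eta> i + (spin_at n \<eta> (z + 1) - spin_at n \<eta> z) * (kron n z i - kron n (z + 1) i)"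
proof -
  have n: "n > 0" using assms by simp
  have neq: "z mod int n \<noteq> (z + 1) mod int n"
  proof
    assume "z mod int n = (z + 1) mod int n"
    then have "int n dvd 1" by (simp add: mod_eq_dvd_iff)
    then show False using assms by simp
  qed
  have inj: "nat (i mod int n) = nat (j mod int n) \<longleftrightarrow> i mod int n = j mod int n" for i j
    using n by (metis eq_nat_nat_iff of_nat_0_less_iff pos_mod_sign)
  show ?thesis
    using neq unfolding spin_at_def exch_def exchange_def kron_def right_nb_mod[OF n]
    by (auto simp: spin_def inj)
qed

lemma sum_spin_exch:
  assumes "n \<ge> 2" "periodic n g"
  shows "(\<Sum>i\<in>{0..<int n}. g i * spin_at n (exch n z \<eta>) i) =
    (\<Sum>i\<in>{0..<int n}. g i * spin_at n \<eta> i) + (spin_at n \<eta> (z + 1) - spin_at n \<eta> z) * (g z - g (z + 1))"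
proof -
  have "(\<Sum>i\<in>{0..<int n}. g i * spin_at n (exch n z \<eta>) i) =
      (\<Sum>i\<in>{0..<int n}. g i * spin_at n \<eta> i) +
      (spin_at n \<eta> (z + 1) - spin_at n \<eta> z)
       * ((\<Sum>i\<in>{0..<int n}. g i * kron n z i) - (\<Sum>i\<in>{0..<int n}. g i * kron n (z + 1) i))"
    unfolding spin_at_exch[OF assms(1)]
    by (simp add: sum.distrib sum_subtractf sum_distrib_left algebra_simps)
  then show ?thesis using assms by (simp add: sum_kron)
qed

text \<open>Exchanging \<open>z\<close> and \<open>z + 1\<close> keeps the product over that bond,
  so only the two adjacent bonds contribute. For \<open>n \<ge> 3\<close> the residues of
  \<open>z - 1\<close>, \<open>z\<close>, \<open>z + 1\<close> are distinct and the mixed Kronecker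
  terms vanish.\<close>

lemma sum_pair_exch:
  fixes \<eta> :: "nat \<Rightarrow> nat" and z :: int
  assumes n: "n \<ge> 3" and g: "periodic n g"
  defines "s \<equiv> spin_at n \<eta>"
  shows "(\<Sum>i\<in>{0..<int n}. g i * (spin_at n (exch n z \<eta>) i * spin_at n (exch n z \<eta>) (i + 1))) =
    (\<Sum>i\<in>{0..<int n}. g i * (s i * s (i + 1)))
     + (s (z + 1) - s z) * (g (z - 1) * s (z - 1) - g (z + 1) * s (z + 2))"
proof -
  define d where "d = s (z + 1) - s z"
  have s: "periodic n s" unfolding s_def by (rule periodic_spin_at)
  have k1: "kron n z i * kron n (z + 1) i = 0" for i
    by (rule kron_mult_neq) (use n in auto)
  have k2: "kron n (z - 1) i * kron n z i = 0" for i
    using kron_mult_neq[of 1 n "z - 1" i] n by simp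
  have k3: "kron n (z - 1) i * kron n (z + 1) i = 0" for i
    using kron_mult_neq[of 2 n "z - 1" i] n by (simp add: add.commute)
  have pt: "g i * (spin_at n (exch n z \<eta>) i * spin_at n (exch n z \<eta>) (i + 1)) =
     g i * (s i * s (i + 1)) + (d * (g i * s (i + 1) * kron n z i) - d * (g i * s (i + 1) * kron n (z + 1) i)
     + d * (g i * s i * kron n (z - 1) i) - d * (g i * s i * kron n z i) - d * d * (g i * kron n z i))" for i
  proof -
    have e: "spin_at n (exch n z \<eta>) i = s i + d * (kron n z i - kron n (z + 1) i)"
      using spin_at_exch[of n z \<eta> i] n by (simp add: s_def d_def)
    have e': "spin_at n (exch n z \<eta>) (i + 1) = s (i + 1) + d * (kron n (z - 1) i - kron n z i)"
      using spin_at_exch[of n z \<eta> "i + 1"] n by (simp add: s_def d_def kron_shift)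
    show ?thesis unfolding e e'
      using k1[of i] k2[of i] k3[of i] kron_idem[of n z i] by algebra
  qed
  have p: "periodic n (\<lambda>i. g i * s (i + 1))" "periodic n (\<lambda>i. g i * s i)"
    by (intro periodic_mult g s periodic_shift)+
  have n0: "n > 0" using n by simp
  have "(\<Sum>i\<in>{0..<int n}. g i * (spin_at n (exch n z \<eta>) i * spin_at n (exch n z \<eta>) (i + 1))) =
    (\<Sum>i\<in>{0..<int n}. g i * (s i * s (i + 1))) + (d * (g z * s (z + 1)) - d * (g (z + 1) * s (z + 1 + 1))
     + d * (g (z - 1) * s (z - 1)) - d * (g z * s z) - d * d * g z)"
    unfolding pt sum.distrib sum_subtractf sum_distrib_left[symmetric]
      sum_kron[OF p(1) n0] sum_kron[OF p(2) n0] sum_kron[OF g n0] by simp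
  then show ?thesis by (simp add: d_def algebra_simps)
qed

section \<open>Integration by parts for the exchange dynamics\<close>

text \<open>The weight \<open>F\<close> is kept abstract: the estimates see it only through
  \<open>mass\<close> and \<open>energy\<close>, and the stationary weight is inserted
  later.\<close>

locale exclusion =
  fixes n :: nat and F :: "(nat \<Rightarrow> nat) \<Rightarrow> real"
  assumes n4: "n \<ge> 4" and F_nonneg: "\<eta> \<in> Omega n \<Longrightarrow> 0 \<le> F \<eta>"
begin

abbreviation "Om \<equiv> Omega n"
abbreviation "period \<equiv> {0..<int n}"
abbreviation "s \<equiv> spin_at n"
abbreviation "grad \<eta> z \<equiv> s \<eta> (z + 1) - s \<eta> z"
abbreviation "incr f z \<eta> \<equiv> f \<eta> - f (exch n z \<eta>)"
abbreviation "flow \<Phi> \<eta> \<equiv> \<Sum>z\<in>period. grad \<eta> z * \<Phi> z \<eta>"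

definition E :: "((nat \<Rightarrow> nat) \<Rightarrow> real) \<Rightarrow> real" where
  "E g = (\<Sum>\<eta>\<in>Om. F \<eta> * g \<eta>)"

text \<open>The square root is the form in which the entropy production bounds the energy from above
  and in which integration by parts consumes it.\<close>

definition bond_energy :: "int \<Rightarrow> real" where
  "bond_energy z = (\<Sum>\<eta>\<in>Om. (sqrt (F (exch n z \<eta>)) - sqrt (F \<eta>))\<^sup>2)"

definition energy :: real where
  "energy = (\<Sum>z\<in>period. bond_energy z)"

definition mass :: real where "mass = (\<Sum>\<eta>\<in>Om. F \<eta>)"

lemma n_pos [simp]: "n > 0" and n_ge2 [simp]: "n \<ge> 2" and n_ge3 [simp]: "n \<ge> 3"
  using n4 by auto

lemma mass_nonneg: "0 \<le> mass"
  unfolding mass_def by (intro sum_nonneg F_nonneg)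

lemma bond_energy_nonneg: "0 \<le> bond_energy z"
  unfolding bond_energy_def by (intro sum_nonneg) simp

lemma energy_nonneg: "0 \<le> energy"
  unfolding energy_def by (intro sum_nonneg bond_energy_nonneg)

lemma E_mono: "(\<And>\<eta>. \<eta> \<in> Om \<Longrightarrow> f \<eta> \<le> g \<eta>) \<Longrightarrow> E f \<le> E g"
  unfolding E_def by (intro sum_mono mult_left_mono F_nonneg)

lemma E_cong: "(\<And>\<eta>. \<eta> \<in> Om \<Longrightarrow> f \<eta> = g \<eta>) \<Longrightarrow> E f = E g"
  unfolding E_def by (intro sum.cong) auto

lemma E_add: "E (\<lambda>\<eta>. f \<eta> + g \<eta>) = E f + E g"
  by (simp add: E_def sum.distrib algebra_simps)

lemma E_diff: "E (\<lambda>\<eta>. f \<eta> - g \<eta>) = E f - E g"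
  by (simp add: E_def sum_subtractf algebra_simps)

lemma E_cmult: "E (\<lambda>\<eta>. c * f \<eta>) = c * E f"
  by (simp add: E_def sum_distrib_left mult_ac)

lemma E_sum: "E (\<lambda>\<eta>. \<Sum>z\<in>A. f z \<eta>) = (\<Sum>z\<in>A. E (f z))"
  unfolding E_def by (subst sum.swap) (simp add: sum_distrib_left)

lemma E_const: "E (\<lambda>\<eta>. c) = c * mass"
  by (simp add: E_def mass_def sum_distrib_left mult_ac)

lemma abs_E_le: "(\<And>\<eta>. \<eta> \<in> Om \<Longrightarrow> \<bar>f \<eta>\<bar> \<le> g \<eta>) \<Longrightarrow> \<bar>E f\<bar> \<le> E g"
proof -
  assume a: "\<And>\<eta>. \<eta> \<in> Om \<Longrightarrow> \<bar>f \<eta>\<bar> \<le> g \<eta>"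
  have "E f \<le> E g" using a by (intro E_mono) (auto dest: abs_le_D1)
  moreover have "E (\<lambda>\<eta>. - g \<eta>) \<le> E f" using a by (intro E_mono) (fastforce dest: abs_le_D2)
  ultimately show ?thesis using E_cmult[of "-1" g] by simp
qed

text \<open>\<open>grad \<eta> z * \<Phi> \<eta>\<close> is odd under the exchange at
  \<open>z\<close>, so twice its expectation is the sum against \<open>F\<close> minus the exchanged
  \<open>F\<close>. That difference is the difference times the sum of the square roots; Young's
  inequality with parameter \<open>A\<close> sends one factor to \<open>bond_energy\<close> and the
  other to the second moment of \<open>\<Phi>\<close>.\<close>

lemma bond_ibp:
  assumes inv: "\<And>\<eta>. \<eta> \<in> Om \<Longrightarrow> \<Phi> (exch n z \<eta>) = \<Phi> \<eta>" and A: "A > 0"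
  shows "\<bar>E (\<lambda>\<eta>. grad \<eta> z * \<Phi> \<eta>)\<bar>
    \<le> A / 2 * bond_energy z + 2 / A * E (\<lambda>\<eta>. (\<Phi> \<eta>)\<^sup>2)"
proof -
  define h where "h \<eta> = grad \<eta> z * \<Phi> \<eta>" for \<eta>
  define F' where "F' \<eta> = F (exch n z \<eta>)" for \<eta>
  have kron: "kron n z z = 1" "kron n (z + 1) (z + 1) = 1" "kron n z (z + 1) = 0" "kron n (z + 1) z = 0"
    using kron_mult_neq[of 1 n z z] kron_mult_neq[of 1 n z "z + 1"] n4 by (auto simp: kron_def)
  have anti: "h (exch n z \<eta>) = - h \<eta>" if "\<eta> \<in> Om" for \<eta>
    unfolding h_def spin_at_exch[OF n_ge2] kron inv[OF that] by (simp add: algebra_simps)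
  have "E h = (\<Sum>\<eta>\<in>Om. F' \<eta> * h (exch n z \<eta>))"
    unfolding E_def F'_def by (rule sum_exch[symmetric]) simp
  also have "\<dots> = - (\<Sum>\<eta>\<in>Om. F' \<eta> * h \<eta>)"
    unfolding sum_negf[symmetric] by (rule sum.cong) (auto simp: anti)
  finally have two: "2 * E h = (\<Sum>\<eta>\<in>Om. (F \<eta> - F' \<eta>) * h \<eta>)"
    by (simp add: E_def sum_subtractf algebra_simps)
  have pt: "\<bar>(F \<eta> - F' \<eta>) * h \<eta>\<bar>
      \<le> A * (sqrt (F' \<eta>) - sqrt (F \<eta>))\<^sup>2 + 2 / A * (F \<eta> * (\<Phi> \<eta>)\<^sup>2 + F' \<eta> * (\<Phi> \<eta>)\<^sup>2)"
    if \<eta>: "\<eta> \<in> Om" for \<eta>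
  proof -
    have nn: "0 \<le> F \<eta>" "0 \<le> F' \<eta>"
      using \<eta> by (auto simp: F'_def intro!: F_nonneg exch_in_Omega)
    define d where "d = sqrt (F' \<eta>) - sqrt (F \<eta>)"
    define e where "e = (sqrt (F' \<eta>) + sqrt (F \<eta>)) * h \<eta>"
    have "(F \<eta> - F' \<eta>) * h \<eta> = - (d * e)"
      using nn by (simp add: d_def e_def algebra_simps)
    moreover have "\<bar>d * e\<bar> \<le> A * d\<^sup>2 + e\<^sup>2 / (4 * A)"
    proof -
      have "0 \<le> (2 * A * d - e)\<^sup>2" "0 \<le> (2 * A * d + e)\<^sup>2" by simp_all
      then have "\<bar>4 * A * (d * e)\<bar> \<le> 4 * A * (A * d\<^sup>2) + e\<^sup>2"
        by (simp add: power2_eq_square algebra_simps abs_le_iff)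
      then have "4 * A * \<bar>d * e\<bar> \<le> 4 * A * (A * d\<^sup>2 + e\<^sup>2 / (4 * A))"
        using A by (simp add: abs_mult algebra_simps)
      then show ?thesis using A by simp
    qed
    moreover have "e\<^sup>2 / (4 * A) \<le> 2 / A * (F \<eta> * (\<Phi> \<eta>)\<^sup>2 + F' \<eta> * (\<Phi> \<eta>)\<^sup>2)"
    proof -
      have "(sqrt (F' \<eta>) + sqrt (F \<eta>))\<^sup>2 \<le> 2 * (F \<eta> + F' \<eta>)"
      proof -
        have "0 \<le> (sqrt (F' \<eta>) - sqrt (F \<eta>))\<^sup>2" by simp
        then show ?thesis using nn by (simp add: power2_sum power2_diff)
      qed
      moreover have "(h \<eta>)\<^sup>2 \<le> 4 * (\<Phi> \<eta>)\<^sup>2"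
      proof -
        have "(grad \<eta> z)\<^sup>2 \<le> 4"
          using spin_at_values[OF \<eta> n_pos, of z] spin_at_values[OF \<eta> n_pos, of "z + 1"] by auto
        then have "(grad \<eta> z)\<^sup>2 * (\<Phi> \<eta>)\<^sup>2 \<le> 4 * (\<Phi> \<eta>)\<^sup>2"
          by (intro mult_right_mono) auto
        then show ?thesis by (simp add: h_def power_mult_distrib)
      qed
      ultimately have "e\<^sup>2 \<le> 2 * (F \<eta> + F' \<eta>) * (4 * (\<Phi> \<eta>)\<^sup>2)"
        unfolding e_def power_mult_distrib using nn by (intro mult_mono) auto
      then have "e\<^sup>2 / (4 * A) \<le> 2 * (F \<eta> + F' \<eta>) * (4 * (\<Phi> \<eta>)\<^sup>2) / (4 * A)"
        using A by (intro divide_right_mono) auto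
      also have "\<dots> = 2 / A * (F \<eta> * (\<Phi> \<eta>)\<^sup>2 + F' \<eta> * (\<Phi> \<eta>)\<^sup>2)"
        by (simp add: algebra_simps add_divide_distrib)
      finally show ?thesis .
    qed
    ultimately show ?thesis unfolding d_def by linarith
  qed
  have "\<bar>2 * E h\<bar> \<le> (\<Sum>\<eta>\<in>Om. \<bar>(F \<eta> - F' \<eta>) * h \<eta>\<bar>)"
    unfolding two by (rule sum_abs)
  also have "\<dots> \<le> (\<Sum>\<eta>\<in>Om. A * (sqrt (F' \<eta>) - sqrt (F \<eta>))\<^sup>2 + 2 / A * (F \<eta> * (\<Phi> \<eta>)\<^sup>2 + F' \<eta> * (\<Phi> \<eta>)\<^sup>2))"
    by (rule sum_mono) (rule pt)
  also have "\<dots> = A * bond_energy z + 2 / A * (E (\<lambda>\<eta>. (\<Phi> \<eta>)\<^sup>2) + (\<Sum>\<eta>\<in>Om. F' \<eta> * (\<Phi> \<eta>)\<^sup>2))"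
    by (simp only: sum.distrib bond_energy_def F'_def E_def sum_distrib_left[symmetric])
  also have "(\<Sum>\<eta>\<in>Om. F' \<eta> * (\<Phi> \<eta>)\<^sup>2) = (\<Sum>\<eta>\<in>Om. F (exch n z \<eta>) * (\<Phi> (exch n z \<eta>))\<^sup>2)"
    unfolding F'_def by (rule sum.cong) (auto simp: inv)
  also have "\<dots> = E (\<lambda>\<eta>. (\<Phi> \<eta>)\<^sup>2)"
    unfolding E_def by (rule sum_exch) simp
  finally show ?thesis by (simp add: h_def abs_mult)
qed

lemma gradient_bound:
  assumes inv: "\<And>\<eta> z. \<eta> \<in> Om \<Longrightarrow> z \<in> period \<Longrightarrow> \<Phi> z (exch n z \<eta>) = \<Phi> z \<eta>" and A: "A > 0"
  shows "\<bar>E (\<lambda>\<eta>. \<Sum>z\<in>period. grad \<eta> z * \<Phi> z \<eta>)\<bar>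
    \<le> A / 2 * energy + 2 / A * (\<Sum>z\<in>period. E (\<lambda>\<eta>. (\<Phi> z \<eta>)\<^sup>2))"
proof -
  have "\<bar>E (\<lambda>\<eta>. \<Sum>z\<in>period. grad \<eta> z * \<Phi> z \<eta>)\<bar>
      \<le> (\<Sum>z\<in>period. \<bar>E (\<lambda>\<eta>. grad \<eta> z * \<Phi> z \<eta>)\<bar>)"
    unfolding E_sum by (rule sum_abs)
  also have "\<dots> \<le> (\<Sum>z\<in>period. A / 2 * bond_energy z + 2 / A * E (\<lambda>\<eta>. (\<Phi> z \<eta>)\<^sup>2))"
    by (intro sum_mono bond_ibp inv A)
  also have "\<dots> = A / 2 * energy + 2 / A * (\<Sum>z\<in>period. E (\<lambda>\<eta>. (\<Phi> z \<eta>)\<^sup>2))"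
    by (simp add: sum.distrib energy_def sum_distrib_left)
  finally show ?thesis .
qed

text \<open>The symmetric part of \<open>\<psi>\<close> under the exchange at \<open>z\<close> may be moved into \<open>\<Phi> z\<close>; since \<open>\<bar>\<Phi> z\<bar> \<le> K n\<close>, taking
  \<open>A\<close> of order \<open>n\<^sup>3\<close> in the integration by parts lets the second moment of \<open>\<psi>\<close> be absorbed.\<close>

lemma square_bound:
  assumes inv: "\<And>\<eta> z. \<eta> \<in> Om \<Longrightarrow> z \<in> period \<Longrightarrow> \<Phi> z (exch n z \<eta>) = \<Phi> z \<eta>"
    and \<psi>: "\<And>\<eta>. \<eta> \<in> Om \<Longrightarrow> \<psi> \<eta> = flow \<Phi> \<eta>"
    and K: "K \<ge> 1"
    and \<Phi>_le: "\<And>\<eta> z. \<eta> \<in> Om \<Longrightarrow> z \<in> period \<Longrightarrow> \<bar>\<Phi> z \<eta>\<bar> \<le> K * real n"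
    and diff_le: "\<And>\<eta> z. \<eta> \<in> Om \<Longrightarrow> z \<in> period \<Longrightarrow> \<bar>incr \<psi> z \<eta>\<bar> \<le> K"
    and sum_le: "\<And>\<eta>. \<eta> \<in> Om \<Longrightarrow>
      \<bar>\<Sum>z\<in>period. grad \<eta> z * \<Phi> z \<eta> * incr \<psi> z \<eta>\<bar> \<le> K * real n"
  shows "E (\<lambda>\<eta>. (\<psi> \<eta>)\<^sup>2) \<le> 10 * K\<^sup>2 * real n * (mass + (real n)\<^sup>2 * energy)"
proof -
  define av where "av z \<eta> = (\<psi> \<eta> + \<psi> (exch n z \<eta>)) / 2" for z \<eta>
  \<comment> \<open>With the factor 8 the term
    \<open>2 / A * (K\<^sup>2 * real n ^ 3 * (2 * X))\<close> equals \<open>X / 2\<close> and can be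
    absorbed on the left.\<close>
  define A where "A = 8 * K\<^sup>2 * real n ^ 3"
  define X where "X = E (\<lambda>\<eta>. (\<psi> \<eta>)\<^sup>2)"
  have n1: "real n \<ge> 1" using n4 by simp
  have A0: "A > 0" using K n1 by (simp add: A_def)
  have "X = E (\<lambda>\<eta>. (\<Sum>z\<in>period. grad \<eta> z * (\<Phi> z \<eta> * av z \<eta>))
     + (1/2) * (\<Sum>z\<in>period. grad \<eta> z * \<Phi> z \<eta> * incr \<psi> z \<eta>))"
    unfolding X_def
  proof (rule E_cong)
    fix \<eta> assume \<eta>: "\<eta> \<in> Om"
    \<comment> \<open>One factor is expanded as a flow; the other is \<open>av\<close> plus half of
      \<open>incr\<close>, and only the \<open>av\<close> part is symmetric enough to be integrated
      by parts.\<close>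
    have "(\<psi> \<eta>)\<^sup>2 = (\<Sum>z\<in>period. grad \<eta> z * \<Phi> z \<eta> * \<psi> \<eta>)"
      unfolding power2_eq_square sum_distrib_right[symmetric] using \<psi>[OF \<eta>] by simp
    also have "\<dots> = (\<Sum>z\<in>period. grad \<eta> z * (\<Phi> z \<eta> * av z \<eta>)
        + (1/2) * (grad \<eta> z * \<Phi> z \<eta> * incr \<psi> z \<eta>))"
      by (rule sum.cong) (auto simp: av_def field_simps)
    finally show "(\<psi> \<eta>)\<^sup>2 = (\<Sum>z\<in>period. grad \<eta> z * (\<Phi> z \<eta> * av z \<eta>))
     + (1/2) * (\<Sum>z\<in>period. grad \<eta> z * \<Phi> z \<eta> * incr \<psi> z \<eta>)"
      by (simp add: sum.distrib sum_distrib_left)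
  qed
  also have "\<dots> = E (\<lambda>\<eta>. \<Sum>z\<in>period. grad \<eta> z * (\<Phi> z \<eta> * av z \<eta>))
     + (1/2) * E (\<lambda>\<eta>. \<Sum>z\<in>period. grad \<eta> z * \<Phi> z \<eta> * incr \<psi> z \<eta>)"
    by (simp only: E_add E_cmult)
  also have "\<dots> \<le> (A / 2 * energy + 2 / A * (\<Sum>z\<in>period. E (\<lambda>\<eta>. (\<Phi> z \<eta> * av z \<eta>)\<^sup>2))) + (1/2) * (K * real n * mass)"
  proof (intro add_mono mult_left_mono)
    have "\<bar>E (\<lambda>\<eta>. \<Sum>z\<in>period. grad \<eta> z * (\<Phi> z \<eta> * av z \<eta>))\<bar>
      \<le> A / 2 * energy + 2 / A * (\<Sum>z\<in>period. E (\<lambda>\<eta>. (\<Phi> z \<eta> * av z \<eta>)\<^sup>2))"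
      by (rule gradient_bound) (use A0 in \<open>auto simp: inv av_def exch_exch\<close>)
    then show "E (\<lambda>\<eta>. \<Sum>z\<in>period. grad \<eta> z * (\<Phi> z \<eta> * av z \<eta>))
      \<le> A / 2 * energy + 2 / A * (\<Sum>z\<in>period. E (\<lambda>\<eta>. (\<Phi> z \<eta> * av z \<eta>)\<^sup>2))" by linarith
    have "\<bar>E (\<lambda>\<eta>. \<Sum>z\<in>period. grad \<eta> z * \<Phi> z \<eta> * incr \<psi> z \<eta>)\<bar>
       \<le> E (\<lambda>\<eta>. K * real n)"
      by (rule abs_E_le) (rule sum_le)
    then show "E (\<lambda>\<eta>. \<Sum>z\<in>period. grad \<eta> z * \<Phi> z \<eta> * incr \<psi> z \<eta>)
      \<le> K * real n * mass" by (simp add: E_const)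
  qed simp
  also have "(\<Sum>z\<in>period. E (\<lambda>\<eta>. (\<Phi> z \<eta> * av z \<eta>)\<^sup>2)) \<le> (\<Sum>z\<in>period. (K * real n)\<^sup>2 * (2 * X + K\<^sup>2 / 2 * mass))"
  proof (rule sum_mono)
    fix z assume z: "z \<in> period"
    have "E (\<lambda>\<eta>. (\<Phi> z \<eta> * av z \<eta>)\<^sup>2) \<le> E (\<lambda>\<eta>. (K * real n)\<^sup>2 * (2 * (\<psi> \<eta>)\<^sup>2 + K\<^sup>2 / 2))"
    proof (rule E_mono)
      fix \<eta> assume \<eta>: "\<eta> \<in> Om"
      define d where "d = \<psi> \<eta> - \<psi> (exch n z \<eta>)"
      have "d\<^sup>2 \<le> K\<^sup>2" using diff_le[OF \<eta> z] K abs_le_square_iff[of d K] unfolding d_def[symmetric] by linarith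
      moreover have "(av z \<eta>)\<^sup>2 \<le> 2 * (\<psi> \<eta>)\<^sup>2 + d\<^sup>2 / 2"
      proof -
        have e: "av z \<eta> = \<psi> \<eta> - d / 2" by (simp add: av_def d_def field_simps)
        have "0 \<le> (\<psi> \<eta> + d / 2)\<^sup>2" by simp
        then show ?thesis unfolding e by (simp add: power2_eq_square algebra_simps)
      qed
      ultimately have 1: "(av z \<eta>)\<^sup>2 \<le> 2 * (\<psi> \<eta>)\<^sup>2 + K\<^sup>2 / 2" by linarith
      have 2: "(\<Phi> z \<eta>)\<^sup>2 \<le> (K * real n)\<^sup>2"
        using \<Phi>_le[OF \<eta> z] K by (subst abs_le_square_iff[symmetric]) simp
      show "(\<Phi> z \<eta> * av z \<eta>)\<^sup>2 \<le> (K * real n)\<^sup>2 * (2 * (\<psi> \<eta>)\<^sup>2 + K\<^sup>2 / 2)"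
        unfolding power_mult_distrib[of "\<Phi> z \<eta>"] by (intro mult_mono 1 2) auto
    qed
    also have "\<dots> = (K * real n)\<^sup>2 * (2 * X + K\<^sup>2 / 2 * mass)"
      by (simp only: E_cmult E_add E_const X_def)
    finally show "E (\<lambda>\<eta>. (\<Phi> z \<eta> * av z \<eta>)\<^sup>2) \<le> (K * real n)\<^sup>2 * (2 * X + K\<^sup>2 / 2 * mass)" .
  qed
  also have "(\<Sum>z\<in>period. (K * real n)\<^sup>2 * (2 * X + K\<^sup>2 / 2 * mass)) = K\<^sup>2 * real n ^ 3 * (2 * X + K\<^sup>2 / 2 * mass)"
    by (simp add: power2_eq_square power3_eq_cube mult_ac)
  finally have "X \<le> A / 2 * energy + 2 / A * (K\<^sup>2 * real n ^ 3 * (2 * X + K\<^sup>2 / 2 * mass)) + (1/2) * (K * real n * mass)"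
    using A0 by (simp add: divide_right_mono mult_left_mono)
  moreover have "2 / A * (K\<^sup>2 * real n ^ 3 * (2 * X + K\<^sup>2 / 2 * mass)) = X / 2 + K\<^sup>2 / 8 * mass"
    using K n1 by (simp add: A_def field_simps)
  ultimately have "X \<le> A * energy + K\<^sup>2 / 4 * mass + K * real n * mass" by linarith
  moreover have "K\<^sup>2 / 4 * mass \<le> K\<^sup>2 * real n * mass"
    using n1 K by (intro mult_right_mono mass_nonneg) (simp add: power2_eq_square)
  moreover have "K * real n * mass \<le> K\<^sup>2 * real n * mass"
    using n1 K by (intro mult_right_mono mass_nonneg) (auto simp: power2_eq_square)
  moreover have "A * energy = 8 * K\<^sup>2 * real n * ((real n)\<^sup>2 * energy)"
    by (simp add: A_def power2_eq_square power3_eq_cube)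
  moreover have "0 \<le> K\<^sup>2 * real n * ((real n)\<^sup>2 * energy)" "0 \<le> K\<^sup>2 * real n * mass"
    using K n1 by (auto intro!: mult_nonneg_nonneg energy_nonneg mass_nonneg)
  moreover have "10 * K\<^sup>2 * real n * (mass + (real n)\<^sup>2 * energy)
      = 10 * (K\<^sup>2 * real n * mass) + 10 * (K\<^sup>2 * real n * ((real n)\<^sup>2 * energy))"
    by (simp add: distrib_left)
  ultimately show ?thesis unfolding X_def[symmetric] by linarith
qed

end

section \<open>Second moments of weighted spin sums\<close>

lemma sum_int_period: "(\<Sum>i\<in>{0..<int n}. f i) = (\<Sum>j<n. f (int j))"
  by (rule sum.reindex_bij_witness[where i = int and j = nat]) auto

lemma sum_full_period:
  fixes q :: "int \<Rightarrow> real"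
  assumes "periodic n q"
  shows "(\<Sum>j=1..n. q (z + int j)) = (\<Sum>i\<in>{0..<int n}. q i)"
proof -
  have "(\<Sum>i\<in>{0..<int n}. q i) = (\<Sum>i\<in>{0..<int n}. q (i + (z + 1)))"
    by (rule sum_period_shift[OF assms, symmetric])
  also have "\<dots> = (\<Sum>j=1..n. q (z + int j))"
    by (rule sum.reindex_bij_witness[where i = "\<lambda>j. int j - 1" and j = "\<lambda>i. nat (i + 1)"])
       (auto simp: algebra_simps)
  finally show ?thesis by simp
qed

lemma sum_period_minus_one:
  fixes q :: "int \<Rightarrow> real"
  assumes "periodic n q" "n \<ge> 1"
  shows "(\<Sum>j=1..n - 1. q (z + int j)) = (\<Sum>i\<in>{0..<int n}. q i) - q z"
proof -
  obtain m where m: "n = Suc m" using assms(2) by (cases n) auto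
  have "q (z + int n) = q z" by (rule periodicD[OF assms(1)])
  then show ?thesis using sum_full_period[OF assms(1), of z] by (simp add: m)
qed

lemma sum_period_minus_two:
  fixes q :: "int \<Rightarrow> real"
  assumes "periodic n q" "n \<ge> 2"
  shows "(\<Sum>j=1..n - 2. q (z + int j)) = (\<Sum>i\<in>{0..<int n}. q i) - q z - q (z - 1)"
proof -
  obtain m where m: "n = Suc (Suc m)" using assms(2) by (metis add_2_eq_Suc le_Suc_ex)
  have "q ((z - 1) + int n) = q (z - 1)" by (rule periodicD[OF assms(1)])
  then have "q (z + int (Suc m)) = q (z - 1)" by (simp add: m algebra_simps)
  then show ?thesis using sum_period_minus_one[OF assms(1), of z] by (simp add: m)
qed

lemma sum_backward_diff:
  fixes q r :: "int \<Rightarrow> real"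
  assumes "periodic n q" "periodic n r"
  shows "(\<Sum>z\<in>{0..<int n}. (q z - q (z + 1)) * r z) = (\<Sum>z\<in>{0..<int n}. q z * (r z - r (z - 1)))"
proof -
  have "(\<Sum>z\<in>{0..<int n}. q (z + 1) * r (z + 1 - 1)) = (\<Sum>z\<in>{0..<int n}. q z * r (z - 1))"
    using sum_period_shift[of n "\<lambda>z. q z * r (z - 1)" 1] assms periodic_shift[OF assms(2), of "-1"]
    by (simp add: periodic_mult)
  then show ?thesis by (simp add: algebra_simps sum_subtractf)
qed

text \<open>The weights of \<open>correlation_identity\<close> as a periodic function of the site,
  so that the fields become sums over a full period. Here \<open>k\<close> is the distance from
  \<open>z + 1\<close> rightwards to \<open>i\<close>; the weight vanishes at \<open>k = 0\<close>
  and from \<open>k = N\<close> on.\<close>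

definition tri_weight :: "nat \<Rightarrow> nat \<Rightarrow> int \<Rightarrow> int \<Rightarrow> real" where
  "tri_weight n N z i = (let k = nat ((i - z - 1) mod int n) in
     if 1 \<le> k \<and> k < N then (real N - real k) / real N else 0)"

lemma periodic_tri_weight: "periodic n (tri_weight n N z)"
proof -
  have "(i + int n - z - 1) mod int n = (i - z - 1) mod int n" for i
    by (metis add.commute add_diff_eq mod_add_self1)
  then show ?thesis by (simp add: periodic_def tri_weight_def)
qed

lemma abs_tri_weight: "\<bar>tri_weight n N z i\<bar> \<le> 1"
  by (simp add: tri_weight_def Let_def abs_le_iff field_simps)

lemma tri_weight_nat:
  "j < n \<Longrightarrow> tri_weight n N z (int j + (z + 1)) = (if 1 \<le> j \<and> j < N then (real N - real j) / real N else 0)"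
  by (simp add: tri_weight_def)

lemma sum_tri_weight:
  assumes "periodic n q" "N \<le> n"
  shows "(\<Sum>j\<in>{1..<N}. (real N - real j) / real N * q (z + 1 + int j)) = (\<Sum>i\<in>{0..<int n}. tri_weight n N z i * q i)"
proof -
  have "(\<Sum>i\<in>{0..<int n}. tri_weight n N z i * q i) = (\<Sum>i\<in>{0..<int n}. tri_weight n N z (i + (z + 1)) * q (i + (z + 1)))"
    by (rule sum_period_shift[symmetric]) (intro periodic_mult periodic_tri_weight assms)
  also have "\<dots> = (\<Sum>j<n. tri_weight n N z (int j + (z + 1)) * q (int j + (z + 1)))"
    by (rule sum_int_period)
  also have "\<dots> = (\<Sum>j<n. if j \<in> {1..<N} then (real N - real j) / real N * q (z + 1 + int j) else 0)"
  proof (rule sum.cong)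
    fix j assume "j \<in> {..<n}"
    then have jn: "j < n" by simp
    have e: "z + 1 + int j = int j + (z + 1)" by simp
    show "tri_weight n N z (int j + (z + 1)) * q (int j + (z + 1))
        = (if j \<in> {1..<N} then (real N - real j) / real N * q (z + 1 + int j) else 0)"
      unfolding e tri_weight_nat[OF jn] by simp
  qed simp
  also have "\<dots> = (\<Sum>j\<in>{..<n} \<inter> {1..<N}. (real N - real j) / real N * q (z + 1 + int j))"
    by (rule sum.inter_restrict[symmetric]) simp
  also have "{..<n} \<inter> {1..<N} = {1..<N}" using assms(2) by auto
  finally show ?thesis by simp
qed

text \<open>There is one jump from 0 to a value below 1, followed by \<open>N - 1\<close> descents
  of size \<open>1 / N\<close>. Since \<open>N < n\<close>, the weight is already 0 when the period
  closes.\<close>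

lemma variation_tri_weight:
  assumes "1 \<le> N" "N < n"
  shows "(\<Sum>i\<in>{0..<int n}. \<bar>tri_weight n N z (i + 1) - tri_weight n N z i\<bar>) \<le> 2"
proof -
  let ?w = "\<lambda>j. tri_weight n N z (int j + (z + 1))"
  have per: "periodic n (\<lambda>i. \<bar>tri_weight n N z (i + 1) - tri_weight n N z i\<bar>)"
    using periodic_tri_weight[of n N z] periodic_shift[OF periodic_tri_weight[of n N z], of 1]
    by (simp add: periodic_def)
  have "(\<Sum>i\<in>{0..<int n}. \<bar>tri_weight n N z (i + 1) - tri_weight n N z i\<bar>)
     = (\<Sum>j<n. \<bar>tri_weight n N z (int j + (z + 1) + 1) - ?w j\<bar>)"
    by (subst sum_period_shift[OF per, of "z + 1", symmetric]) (rule sum_int_period)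
  also have "\<dots> \<le> (\<Sum>j<n. (if j = 0 then 1 else 0) + (if j \<in> {1..<N} then 1 / real N else 0))"
  proof (rule sum_mono)
    fix j assume j: "j \<in> {..<n}"
    show "\<bar>tri_weight n N z (int j + (z + 1) + 1) - ?w j\<bar>
        \<le> (if j = 0 then 1 else 0) + (if j \<in> {1..<N} then 1 / real N else 0)"
    proof (cases "Suc j < n")
      case True
      have e: "int j + (z + 1) + 1 = int (Suc j) + (z + 1)" by simp
      have jn: "j < n" using j by simp
      show ?thesis unfolding e tri_weight_nat[OF True] tri_weight_nat[OF jn]
      proof (cases "1 \<le> j \<and> j < N")
        case True
        then have "(if 1 \<le> Suc j \<and> Suc j < N then (real N - real (Suc j)) / real N else 0) = (real N - real j) / real N - 1 / real N"
          by (cases "Suc j = N") (auto simp: field_simps)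
        then show "\<bar>(if 1 \<le> Suc j \<and> Suc j < N then (real N - real (Suc j)) / real N else 0)
            - (if 1 \<le> j \<and> j < N then (real N - real j) / real N else 0)\<bar>
          \<le> (if j = 0 then 1 else 0) + (if j \<in> {1..<N} then 1 / real N else 0)"
          using True by simp
      next
        case False
        then show "\<bar>(if 1 \<le> Suc j \<and> Suc j < N then (real N - real (Suc j)) / real N else 0)
            - (if 1 \<le> j \<and> j < N then (real N - real j) / real N else 0)\<bar>
          \<le> (if j = 0 then 1 else 0) + (if j \<in> {1..<N} then 1 / real N else 0)"
          using assms by (auto simp: field_simps)
      qed
    next
      case False
      then have jn: "Suc j = n" using j by simp
      have wrap: "int j + (z + 1) + 1 = z + 1 + int n" using jn by auto
      have "tri_weight n N z (int j + (z + 1) + 1) = tri_weight n N z (int 0 + (z + 1))"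
        unfolding wrap periodicD[OF periodic_tri_weight] by simp
      also have "\<dots> = 0" using assms by (subst tri_weight_nat) auto
      finally show ?thesis using j jn assms by (subst tri_weight_nat) auto
    qed
  qed
  also have "\<dots> = 1 + (\<Sum>j\<in>{..<n} \<inter> {1..<N}. 1 / real N)"
    unfolding sum.distrib sum.inter_restrict[OF finite_lessThan] using assms by (simp add: sum.delta)
  also have "{..<n} \<inter> {1..<N} = {1..<N}" using assms by auto
  also have "1 + (\<Sum>j\<in>{1..<N}. 1 / real N) \<le> 2" using assms by (simp add: field_simps)
  finally show ?thesis .
qed

section \<open>Averages given the magnetization, and second moments of centred sums\<close>

context exclusion begin

definition S :: "(nat \<Rightarrow> nat) \<Rightarrow> real" where
  "S \<eta> = (\<Sum>i\<in>period. s \<eta> i)"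

definition Q1 :: "(nat \<Rightarrow> nat) \<Rightarrow> real" where
  "Q1 \<eta> = (\<Sum>i\<in>period. s \<eta> i * s \<eta> (i + 1))"

definition Q2 :: "(nat \<Rightarrow> nat) \<Rightarrow> real" where
  "Q2 \<eta> = (\<Sum>i\<in>period. s \<eta> i * s \<eta> (i + 2))"

definition T :: "(nat \<Rightarrow> nat) \<Rightarrow> real" where
  "T \<eta> = (\<Sum>i\<in>period. s \<eta> i * s \<eta> (i + 1) * s \<eta> (i + 2))"

text \<open>Mean of \<open>Q1\<close>, and of \<open>Q2\<close>, given \<open>S\<close> under the
  uniform measure: \<open>S\<^sup>2\<close> is \<open>n\<close> plus the sum over the
  \<open>n * (n - 1)\<close> ordered pairs of distinct sites, and \<open>n\<close> such pairs
  enter.\<close>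

definition avg2 :: "(nat \<Rightarrow> nat) \<Rightarrow> real" where
  "avg2 \<eta> = ((S \<eta>)\<^sup>2 - real n) / (real n - 1)"

text \<open>Mean of \<open>T\<close> given \<open>S\<close> under the uniform measure. Besides
  triples of distinct sites, \<open>S * Q1\<close> contains \<open>2 * S\<close>, from a site
  meeting one of the two neighbours.\<close>

definition avg3 :: "(nat \<Rightarrow> nat) \<Rightarrow> real" where
  "avg3 \<eta> = (S \<eta> * avg2 \<eta> - 2 * S \<eta>) / (real n - 2)"

definition bound :: real where "bound = mass + (real n)\<^sup>2 * energy"

lemma bound_nonneg: "0 \<le> bound"
  unfolding bound_def by (intro add_nonneg_nonneg mult_nonneg_nonneg mass_nonneg energy_nonneg) simp

lemma S_exch [simp]: "S (exch n z \<eta>) = S \<eta>"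
  using sum_spin_exch[OF n_ge2, of "\<lambda>_. 1" z \<eta>] by (simp add: S_def periodic_def)

lemma avg2_exch [simp]: "avg2 (exch n z \<eta>) = avg2 \<eta>"
  by (simp add: avg2_def)

lemma abs_S_le: "\<eta> \<in> Om \<Longrightarrow> \<bar>S \<eta>\<bar> \<le> real n"
  unfolding S_def by (rule order_trans[OF sum_abs]) (simp add: abs_spin_at)

lemma abs_diff_spin_le: "\<eta> \<in> Om \<Longrightarrow> \<bar>s \<eta> i - s \<eta> j\<bar> \<le> 2"
  using spin_at_values[OF _ n_pos, of \<eta> i] spin_at_values[OF _ n_pos, of \<eta> j] by auto

lemma spin_exch_other:
  assumes "2 \<le> j" "j < int n"
  shows "s (exch n z \<eta>) (z + j) = s \<eta> (z + j)"
proof -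
  have "kron n z (z + j) = 0" using kron_mult_neq[of j n z "z + j"] assms by (auto simp: kron_def)
  moreover have "kron n (z + 1) (z + j) = 0"
    using kron_mult_neq[of "j - 1" n "z + 1" "z + j"] assms by (auto simp: kron_def)
  ultimately show ?thesis by (simp add: spin_at_exch)
qed

lemma periodic_s [simp]: "periodic n (s \<eta>)"
  by (rule periodic_spin_at)

lemma abs_weighted_sum_le:
  assumes "\<And>i. \<bar>q i\<bar> \<le> 1"
  shows "\<bar>\<Sum>j\<in>{1..<N}. (real N - real j) / real N * q (z + int j)\<bar> \<le> real N"
proof -
  have "\<bar>\<Sum>j\<in>{1..<N}. (real N - real j) / real N * q (z + int j)\<bar>
     \<le> (\<Sum>j\<in>{1..<N}. \<bar>(real N - real j) / real N * q (z + int j)\<bar>)" by (rule sum_abs)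
  also have "\<dots> \<le> (\<Sum>j\<in>{1..<N}. 1)"
  proof (rule sum_mono)
    fix j assume "j \<in> {1..<N}"
    then have "\<bar>(real N - real j) / real N\<bar> \<le> 1" by (simp add: abs_le_iff field_simps)
    then show "\<bar>(real N - real j) / real N * q (z + int j)\<bar> \<le> 1"
      using assms[of "z + int j"] mult_le_one[of "\<bar>(real N - real j) / real N\<bar>" "\<bar>q (z + int j)\<bar>"]
      unfolding abs_mult by linarith
  qed
  also have "\<dots> \<le> real N" by simp
  finally show ?thesis .
qed

text \<open>The centred sum is a flow with deterministic coefficients \<open>V z\<close> of size at
  most \<open>n\<close>. An exchange at \<open>z\<close> changes it by a multiple of
  \<open>\<omega> (z + 1) - \<omega> z\<close>, so the bounded variation of \<open>\<omega>\<close>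
  keeps the sum demanded by \<open>square_bound\<close> of order \<open>n\<close> instead of its
  square.\<close>

lemma linear_bound:
  assumes \<omega>: "periodic n \<omega>" and b: "\<And>i. \<bar>\<omega> i\<bar> \<le> 1"
    and tv: "(\<Sum>i\<in>period. \<bar>\<omega> (i + 1) - \<omega> i\<bar>) \<le> 2"
  shows "E (\<lambda>\<eta>. ((\<Sum>i\<in>period. \<omega> i * s \<eta> i) - S \<eta> / real n * (\<Sum>i\<in>period. \<omega> i))\<^sup>2) \<le> 640 * real n * bound"
proof -
  define V where "V z = (\<Sum>j\<in>{1..<n}. (real n - real j) / real n * \<omega> (z + int j))" for z
  define \<psi> where "\<psi> \<eta> = (\<Sum>i\<in>period. \<omega> i * s \<eta> i) - S \<eta> / real n * (\<Sum>i\<in>period. \<omega> i)" for \<eta>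
  have V: "\<bar>V z\<bar> \<le> real n" for z unfolding V_def by (rule abs_weighted_sum_le[OF b])
  have diff: "incr \<psi> z \<eta> = grad \<eta> z * (\<omega> (z + 1) - \<omega> z)" for \<eta> z
    unfolding \<psi>_def using sum_spin_exch[OF n_ge2 \<omega>, of z \<eta>] by (simp add: algebra_simps)
  have "E (\<lambda>\<eta>. (\<psi> \<eta>)\<^sup>2) \<le> 10 * 8\<^sup>2 * real n * (mass + (real n)\<^sup>2 * energy)"
  proof (rule square_bound[where \<Phi> = "\<lambda>z \<eta>. V z"])
    fix \<eta> assume \<eta>: "\<eta> \<in> Om"
    have q: "periodic n (\<lambda>i. \<omega> (i - 1))" using periodic_shift[OF \<omega>, of "-1"] by simp
    \<comment> \<open>The average in \<open>correlation_identity\<close> is taken over a full turn,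
      so it factors into \<open>S \<eta>\<close> and the sum of \<open>\<omega>\<close>.\<close>
    have "(\<Sum>j=1..n. \<Sum>z\<in>period. s \<eta> z * \<omega> (z + int j - 1)) = (\<Sum>z\<in>period. s \<eta> z * (\<Sum>j=1..n. \<omega> (z + int j - 1)))"
      by (subst sum.swap) (simp add: sum_distrib_left)
    also have "\<dots> = S \<eta> * (\<Sum>i\<in>period. \<omega> i)"
      using sum_full_period[OF q] sum_period_shift[OF \<omega>, of "-1"] by (simp add: S_def sum_distrib_right)
    finally have c: "(\<Sum>j=1..n. \<Sum>z\<in>period. s \<eta> z * \<omega> (z + int j - 1)) = S \<eta> * (\<Sum>i\<in>period. \<omega> i)" .
    show "\<psi> \<eta> = (\<Sum>z\<in>period. grad \<eta> z * V z)"
      using correlation_identity[OF periodic_s[of \<eta>] q, of n] n4 unfolding c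
      by (simp add: V_def \<psi>_def algebra_simps)
    have "\<bar>\<Sum>z\<in>period. grad \<eta> z * V z * incr \<psi> z \<eta>\<bar>
       \<le> (\<Sum>z\<in>period. 4 * real n * \<bar>\<omega> (z + 1) - \<omega> z\<bar>)"
    proof (rule order_trans[OF sum_abs], rule sum_mono)
      fix z
      have "\<bar>grad \<eta> z\<bar> * \<bar>V z\<bar> * (\<bar>grad \<eta> z\<bar> * \<bar>\<omega> (z + 1) - \<omega> z\<bar>)
        \<le> 2 * real n * (2 * \<bar>\<omega> (z + 1) - \<omega> z\<bar>)"
        by (intro mult_mono abs_diff_spin_le \<eta> V) auto
      then show "\<bar>grad \<eta> z * V z * incr \<psi> z \<eta>\<bar> \<le> 4 * real n * \<bar>\<omega> (z + 1) - \<omega> z\<bar>"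
        unfolding diff abs_mult by simp
    qed
    also have "\<dots> \<le> 4 * real n * 2"
      unfolding sum_distrib_left[symmetric] by (intro mult_left_mono tv) simp
    finally show "\<bar>\<Sum>z\<in>period. grad \<eta> z * V z * incr \<psi> z \<eta>\<bar> \<le> 8 * real n"
      by simp
  next
    fix \<eta> z assume \<eta>: "\<eta> \<in> Om"
    have "\<bar>grad \<eta> z\<bar> * \<bar>\<omega> (z + 1) - \<omega> z\<bar> \<le> 2 * 2"
      using b[of z] b[of "z + 1"] by (intro mult_mono abs_diff_spin_le \<eta>) auto
    then show "\<bar>incr \<psi> z \<eta>\<bar> \<le> 8" unfolding diff abs_mult by simp
    show "\<bar>V z\<bar> \<le> 8 * real n" using V[of z] by simp
  qed auto
  then show ?thesis by (simp add: \<psi>_def bound_def)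
qed

text \<open>The quantity that \<open>correlation_identity\<close> compares with,
  \<open>(S \<eta> * lin \<eta> - W) / real m\<close>, is not yet a function of the magnetization.
  The deviation from it is bounded by \<open>square_bound\<close>; what is left is
  \<open>S \<eta> / real m\<close>, at most 2 in modulus, times a centred linear sum, which is the
  case of \<open>linear_bound\<close>.\<close>

lemma quadratic_bound:
  assumes \<omega>: "periodic n \<omega>" and b: "\<And>i. \<bar>\<omega> i\<bar> \<le> 1"
    and tv: "(\<Sum>i\<in>period. \<bar>\<omega> (i + 1) - \<omega> i\<bar>) \<le> 2"
  shows "E (\<lambda>\<eta>. ((\<Sum>i\<in>period. \<omega> i * (s \<eta> i * s \<eta> (i + 1))) - avg2 \<eta> / real n * (\<Sum>i\<in>period. \<omega> i))\<^sup>2)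
    \<le> 140000 * real n * bound"
proof -
  \<comment> \<open>Distances 1 to \<open>n - 1\<close> reach every site but the one of the first
    factor, whence the correction \<open>W\<close>. Stopping below \<open>m\<close> also keeps
    \<open>\<Phi> z\<close> off the sites \<open>z\<close> and \<open>z + 1\<close>.\<close>
  define m where "m = n - 1"
  have m: "real m = real n - 1" "m \<ge> 3" "real m > 0" "m < n" using n4 by (auto simp: m_def)
  define W where "W = (\<Sum>i\<in>period. \<omega> i)"
  define \<Phi> where "\<Phi> z \<eta> = (\<Sum>j\<in>{1..<m}. (real m - real j) / real m * (\<omega> (z + int j) * s \<eta> (z + int j + 1)))" for z \<eta>
  define lin where "lin \<eta> = (\<Sum>i\<in>period. \<omega> (i - 1) * s \<eta> i)" for \<eta>
  define \<psi> where "\<psi> \<eta> = (\<Sum>i\<in>period. \<omega> i * (s \<eta> i * s \<eta> (i + 1))) - (S \<eta> * lin \<eta> - W) / real m" for \<eta>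
  have \<omega>': "periodic n (\<lambda>i. \<omega> (i - 1))" using periodic_shift[OF \<omega>, of "-1"] by simp
  have W': "(\<Sum>i\<in>period. \<omega> (i - 1)) = W" using sum_period_shift[OF \<omega>, of "-1"] by (simp add: W_def)
  have tvper: "periodic n (\<lambda>i. \<bar>\<omega> (i + 1) - \<omega> i\<bar>)"
    using \<omega> periodic_shift[OF \<omega>, of 1] by (simp add: periodic_def)
  have tv': "(\<Sum>i\<in>period. \<bar>\<omega> (i + k + 1) - \<omega> (i + k)\<bar>) \<le> 2" for k
    using sum_period_shift[OF tvper, of k] tv by simp
  have r: "\<bar>\<omega> i * s \<eta> (i + 1)\<bar> \<le> 1" if "\<eta> \<in> Om" for i \<eta>
    unfolding abs_mult using b[of i] abs_spin_at[OF that n_pos] by simp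
  have \<Phi>_le: "\<bar>\<Phi> z \<eta>\<bar> \<le> real n" if "\<eta> \<in> Om" for z \<eta>
    using abs_weighted_sum_le[of "\<lambda>i. \<omega> i * s \<eta> (i + 1)" m z, OF r[OF that]] m by (simp add: \<Phi>_def)
  define G where "G z \<eta> = \<omega> (z - 1) * s \<eta> (z - 1) - \<omega> (z + 1) * s \<eta> (z + 2) - S \<eta> / real m * (\<omega> (z - 1) - \<omega> z)" for z \<eta>
  have diff: "incr \<psi> z \<eta> = - (grad \<eta> z * G z \<eta>)" for \<eta> z
  proof -
    have l: "lin (exch n z \<eta>) = lin \<eta> + grad \<eta> z * (\<omega> (z - 1) - \<omega> z)"
      using sum_spin_exch[OF n_ge2 \<omega>', of z \<eta>] by (simp add: lin_def)
    show ?thesis unfolding \<psi>_def sum_pair_exch[OF n_ge3 \<omega>] l S_exch G_def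
      by (simp add: diff_divide_distrib add_divide_distrib algebra_simps)
  qed
  have Sm: "\<bar>S \<eta> / real m\<bar> \<le> 2" if "\<eta> \<in> Om" for \<eta>
    using abs_S_le[OF that] m by (simp add: field_simps)
  have G_le: "\<bar>G z \<eta>\<bar> \<le> 6" if \<eta>: "\<eta> \<in> Om" for z \<eta>
  proof -
    have "\<bar>S \<eta> / real m * (\<omega> (z - 1) - \<omega> z)\<bar> \<le> 2 * 2"
      unfolding abs_mult using b[of z] b[of "z - 1"] by (intro mult_mono Sm \<eta>) auto
    moreover have "\<bar>\<omega> (z - 1) * s \<eta> (z - 1)\<bar> \<le> 1" "\<bar>\<omega> (z + 1) * s \<eta> (z + 2)\<bar> \<le> 1"
      unfolding abs_mult using b abs_spin_at[OF \<eta> n_pos] by auto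
    ultimately show ?thesis unfolding G_def by linarith
  qed
  have \<psi>_bound: "E (\<lambda>\<eta>. (\<psi> \<eta>)\<^sup>2) \<le> 10 * 80\<^sup>2 * real n * (mass + (real n)\<^sup>2 * energy)"
  proof (rule square_bound[where \<Phi> = \<Phi>])
    fix \<eta> assume \<eta>: "\<eta> \<in> Om"
    define q where "q i = \<omega> (i - 1) * s \<eta> i" for i
    have q: "periodic n q" unfolding q_def by (intro periodic_mult \<omega>' periodic_s)
    have "(\<Sum>j=1..m. \<Sum>z\<in>period. s \<eta> z * q (z + int j)) = (\<Sum>z\<in>period. s \<eta> z * (\<Sum>j=1..m. q (z + int j)))"
      by (subst sum.swap) (simp add: sum_distrib_left)
    also have "\<dots> = (\<Sum>z\<in>period. s \<eta> z * (lin \<eta> - q z))"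
      using sum_period_minus_one[OF q] by (simp add: m_def lin_def q_def)
    also have "\<dots> = (\<Sum>z\<in>period. s \<eta> z * lin \<eta> - \<omega> (z - 1))"
      using spin_at_sq[OF \<eta> n_pos] by (intro sum.cong) (auto simp: q_def algebra_simps)
    also have "\<dots> = S \<eta> * lin \<eta> - W"
      by (simp add: sum_subtractf W' S_def sum_distrib_right)
    finally have c: "(\<Sum>j=1..m. \<Sum>z\<in>period. s \<eta> z * q (z + int j)) = S \<eta> * lin \<eta> - W" .
    have "flow \<Phi> \<eta> = (\<Sum>z\<in>period. s \<eta> z * q (z + 1)) - (S \<eta> * lin \<eta> - W) / real m"
    proof -
      have "\<Phi> z \<eta> = (\<Sum>j\<in>{1..<m}. (real m - real j) / real m * q (z + 1 + int j))" for z
        unfolding \<Phi>_def q_def by (intro sum.cong refl) (simp add: ac_simps)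
      moreover have "1 \<le> m" using m by simp
      ultimately show ?thesis using correlation_identity[OF periodic_s[of \<eta>] q, of m] c by simp
    qed
    then show "\<psi> \<eta> = flow \<Phi> \<eta>"
      by (simp add: \<psi>_def q_def mult_ac)
    \<comment> \<open>The exchange current is a discrete gradient, \<open>2 (H z - H (z + 1))\<close>; summation by parts moves the
      difference onto \<open>\<Phi>\<close>, which varies slowly. Without this the sum would be of order \<open>n\<^sup>2\<close>.\<close>
    define H where "H z = s \<eta> (z - 1) + s \<eta> z + s \<eta> (z + 1) - s \<eta> (z - 1) * s \<eta> z * s \<eta> (z + 1)" for z
    define g where "g z = \<omega> (z - 1) * \<Phi> z \<eta>" for z
    have per\<Phi>: "periodic n (\<lambda>z. \<Phi> z \<eta>)"
    proof -
      have "\<omega> (z + int n + int j) = \<omega> (z + int j)" "s \<eta> (z + int n + int j + 1) = s \<eta> (z + int j + 1)" for z j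
        using periodicD[OF \<omega>, of "z + int j"] periodicD[OF periodic_s, of \<eta> "z + int j + 1"]
        by (simp_all add: algebra_simps)
      then show ?thesis by (simp add: periodic_def \<Phi>_def)
    qed
    have perg: "periodic n g" unfolding g_def by (intro periodic_mult \<omega>' per\<Phi>)
    have perH: "periodic n H"
    proof -
      have "s \<eta> (z + int n - 1) = s \<eta> (z - 1)" "s \<eta> (z + int n + 1) = s \<eta> (z + 1)" for z
        using periodicD[OF periodic_s, of \<eta> "z - 1"] periodicD[OF periodic_s, of \<eta> "z + 1"]
        by (simp_all add: algebra_simps)
      then show ?thesis using periodicD[OF periodic_s, of \<eta>] by (simp add: periodic_def H_def)
    qed
    have H4: "\<bar>H z\<bar> \<le> 4" for z
      using spin_at_values[OF \<eta> n_pos, of z] spin_at_values[OF \<eta> n_pos, of "z + 1"]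
        spin_at_values[OF \<eta> n_pos, of "z - 1"] by (auto simp: H_def)
    have sq: "(grad \<eta> z)\<^sup>2 * (s \<eta> (z - 1) - s \<eta> (z + 2)) = 2 * (H z - H (z + 1))" for z
      using spin_at_values[OF \<eta> n_pos, of z] spin_at_values[OF \<eta> n_pos, of "z + 1"]
      by (auto simp: H_def algebra_simps)
    \<comment> \<open>Moving the window by one site changes \<open>\<Phi>\<close> by a bounded
      amount although \<open>\<Phi>\<close> itself may have order \<open>n\<close>: the difference
      is again a sum of linear weights against differences.\<close>
    have step: "\<bar>\<Phi> z \<eta> - \<Phi> (z - 1) \<eta>\<bar> \<le> 2" for z
    proof -
      define C where "C j = - (\<omega> (z + int j - 1) * s \<eta> (z + int j))" for j :: nat
      have C1: "\<bar>C j\<bar> \<le> 1" for j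
        using r[OF \<eta>, of "z + int j - 1"] by (simp add: C_def)
      have "\<Phi> z \<eta> - \<Phi> (z - 1) \<eta> = (\<Sum>j\<in>{1..<m}. (real m - real j) / real m * (C j - C (Suc j)))"
        unfolding \<Phi>_def C_def sum_subtractf[symmetric]
        by (rule sum.cong) (auto simp: algebra_simps)
      also have "\<dots> = C 1 - (\<Sum>j=1..m. C j) / real m"
        by (rule sum_abel_linear_weights) (use m in auto)
      also have "\<bar>\<dots>\<bar> \<le> 1 + 1"
      proof -
        have "\<bar>\<Sum>j=1..m. C j\<bar> \<le> (\<Sum>j=1..m. 1)"
          by (rule order_trans[OF sum_abs]) (intro sum_mono C1)
        then have "\<bar>(\<Sum>j=1..m. C j) / real m\<bar> \<le> 1" using m by simp
        then show ?thesis using C1[of 1] by linarith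
      qed
      finally show ?thesis by simp
    qed
    have main: "\<bar>\<Sum>z\<in>period. 2 * (H z - H (z + 1)) * g z\<bar> \<le> 40 * real n"
    proof -
      have gg: "\<bar>g z - g (z - 1)\<bar> \<le> real n * \<bar>\<omega> (z + - 2 + 1) - \<omega> (z + - 2)\<bar> + 2" for z
      proof -
        have "g z - g (z - 1) = \<omega> (z - 1) * (\<Phi> z \<eta> - \<Phi> (z - 1) \<eta>) + (\<omega> (z - 1) - \<omega> (z - 2)) * \<Phi> (z - 1) \<eta>"
          by (simp add: g_def algebra_simps)
        moreover have "\<bar>\<omega> (z - 1) * (\<Phi> z \<eta> - \<Phi> (z - 1) \<eta>)\<bar> \<le> 1 * 2"
          unfolding abs_mult by (intro mult_mono b step) auto
        moreover have "\<bar>(\<omega> (z - 1) - \<omega> (z - 2)) * \<Phi> (z - 1) \<eta>\<bar> \<le> \<bar>\<omega> (z - 1) - \<omega> (z - 2)\<bar> * real n"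
          unfolding abs_mult by (intro mult_left_mono \<Phi>_le \<eta>) auto
        ultimately show ?thesis by (simp add: mult.commute)
      qed
      have "(\<Sum>z\<in>period. 2 * (H z - H (z + 1)) * g z) = 2 * (\<Sum>z\<in>period. H z * (g z - g (z - 1)))"
        unfolding sum_backward_diff[OF perH perg, symmetric] by (simp only: sum_distrib_left mult.assoc)
      moreover have "\<bar>\<Sum>z\<in>period. H z * (g z - g (z - 1))\<bar>
          \<le> (\<Sum>z\<in>period. 4 * (real n * \<bar>\<omega> (z + - 2 + 1) - \<omega> (z + - 2)\<bar> + 2))"
        by (rule order_trans[OF sum_abs], rule sum_mono, unfold abs_mult, intro mult_mono H4 gg) auto
      moreover have "\<dots> = 4 * (real n * (\<Sum>z\<in>period. \<bar>\<omega> (z + - 2 + 1) - \<omega> (z + - 2)\<bar>)) + 8 * real n"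
        by (simp add: sum.distrib sum_distrib_left algebra_simps)
      moreover have "real n * (\<Sum>z\<in>period. \<bar>\<omega> (z + - 2 + 1) - \<omega> (z + - 2)\<bar>) \<le> real n * 2"
        by (intro mult_left_mono tv') simp
      ultimately show ?thesis by linarith
    qed
    \<comment> \<open>Errors from giving both spins of the current the same weight
      \<open>\<omega> (z - 1)\<close>, and from the \<open>S\<close> term. Each carries a difference
      of \<open>\<omega>\<close>, so bounded variation makes their sums of order
      \<open>n\<close>.\<close>
    define e1 where "e1 z = (grad \<eta> z)\<^sup>2 * \<Phi> z \<eta> * s \<eta> (z + 2) * (\<omega> (z + 1) - \<omega> (z - 1))" for z
    define e2 where "e2 z = (grad \<eta> z)\<^sup>2 * \<Phi> z \<eta> * (S \<eta> / real m) * (\<omega> (z - 1) - \<omega> z)" for z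
    have d4: "\<bar>(grad \<eta> z)\<^sup>2\<bar> \<le> 4" for z
      using spin_at_values[OF \<eta> n_pos, of z] spin_at_values[OF \<eta> n_pos, of "z + 1"] by auto
    have e1: "\<bar>\<Sum>z\<in>period. e1 z\<bar> \<le> 16 * real n"
    proof -
      have "\<bar>\<Sum>z\<in>period. e1 z\<bar> \<le> (\<Sum>z\<in>period. 4 * real n * 1 * (\<bar>\<omega> (z + 0 + 1) - \<omega> (z + 0)\<bar> + \<bar>\<omega> (z + -1 + 1) - \<omega> (z + -1)\<bar>))"
        by (rule order_trans[OF sum_abs], rule sum_mono, unfold e1_def abs_mult, intro mult_mono d4 \<Phi>_le \<eta>)
           (auto simp: abs_spin_at[OF \<eta> n_pos])
      also have "\<dots> = 4 * real n * ((\<Sum>z\<in>period. \<bar>\<omega> (z + 0 + 1) - \<omega> (z + 0)\<bar>) + (\<Sum>z\<in>period. \<bar>\<omega> (z + -1 + 1) - \<omega> (z + -1)\<bar>))"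
        by (simp only: sum.distrib[symmetric] sum_distrib_left mult_1_right)
      also have "\<dots> \<le> 4 * real n * (2 + 2)"
        by (intro mult_left_mono add_mono tv') simp
      finally show ?thesis by simp
    qed
    have e2: "\<bar>\<Sum>z\<in>period. e2 z\<bar> \<le> 16 * real n"
    proof -
      have "\<bar>\<Sum>z\<in>period. e2 z\<bar> \<le> (\<Sum>z\<in>period. 4 * real n * 2 * \<bar>\<omega> (z + -1 + 1) - \<omega> (z + -1)\<bar>)"
        by (rule order_trans[OF sum_abs], rule sum_mono, unfold e2_def abs_mult[of _ "\<omega> _ - \<omega> _"] abs_mult[of _ "S \<eta> / real m"] abs_mult[of _ "\<Phi> _ \<eta>"], intro mult_mono d4 \<Phi>_le Sm \<eta>)
           (auto simp: abs_minus_commute)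
      also have "\<dots> = 4 * real n * 2 * (\<Sum>z\<in>period. \<bar>\<omega> (z + -1 + 1) - \<omega> (z + -1)\<bar>)"
        by (simp only: sum_distrib_left)
      also have "\<dots> \<le> 4 * real n * 2 * 2"
        by (intro mult_left_mono tv') simp
      finally show ?thesis by simp
    qed
    have split: "grad \<eta> z * \<Phi> z \<eta> * incr \<psi> z \<eta> = - (2 * (H z - H (z + 1)) * g z) + e1 z + e2 z" for z
    proof -
      have "grad \<eta> z * \<Phi> z \<eta> * incr \<psi> z \<eta>
        = - ((grad \<eta> z)\<^sup>2 * (s \<eta> (z - 1) - s \<eta> (z + 2)) * g z) + e1 z + e2 z"
        unfolding diff e1_def e2_def g_def G_def
        by (simp add: power2_eq_square algebra_simps add_divide_distrib diff_divide_distrib)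
      then show ?thesis unfolding sq .
    qed
    \<comment> \<open>The three parts give 40 + 16 + 16 = 72, rounded up to 80.\<close>
    show "\<bar>\<Sum>z\<in>period. grad \<eta> z * \<Phi> z \<eta> * incr \<psi> z \<eta>\<bar> \<le> 80 * real n"
      unfolding split sum.distrib sum_negf using main e1 e2 by linarith
  next
    fix \<eta> z assume \<eta>: "\<eta> \<in> Om"
    have "\<bar>grad \<eta> z\<bar> * \<bar>G z \<eta>\<bar> \<le> 2 * 6"
      by (intro mult_mono abs_diff_spin_le G_le \<eta>) auto
    then show "\<bar>incr \<psi> z \<eta>\<bar> \<le> 80" unfolding diff abs_minus_cancel abs_mult by simp
    show "\<bar>\<Phi> z \<eta>\<bar> \<le> 80 * real n" using \<Phi>_le[OF \<eta>, of z] by simp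
    have "s (exch n z \<eta>) (z + int j + 1) = s \<eta> (z + int j + 1)" if "j \<in> {1..<m}" for j
      using spin_exch_other[of "int j + 1" z \<eta>] that m by (simp add: add.assoc)
    then show "\<Phi> z (exch n z \<eta>) = \<Phi> z \<eta>" unfolding \<Phi>_def by (intro sum.cong) auto
  qed auto
  have lin_bound: "E (\<lambda>\<eta>. (lin \<eta> - S \<eta> / real n * W)\<^sup>2) \<le> 640 * real n * bound"
    using linear_bound[OF \<omega>' b] tv'[of "-1"] unfolding lin_def W' by simp
  have "E (\<lambda>\<eta>. ((\<Sum>i\<in>period. \<omega> i * (s \<eta> i * s \<eta> (i + 1))) - avg2 \<eta> / real n * W)\<^sup>2)
     \<le> E (\<lambda>\<eta>. 2 * (\<psi> \<eta>)\<^sup>2 + 8 * (lin \<eta> - S \<eta> / real n * W)\<^sup>2)"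
  proof (rule E_mono)
    fix \<eta> assume \<eta>: "\<eta> \<in> Om"
    define c where "c = S \<eta> / real m"
    define l where "l = lin \<eta> - S \<eta> / real n * W"
    have n0: "real n > 0" using n4 by simp
    have "(\<Sum>i\<in>period. \<omega> i * (s \<eta> i * s \<eta> (i + 1))) - avg2 \<eta> / real n * W = \<psi> \<eta> + c * l"
      unfolding \<psi>_def avg2_def c_def l_def m(1)[symmetric] using n0 m(3)
      by (simp add: field_simps power2_eq_square)
    moreover have "(\<psi> \<eta> + c * l)\<^sup>2 \<le> 2 * (\<psi> \<eta>)\<^sup>2 + 2 * (c * l)\<^sup>2"
    proof -
      have "0 \<le> (\<psi> \<eta> - c * l)\<^sup>2" by simp
      then show ?thesis by (simp add: power2_sum power2_diff)
    qed
    moreover have "(c * l)\<^sup>2 \<le> 4 * l\<^sup>2"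
    proof -
      have "c\<^sup>2 \<le> 2\<^sup>2" using Sm[OF \<eta>] unfolding c_def[symmetric] by (subst abs_le_square_iff[symmetric]) simp
      then show ?thesis unfolding power_mult_distrib by (intro mult_right_mono) auto
    qed
    ultimately show "((\<Sum>i\<in>period. \<omega> i * (s \<eta> i * s \<eta> (i + 1))) - avg2 \<eta> / real n * W)\<^sup>2
      \<le> 2 * (\<psi> \<eta>)\<^sup>2 + 8 * (lin \<eta> - S \<eta> / real n * W)\<^sup>2" unfolding l_def by simp
  qed
  also have "\<dots> = 2 * E (\<lambda>\<eta>. (\<psi> \<eta>)\<^sup>2) + 8 * E (\<lambda>\<eta>. (lin \<eta> - S \<eta> / real n * W)\<^sup>2)"
    by (simp only: E_add E_cmult)
  also have "\<dots> \<le> 2 * (64000 * (real n * bound)) + 8 * (640 * (real n * bound))"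
    using \<psi>_bound lin_bound unfolding bound_def[symmetric] by (intro add_mono mult_left_mono) auto
  also have "\<dots> \<le> 140000 * real n * bound"
    using mult_nonneg_nonneg[OF of_nat_0_le_iff[of n] bound_nonneg] unfolding mult.assoc by linarith
  finally show ?thesis unfolding W_def .
qed

end

section \<open>Replacement of local products by conditional averages\<close>

context exclusion begin

text \<open>Factors that pass through an exchange: test functions of the magnetization and the
  coefficients of the entropy production. The bound 1 is a normalization, and larger coefficients
  are rescaled before use.\<close>

definition invariant_weight :: "((nat \<Rightarrow> nat) \<Rightarrow> real) \<Rightarrow> bool" where
  "invariant_weight \<kappa> \<longleftrightarrow> (\<forall>\<eta>\<in>Om. \<bar>\<kappa> \<eta>\<bar> \<le> 1 \<and> (\<forall>z. \<kappa> (exch n z \<eta>) = \<kappa> \<eta>))"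

text \<open>Gradients sum to zero over a period, so an exchange-invariant centring \<open>c\<close>
  may be subtracted at no cost. Integration by parts with \<open>A\<close> equal to
  \<open>(real n)\<^sup>2\<close> weighs the energy as \<open>bound\<close> does, and its factor
  \<open>2 / (real n)\<^sup>2\<close> compensates \<open>n\<close> second moments of size
  \<open>B * real n * bound\<close>.\<close>

lemma centred_gradient_bound:
  assumes \<kappa>: "invariant_weight \<kappa>"
    and inv: "\<And>\<eta> z. \<eta> \<in> Om \<Longrightarrow> \<Phi> z (exch n z \<eta>) = \<Phi> z \<eta>"
    and c: "\<And>\<eta> z. \<eta> \<in> Om \<Longrightarrow> c (exch n z \<eta>) = c \<eta>"
    and B: "\<And>z. E (\<lambda>\<eta>. (\<Phi> z \<eta> - c \<eta>)\<^sup>2) \<le> B * real n * bound"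
  shows "\<bar>E (\<lambda>\<eta>. \<kappa> \<eta> * flow \<Phi> \<eta>)\<bar> \<le> (2 * B + 1) * bound"
proof -
  define \<Psi> where "\<Psi> z \<eta> = \<kappa> \<eta> * (\<Phi> z \<eta> - c \<eta>)" for z \<eta>
  have n0: "real n > 0" using n4 by simp
  have k: "\<bar>\<kappa> \<eta>\<bar> \<le> 1" "\<kappa> (exch n z \<eta>) = \<kappa> \<eta>" if "\<eta> \<in> Om" for \<eta> z
    using \<kappa> that by (auto simp: invariant_weight_def)
  have "E (\<lambda>\<eta>. \<kappa> \<eta> * flow \<Phi> \<eta>)
      = E (\<lambda>\<eta>. \<Sum>z\<in>period. grad \<eta> z * \<Psi> z \<eta>)"
  proof (rule E_cong)
    fix \<eta>
    have "(\<Sum>z\<in>period. grad \<eta> z) = 0"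
      using sum_period_shift[OF periodic_s, of \<eta> 1] by (simp add: sum_subtractf)
    then have "(\<Sum>z\<in>period. grad \<eta> z * (\<kappa> \<eta> * c \<eta>)) = 0"
      unfolding sum_distrib_right[symmetric] by simp
    moreover have "(\<Sum>z\<in>period. grad \<eta> z * \<Psi> z \<eta>)
        = (\<Sum>z\<in>period. \<kappa> \<eta> * (grad \<eta> z * \<Phi> z \<eta>))
          - (\<Sum>z\<in>period. grad \<eta> z * (\<kappa> \<eta> * c \<eta>))"
      unfolding sum_subtractf[symmetric] by (rule sum.cong) (auto simp: \<Psi>_def algebra_simps)
    ultimately show "\<kappa> \<eta> * flow \<Phi> \<eta>
        = (\<Sum>z\<in>period. grad \<eta> z * \<Psi> z \<eta>)"
      by (simp add: sum_distrib_left)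
  qed
  also have "\<bar>\<dots>\<bar> \<le> (real n)\<^sup>2 / 2 * energy + 2 / (real n)\<^sup>2 * (\<Sum>z\<in>period. E (\<lambda>\<eta>. (\<Psi> z \<eta>)\<^sup>2))"
    by (rule gradient_bound) (use n0 in \<open>auto simp: \<Psi>_def k inv c\<close>)
  finally have 1: "\<bar>E (\<lambda>\<eta>. \<kappa> \<eta> * flow \<Phi> \<eta>)\<bar>
      \<le> (real n)\<^sup>2 / 2 * energy + 2 / (real n)\<^sup>2 * (\<Sum>z\<in>period. E (\<lambda>\<eta>. (\<Psi> z \<eta>)\<^sup>2))" .
  have "(\<Sum>z\<in>period. E (\<lambda>\<eta>. (\<Psi> z \<eta>)\<^sup>2)) \<le> (\<Sum>z\<in>period. B * real n * bound)"
  proof (rule sum_mono)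
    fix z
    have "E (\<lambda>\<eta>. (\<Psi> z \<eta>)\<^sup>2) \<le> E (\<lambda>\<eta>. (\<Phi> z \<eta> - c \<eta>)\<^sup>2)"
    proof (rule E_mono)
      fix \<eta> assume "\<eta> \<in> Om"
      then have "(\<kappa> \<eta>)\<^sup>2 \<le> 1" using k(1) by (simp add: abs_square_le_1)
      then have "(\<kappa> \<eta>)\<^sup>2 * (\<Phi> z \<eta> - c \<eta>)\<^sup>2 \<le> 1 * (\<Phi> z \<eta> - c \<eta>)\<^sup>2" by (rule mult_right_mono) simp
      then show "(\<Psi> z \<eta>)\<^sup>2 \<le> (\<Phi> z \<eta> - c \<eta>)\<^sup>2" by (simp add: \<Psi>_def power_mult_distrib)
    qed
    then show "E (\<lambda>\<eta>. (\<Psi> z \<eta>)\<^sup>2) \<le> B * real n * bound" using B[of z] by linarith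
  qed
  also have "(\<Sum>z\<in>period. B * real n * bound) = (real n)\<^sup>2 * (B * bound)"
    by (simp add: power2_eq_square)
  finally have "2 / (real n)\<^sup>2 * (\<Sum>z\<in>period. E (\<lambda>\<eta>. (\<Psi> z \<eta>)\<^sup>2)) \<le> 2 / (real n)\<^sup>2 * ((real n)\<^sup>2 * (B * bound))"
    by (rule mult_left_mono) simp
  also have "\<dots> = 2 * (B * bound)"
  proof -
    have "2 / y * (y * x) = 2 * x" if "y \<noteq> 0" for x y :: real using that by simp
    then show ?thesis using n0 by (metis less_irrefl power_not_zero)
  qed
  finally have "\<bar>E (\<lambda>\<eta>. \<kappa> \<eta> * flow \<Phi> \<eta>)\<bar>
      \<le> (real n)\<^sup>2 / 2 * energy + 2 * (B * bound)"
    using 1 by linarith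
  moreover have "(real n)\<^sup>2 / 2 * energy \<le> bound"
    using mass_nonneg mult_nonneg_nonneg[OF _ energy_nonneg, of "(real n)\<^sup>2"] by (simp add: bound_def algebra_simps)
  ultimately show ?thesis by (simp add: algebra_simps)
qed

text \<open>The fields are triangular averages of single spins, so their second moments about the
  centring are those of \<open>linear_bound\<close>; the constant is 2 * 640 + 1, rounded
  up.\<close>

lemma E_pair:
  assumes \<kappa>: "invariant_weight \<kappa>"
  shows "\<bar>E (\<lambda>\<eta>. \<kappa> \<eta> * (Q1 \<eta> - avg2 \<eta>))\<bar> \<le> 1300 * bound"
proof -
  define m where "m = n - 1"
  have m: "real m = real n - 1" "1 \<le> m" "m < n" using n4 by (auto simp: m_def)
  define \<Phi> where "\<Phi> z \<eta> = (\<Sum>j\<in>{1..<m}. (real m - real j) / real m * s \<eta> (z + 1 + int j))" for z \<eta>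
  define w where "w = (\<Sum>j\<in>{1..<m}. (real m - real j) / real m)"
  have id: "Q1 \<eta> - avg2 \<eta> = flow \<Phi> \<eta>" if \<eta>: "\<eta> \<in> Om" for \<eta>
  proof -
    have "(\<Sum>j=1..m. \<Sum>z\<in>period. s \<eta> z * s \<eta> (z + int j)) = (\<Sum>z\<in>period. s \<eta> z * (\<Sum>j=1..m. s \<eta> (z + int j)))"
      by (subst sum.swap) (simp add: sum_distrib_left)
    also have "\<dots> = (\<Sum>z\<in>period. s \<eta> z * S \<eta> - 1)"
      unfolding m_def using sum_period_minus_one[OF periodic_s, of \<eta>] n4
      by (intro sum.cong) (auto simp: S_def right_diff_distrib spin_at_sq[OF \<eta> n_pos])
    also have "\<dots> = (S \<eta>)\<^sup>2 - real n"
      by (simp add: sum_subtractf sum_distrib_right[symmetric] power2_eq_square) (simp add: S_def)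
    finally have c: "(\<Sum>j=1..m. \<Sum>z\<in>period. s \<eta> z * s \<eta> (z + int j)) = (S \<eta>)\<^sup>2 - real n" .
    show ?thesis
      unfolding \<Phi>_def correlation_identity[OF periodic_s periodic_s m(2)] c Q1_def avg2_def m(1)[symmetric] ..
  qed
  have "\<bar>E (\<lambda>\<eta>. \<kappa> \<eta> * (Q1 \<eta> - avg2 \<eta>))\<bar> = \<bar>E (\<lambda>\<eta>. \<kappa> \<eta> * flow \<Phi> \<eta>)\<bar>"
    by (intro arg_cong[where f = abs] E_cong) (simp add: id)
  also have "\<dots> \<le> (2 * 640 + 1) * bound"
  proof (rule centred_gradient_bound[OF \<kappa>, where c = "\<lambda>\<eta>. S \<eta> / real n * w"])
    fix \<eta> z assume "\<eta> \<in> Om"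
    have "s (exch n z \<eta>) (z + 1 + int j) = s \<eta> (z + 1 + int j)" if "j \<in> {1..<m}" for j
      using spin_exch_other[of "1 + int j" z \<eta>] that m by (simp add: add.assoc)
    then show "\<Phi> z (exch n z \<eta>) = \<Phi> z \<eta>" unfolding \<Phi>_def by (intro sum.cong) auto
  next
    fix z
    have 1: "\<Phi> z \<eta> = (\<Sum>i\<in>period. tri_weight n m z i * s \<eta> i)" for \<eta>
      unfolding \<Phi>_def by (rule sum_tri_weight) (use m in auto)
    have 2: "w = (\<Sum>i\<in>period. tri_weight n m z i)"
      using sum_tri_weight[of n "\<lambda>_. 1" m z] m by (simp add: w_def periodic_def)
    show "E (\<lambda>\<eta>. (\<Phi> z \<eta> - S \<eta> / real n * w)\<^sup>2) \<le> 640 * real n * bound"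
      unfolding 1 2 by (rule linear_bound[OF periodic_tri_weight abs_tri_weight variation_tri_weight[OF m(2,3)]])
  qed simp
  also have "\<dots> \<le> 1300 * bound" using bound_nonneg by (intro mult_right_mono) auto
  finally show ?thesis .
qed

text \<open>\<open>Q2 - Q1\<close> is a flow whose coefficient is the single spin at
  \<open>z - 1\<close>; its trivial second moment suffices, and \<open>E_pair\<close> does the
  rest.\<close>

lemma E_next_pair:
  assumes \<kappa>: "invariant_weight \<kappa>"
  shows "\<bar>E (\<lambda>\<eta>. \<kappa> \<eta> * (Q2 \<eta> - avg2 \<eta>))\<bar> \<le> 1310 * bound"
proof -
  have id: "Q2 \<eta> - Q1 \<eta> = (\<Sum>z\<in>period. grad \<eta> z * s \<eta> (z - 1))" for \<eta>
  proof -
    have "periodic n (\<lambda>z. grad \<eta> z * s \<eta> (z - 1))"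
      using periodic_shift[OF periodic_s, of \<eta> 1] periodic_shift[OF periodic_s, of \<eta> "-1"] periodic_s[of \<eta>]
      by (simp add: periodic_def)
    from sum_period_shift[OF this, of 1] show ?thesis
      by (simp add: Q1_def Q2_def sum_subtractf algebra_simps)
  qed
  have "\<bar>E (\<lambda>\<eta>. \<kappa> \<eta> * (Q2 \<eta> - Q1 \<eta>))\<bar> \<le> (2 * 1 + 1) * bound"
    unfolding id
  proof (rule centred_gradient_bound[OF \<kappa>, where c = "\<lambda>_. 0"])
    fix \<eta> z
    \<comment> \<open>The left neighbour is reached by going \<open>n - 1\<close> sites to the
      right, the form in which \<open>spin_exch_other\<close> applies.\<close>
    have "z - 1 = z + (int n - 1) + - int n" by simp
    then have "s \<zeta> (z - 1) = s \<zeta> (z + (int n - 1))" for \<zeta>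
      using periodicD[OF periodic_s, of \<zeta> "z - 1"] by (simp add: algebra_simps)
    then show "s (exch n z \<eta>) (z - 1) = s \<eta> (z - 1)"
      using spin_exch_other[of "int n - 1" z \<eta>] n4 by simp
  next
    fix z
    have "E (\<lambda>\<eta>. (s \<eta> (z - 1) - 0)\<^sup>2) = E (\<lambda>\<eta>. 1)"
      by (rule E_cong) (simp add: power2_eq_square spin_at_sq)
    also have "\<dots> \<le> bound"
      using mult_nonneg_nonneg[OF _ energy_nonneg, of "(real n)\<^sup>2"] by (simp add: E_const bound_def)
    also have "\<dots> \<le> 1 * real n * bound"
      using bound_nonneg n4 mult_right_mono[of 1 "real n" bound] by simp
    finally show "E (\<lambda>\<eta>. (s \<eta> (z - 1) - 0)\<^sup>2) \<le> 1 * real n * bound" .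
  qed simp
  then have "\<bar>E (\<lambda>\<eta>. \<kappa> \<eta> * (Q2 \<eta> - Q1 \<eta>))\<bar> \<le> 3 * bound" by simp
  moreover have "E (\<lambda>\<eta>. \<kappa> \<eta> * (Q2 \<eta> - avg2 \<eta>)) = E (\<lambda>\<eta>. \<kappa> \<eta> * (Q2 \<eta> - Q1 \<eta>)) + E (\<lambda>\<eta>. \<kappa> \<eta> * (Q1 \<eta> - avg2 \<eta>))"
    unfolding E_add[symmetric] by (rule E_cong) (simp add: algebra_simps)
  ultimately show ?thesis using E_pair[OF \<kappa>] bound_nonneg by linarith
qed

text \<open>The gradient representation with pair products leads to
  \<open>(S \<eta> * Q1 \<eta> - 2 * S \<eta>) / real m\<close>, which still contains
  \<open>Q1\<close>. A second replacement removes it: the factor \<open>S \<eta> / real m\<close> is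
  exchange-invariant and, once halved, an admissible weight.\<close>

lemma E_triple:
  assumes \<kappa>: "invariant_weight \<kappa>"
  shows "\<bar>E (\<lambda>\<eta>. \<kappa> \<eta> * (T \<eta> - avg3 \<eta>))\<bar> \<le> 300000 * bound"
proof -
  \<comment> \<open>Of the \<open>n\<close> neighbouring pairs the two that contain \<open>z\<close>
    are left out, so distances 1 to \<open>n - 2\<close> remain.\<close>
  define m where "m = n - 2"
  have m: "real m = real n - 2" "1 \<le> m" "m < n" "m + 1 < n" "real m > 0" using n4 by (auto simp: m_def)
  define q where "q \<eta> i = s \<eta> i * s \<eta> (i + 1)" for \<eta> i
  have q: "periodic n (q \<eta>)" for \<eta>
    unfolding q_def by (intro periodic_mult periodic_shift periodic_s)
  define \<Phi> where "\<Phi> z \<eta> = (\<Sum>j\<in>{1..<m}. (real m - real j) / real m * q \<eta> (z + 1 + int j))" for z \<eta>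
  define w where "w = (\<Sum>j\<in>{1..<m}. (real m - real j) / real m)"
  have id: "T \<eta> - (S \<eta> * Q1 \<eta> - 2 * S \<eta>) / real m = flow \<Phi> \<eta>" if \<eta>: "\<eta> \<in> Om" for \<eta>
  proof -
    have e: "s \<eta> z * (\<Sum>j=1..m. q \<eta> (z + int j)) = s \<eta> z * Q1 \<eta> - s \<eta> (z + 1) - s \<eta> (z - 1)" for z
    proof -
      have "(\<Sum>j=1..m. q \<eta> (z + int j)) = Q1 \<eta> - q \<eta> z - q \<eta> (z - 1)"
        unfolding m_def using sum_period_minus_two[OF q, of \<eta>] by (simp add: Q1_def q_def)
      then show ?thesis using spin_at_sq[OF \<eta> n_pos, of z] by (simp add: q_def) algebra
    qed
    have "(\<Sum>j=1..m. \<Sum>z\<in>period. s \<eta> z * q \<eta> (z + int j)) = (\<Sum>z\<in>period. s \<eta> z * (\<Sum>j=1..m. q \<eta> (z + int j)))"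
      by (subst sum.swap) (simp add: sum_distrib_left)
    also have "\<dots> = (\<Sum>z\<in>period. s \<eta> z * Q1 \<eta>) - (\<Sum>z\<in>period. s \<eta> (z + 1)) - (\<Sum>z\<in>period. s \<eta> (z + - 1))"
      unfolding e by (simp add: sum_subtractf)
    also have "\<dots> = S \<eta> * Q1 \<eta> - 2 * S \<eta>"
      unfolding sum_period_shift[OF periodic_s] sum_distrib_right[symmetric] by (simp add: S_def)
    finally have c: "(\<Sum>j=1..m. \<Sum>z\<in>period. s \<eta> z * q \<eta> (z + int j)) = S \<eta> * Q1 \<eta> - 2 * S \<eta>" .
    have "T \<eta> = (\<Sum>z\<in>period. s \<eta> z * q \<eta> (z + 1))"
      by (simp add: T_def q_def mult.assoc add.assoc)
    then show ?thesis
      unfolding \<Phi>_def correlation_identity[OF periodic_s q m(2)] c by simp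
  qed
  have "\<bar>E (\<lambda>\<eta>. \<kappa> \<eta> * (T \<eta> - (S \<eta> * Q1 \<eta> - 2 * S \<eta>) / real m))\<bar>
      = \<bar>E (\<lambda>\<eta>. \<kappa> \<eta> * flow \<Phi> \<eta>)\<bar>"
    by (intro arg_cong[where f = abs] E_cong) (simp add: id)
  also have "\<dots> \<le> (2 * 140000 + 1) * bound"
  proof (rule centred_gradient_bound[OF \<kappa>, where c = "\<lambda>\<eta>. avg2 \<eta> / real n * w"])
    fix \<eta> z assume "\<eta> \<in> Om"
    have "s (exch n z \<eta>) (z + 1 + int j) = s \<eta> (z + 1 + int j)" if "j \<in> {1..<m}" for j
      using spin_exch_other[of "1 + int j" z \<eta>] that m by (simp add: add.assoc)
    moreover have "s (exch n z \<eta>) (z + 1 + int j + 1) = s \<eta> (z + 1 + int j + 1)" if "j \<in> {1..<m}" for j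
      using spin_exch_other[of "2 + int j" z \<eta>] that m by (simp add: algebra_simps)
    ultimately show "\<Phi> z (exch n z \<eta>) = \<Phi> z \<eta>" unfolding \<Phi>_def q_def by (intro sum.cong) auto
  next
    fix z
    have 1: "\<Phi> z \<eta> = (\<Sum>i\<in>period. tri_weight n m z i * (s \<eta> i * s \<eta> (i + 1)))" for \<eta>
      unfolding \<Phi>_def q_def[symmetric] by (rule sum_tri_weight) (use m q in auto)
    have 2: "w = (\<Sum>i\<in>period. tri_weight n m z i)"
      using sum_tri_weight[of n "\<lambda>_. 1" m z] m by (simp add: w_def periodic_def)
    show "E (\<lambda>\<eta>. (\<Phi> z \<eta> - avg2 \<eta> / real n * w)\<^sup>2) \<le> 140000 * real n * bound"
      unfolding 1 2 by (rule quadratic_bound[OF periodic_tri_weight abs_tri_weight variation_tri_weight[OF m(2,3)]])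
  qed simp
  finally have 1: "\<bar>E (\<lambda>\<eta>. \<kappa> \<eta> * (T \<eta> - (S \<eta> * Q1 \<eta> - 2 * S \<eta>) / real m))\<bar> \<le> 280001 * bound" by simp
  define \<kappa>' where "\<kappa>' \<eta> = \<kappa> \<eta> * (S \<eta> / (2 * real m))" for \<eta>
  have "invariant_weight \<kappa>'"
    unfolding invariant_weight_def
  proof (intro ballI conjI allI)
    fix \<eta> z assume \<eta>: "\<eta> \<in> Om"
    have "\<bar>S \<eta> / (2 * real m)\<bar> \<le> 1"
      using abs_S_le[OF \<eta>] m n4 by (simp add: field_simps)
    then show "\<bar>\<kappa>' \<eta>\<bar> \<le> 1" using \<kappa> \<eta> unfolding \<kappa>'_def abs_mult invariant_weight_def by (intro mult_le_one) auto
    show "\<kappa>' (exch n z \<eta>) = \<kappa>' \<eta>" using \<kappa> \<eta> by (simp add: \<kappa>'_def invariant_weight_def)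
  qed
  from E_pair[OF this] have 2: "\<bar>E (\<lambda>\<eta>. \<kappa>' \<eta> * (Q1 \<eta> - avg2 \<eta>))\<bar> \<le> 1300 * bound" .
  have "E (\<lambda>\<eta>. \<kappa> \<eta> * (T \<eta> - avg3 \<eta>)) = E (\<lambda>\<eta>. \<kappa> \<eta> * (T \<eta> - (S \<eta> * Q1 \<eta> - 2 * S \<eta>) / real m))
      + 2 * E (\<lambda>\<eta>. \<kappa>' \<eta> * (Q1 \<eta> - avg2 \<eta>))"
    unfolding E_add[symmetric] E_cmult[symmetric] avg3_def \<kappa>'_def m(1)[symmetric]
    by (rule E_cong) (use m(5) in \<open>simp add: field_simps\<close>)
  then show ?thesis using 1 2 bound_nonneg by linarith
qed

end

section \<open>The invariant distribution\<close>

lemma exch_nat: "x < n \<Longrightarrow> exch n (int x) \<eta> = exchange n x \<eta>"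
  by (simp add: exch_def)

lemma exchange_in_Omega: "\<eta> \<in> Omega n \<Longrightarrow> x < n \<Longrightarrow> exchange n x \<eta> \<in> Omega n"
  using exch_in_Omega[of \<eta> n "int x"] by (simp add: exch_nat)

lemma flip_in_Omega:
  assumes "\<eta> \<in> Omega n" "x < n"
  shows "flip x \<eta> \<in> Omega n"
proof -
  have "flip x \<eta> y \<in> {0, 1}" if "y < n" for y
    using Omega_values[OF assms(1) that] by (auto simp: flip_def)
  moreover have "flip x \<eta> y = undefined" if "\<not> y < n" for y
    using that assms by (auto simp: flip_def Omega_def PiE_def extensional_def)
  ultimately show ?thesis unfolding Omega_def PiE_def extensional_def by auto
qed

lemma flip_flip: "\<eta> \<in> Omega n \<Longrightarrow> x < n \<Longrightarrow> flip x (flip x \<eta>) = \<eta>"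
  using Omega_values[of \<eta> n x] by (auto simp: flip_def)

lemma sum_flip:
  assumes "x < n"
  shows "(\<Sum>\<eta>\<in>Omega n. g (flip x \<eta>)) = (\<Sum>\<eta>\<in>Omega n. g \<eta>)"
  by (rule sum.reindex_bij_witness[where i = "flip x" and j = "flip x"])
     (use assms in \<open>auto simp: flip_flip flip_in_Omega\<close>)

lemma Omega_eqI:
  "\<eta> \<in> Omega n \<Longrightarrow> \<zeta> \<in> Omega n \<Longrightarrow> (\<And>x. x < n \<Longrightarrow> \<eta> x = \<zeta> x) \<Longrightarrow> \<eta> = \<zeta>"
  unfolding Omega_def by (rule PiE_ext) auto

lemma Omega_nonempty: "Omega n \<noteq> {}"
  by (simp add: Omega_def PiE_eq_empty_iff)

lemma spin_values: "\<eta> \<in> Omega n \<Longrightarrow> x < n \<Longrightarrow> spin \<eta> x = 1 \<or> spin \<eta> x = -1"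
  using Omega_values[of \<eta> n x] by (auto simp: spin_def)

text \<open>Since squares of spins are 1, the rate is
  \<open>(1 - g * s * s') * (1 - g * s * s'')\<close> with \<open>s\<close> the spin at
  \<open>x\<close> and \<open>s'\<close>, \<open>s''\<close> its neighbours. It lies between
  \<open>(1 - g)\<^sup>2\<close> and \<open>(1 + g)\<^sup>2\<close>.\<close>

lemma rate_bounds:
  assumes "\<eta> \<in> Omega n" "x < n" "0 < gam \<theta> n" "gam \<theta> n < 1"
  shows "(1 - gam \<theta> n)\<^sup>2 \<le> rate \<theta> n x \<eta>" and "rate \<theta> n x \<eta> \<le> 4"
proof -
  define g where "g = gam \<theta> n"
  have nb: "left_nb n x < n" "right_nb n x < n" using assms by (auto simp: left_nb_def right_nb_def)
  have "0 < g" "g < 1" using assms by (auto simp: g_def)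
  define h where "h = g * g"
  have h: "0 \<le> h" "h \<le> g" using \<open>0 < g\<close> \<open>g < 1\<close> by (auto simp: h_def mult_left_le)
  have sq: "(1 - g)\<^sup>2 = 1 - 2 * g + h" "g\<^sup>2 = h" by (auto simp: h_def power2_eq_square algebra_simps)
  have "(1 - g)\<^sup>2 \<le> rate \<theta> n x \<eta> \<and> rate \<theta> n x \<eta> \<le> 4"
    unfolding rate_def g_def[symmetric] sq
    using spin_values[OF assms(1,2)] spin_values[OF assms(1) nb(1)] spin_values[OF assms(1) nb(2)] h \<open>0 < g\<close> \<open>g < 1\<close>
    by auto
  then show "(1 - gam \<theta> n)\<^sup>2 \<le> rate \<theta> n x \<eta>" "rate \<theta> n x \<eta> \<le> 4" by (auto simp: g_def)
qed

section \<open>The uniformized chain and its unique stationary weight\<close>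

locale chain =
  fixes \<theta> a :: real and n :: nat
  assumes a_pos: "a > 0" and n_pos: "n > 0" and gam_pos: "0 < gam \<theta> n" and gam_less: "gam \<theta> n < 1"
begin

abbreviation "Om \<equiv> Omega n"
abbreviation "c \<equiv> rate \<theta> n"
abbreviation "L \<equiv> generator \<theta> a n"

lemma L_cong:
  assumes "\<And>\<eta>. \<eta> \<in> Om \<Longrightarrow> f \<eta> = g \<eta>" "\<eta> \<in> Om"
  shows "L f \<eta> = L g \<eta>"
  using assms by (simp add: generator_def L_ex_def L_G_def exchange_in_Omega flip_in_Omega)

lemma L_sum: "L (\<lambda>\<eta>. \<Sum>\<zeta>\<in>A. b \<zeta> * g \<zeta> \<eta>) \<eta> = (\<Sum>\<zeta>\<in>A. b \<zeta> * L (g \<zeta>) \<eta>)"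
proof -
  have ex: "L_ex n (\<lambda>\<eta>. \<Sum>\<zeta>\<in>A. b \<zeta> * g \<zeta> \<eta>) \<eta> = (\<Sum>\<zeta>\<in>A. b \<zeta> * L_ex n (g \<zeta>) \<eta>)"
    unfolding L_ex_def sum_distrib_left
    by (subst sum.swap) (simp add: sum_subtractf right_diff_distrib)
  have gl: "L_G \<theta> n (\<lambda>\<eta>. \<Sum>\<zeta>\<in>A. b \<zeta> * g \<zeta> \<eta>) \<eta> = (\<Sum>\<zeta>\<in>A. b \<zeta> * L_G \<theta> n (g \<zeta>) \<eta>)"
    unfolding L_G_def sum_distrib_left
    by (subst sum.swap) (simp add: sum_subtractf right_diff_distrib sum_distrib_left mult_ac)
  show ?thesis unfolding generator_def ex gl
    by (simp add: sum_distrib_left sum.distrib distrib_left mult_ac)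
qed

text \<open>A bound for the total jump rate, \<open>n\<close> exchanges at rate
  \<open>(real n)\<^sup>2\<close> and \<open>n\<close> flips at rate at most \<open>4 * a\<close>,
  enlarged by the minimal flip rate. The enlargement gives every configuration a holding probability
  of at least \<open>delta\<close> under \<open>step\<close>, the same lower bound as for each
  flip.\<close>

definition lam :: real where
  "lam = real n ^ 3 + 4 * a * real n + a * (1 - gam \<theta> n)\<^sup>2"

definition delta :: real where
  "delta = a * (1 - gam \<theta> n)\<^sup>2 / lam"

definition step :: "((nat \<Rightarrow> nat) \<Rightarrow> real) \<Rightarrow> (nat \<Rightarrow> nat) \<Rightarrow> real" where
  "step f \<eta> = f \<eta> + L f \<eta> / lam"

lemma lam_pos: "lam > 0"
  using a_pos n_pos by (simp add: lam_def add_pos_nonneg)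

lemma delta_pos: "delta > 0"
  using a_pos gam_less lam_pos by (simp add: delta_def)

lemma delta_le_1: "delta \<le> 1"
  using a_pos lam_pos by (simp add: delta_def lam_def field_simps)

lemma step_cong: "(\<And>\<eta>. \<eta> \<in> Om \<Longrightarrow> f \<eta> = g \<eta>) \<Longrightarrow> \<eta> \<in> Om \<Longrightarrow> step f \<eta> = step g \<eta>"
  using L_cong[of f g] by (simp add: step_def)

lemma step_sum: "step (\<lambda>\<eta>. \<Sum>\<zeta>\<in>A. b \<zeta> * g \<zeta> \<eta>) = (\<lambda>\<eta>. \<Sum>\<zeta>\<in>A. b \<zeta> * step (g \<zeta>) \<eta>)"
  by (rule ext) (simp add: step_def L_sum sum.distrib distrib_left sum_divide_distrib)

lemma step_uminus: "step (\<lambda>\<eta>. - f \<eta>) = (\<lambda>\<eta>. - step f \<eta>)"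
  using step_sum[of "\<lambda>_. -1" "\<lambda>_. f" "{0::nat}"] by simp

text \<open>\<open>lam * (step f \<eta> - m)\<close> combines values of \<open>f - m\<close> with
  nonnegative coefficients, and those at \<open>\<eta>\<close> and at each single flip are at least
  \<open>a * (1 - gam \<theta> n)\<^sup>2\<close>. Expressed through a lower bound \<open>m\<close>
  of \<open>f\<close>, the minorization iterates without transition matrices.\<close>

lemma step_lower:
  assumes f: "\<And>\<eta>. \<eta> \<in> Om \<Longrightarrow> m \<le> f \<eta>" and \<eta>: "\<eta> \<in> Om" and \<zeta>: "\<zeta> = \<eta> \<or> (\<exists>x<n. \<zeta> = flip x \<eta>)"
  shows "m + delta * (f \<zeta> - m) \<le> step f \<eta>"
proof -
  define A where "A = (\<Sum>x<n. f (exchange n x \<eta>) - m)"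
  define B where "B = (\<Sum>x<n. c x \<eta> * (f (flip x \<eta>) - m))"
  define C where "C = (\<Sum>x<n. c x \<eta>)"
  have L1: "L_ex n f \<eta> = A - real n * (f \<eta> - m)"
    by (simp add: L_ex_def A_def sum_subtractf algebra_simps)
  have L2: "L_G \<theta> n f \<eta> = B - C * (f \<eta> - m)"
    unfolding L_G_def B_def C_def sum_distrib_right sum_subtractf[symmetric]
    by (rule sum.cong) (auto simp: algebra_simps)
  have "lam * (step f \<eta> - m) = lam * (f \<eta> - m) + ((real n)\<^sup>2 * (A - real n * (f \<eta> - m)) + a * (B - C * (f \<eta> - m)))"
  proof -
    have "lam * (step f \<eta> - m) = lam * (f \<eta> - m) + L f \<eta>"
      using lam_pos by (simp add: step_def field_simps)
    then show ?thesis by (simp add: generator_def L1 L2)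
  qed
  also have "\<dots> = (a * (1 - gam \<theta> n)\<^sup>2 + a * (4 * real n - C)) * (f \<eta> - m) + (real n)\<^sup>2 * A + a * B"
    by (simp add: lam_def algebra_simps power2_eq_square power3_eq_cube)
  finally have eq: "lam * (step f \<eta> - m) = \<dots>" .
  have A: "0 \<le> A" unfolding A_def by (rule sum_nonneg) (use f \<eta> in \<open>auto simp: exchange_in_Omega\<close>)
  have cnn: "0 \<le> c x \<eta>" if "x < n" for x
    using rate_bounds(1)[OF \<eta> that gam_pos gam_less] zero_le_power2[of "1 - gam \<theta> n"] by linarith
  have tm: "0 \<le> c x \<eta> * (f (flip x \<eta>) - m)" if "x < n" for x
    using cnn[OF that] f[OF flip_in_Omega[OF \<eta> that]] by simp
  have B: "0 \<le> B" unfolding B_def by (rule sum_nonneg) (use tm in auto)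
  have "C \<le> (\<Sum>x<n. 4)" unfolding C_def
    by (rule sum_mono) (use rate_bounds(2)[OF \<eta> _ gam_pos gam_less] in auto)
  then have C: "0 \<le> 4 * real n - C" by simp
  have fm: "0 \<le> f \<eta> - m" using f[OF \<eta>] by simp
  have "a * (1 - gam \<theta> n)\<^sup>2 * (f \<zeta> - m) \<le> lam * (step f \<eta> - m)"
    using \<zeta>
  proof
    assume "\<zeta> = \<eta>"
    have "0 \<le> a * (4 * real n - C) * (f \<eta> - m) + (real n)\<^sup>2 * A + a * B"
      using A B C fm a_pos by (intro add_nonneg_nonneg mult_nonneg_nonneg) auto
    then show ?thesis unfolding eq \<open>\<zeta> = \<eta>\<close> by (simp add: algebra_simps)
  next
    assume "\<exists>x<n. \<zeta> = flip x \<eta>"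
    then obtain x where x: "x < n" "\<zeta> = flip x \<eta>" by blast
    have "(1 - gam \<theta> n)\<^sup>2 * (f \<zeta> - m) \<le> c x \<eta> * (f (flip x \<eta>) - m)"
      unfolding x(2) using f[OF flip_in_Omega[OF \<eta> x(1)]]
      by (intro mult_right_mono rate_bounds(1)[OF \<eta> x(1) gam_pos gam_less]) auto
    also have "\<dots> \<le> B"
      unfolding B_def using x(1) tm by (intro member_le_sum) auto
    finally have "a * ((1 - gam \<theta> n)\<^sup>2 * (f \<zeta> - m)) \<le> a * B" using a_pos by simp
    moreover have "0 \<le> (a * (1 - gam \<theta> n)\<^sup>2 + a * (4 * real n - C)) * (f \<eta> - m) + (real n)\<^sup>2 * A"
      using A C fm a_pos by (intro add_nonneg_nonneg mult_nonneg_nonneg) auto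
    ultimately show ?thesis unfolding eq by (simp add: mult.assoc)
  qed
  then have "a * (1 - gam \<theta> n)\<^sup>2 * (f \<zeta> - m) / lam \<le> step f \<eta> - m"
    using lam_pos by (simp add: pos_divide_le_eq mult.commute)
  then show ?thesis by (simp add: delta_def)
qed

lemma step_ge:
  assumes f: "\<And>\<eta>. \<eta> \<in> Om \<Longrightarrow> m \<le> f \<eta>" and \<eta>: "\<eta> \<in> Om"
  shows "m \<le> step f \<eta>"
proof -
  have "0 \<le> delta * (f \<eta> - m)" using delta_pos f[OF \<eta>] by simp
  moreover have "m + delta * (f \<eta> - m) \<le> step f \<eta>"
    by (rule step_lower) (use f \<eta> in auto)
  ultimately show ?thesis by linarith
qed

text \<open>Doeblin minorization: only sites below \<open>k\<close> may disagree with
  \<open>\<zeta>\<close>, and each step repairs one site by a flip or holds if it already agrees. In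
  \<open>n\<close> steps every configuration is reached from every other with probability at least
  \<open>delta ^ n\<close>.\<close>

lemma iterate_lower:
  assumes f: "\<And>\<eta>. \<eta> \<in> Om \<Longrightarrow> m \<le> f \<eta>" and \<zeta>: "\<zeta> \<in> Om"
  shows "k \<le> n \<Longrightarrow> \<eta> \<in> Om \<Longrightarrow> (\<And>x. k \<le> x \<Longrightarrow> x < n \<Longrightarrow> \<eta> x = \<zeta> x)
    \<Longrightarrow> m + delta ^ k * (f \<zeta> - m) \<le> (step ^^ k) f \<eta>"
proof (induction k arbitrary: \<eta>)
  case 0
  then have "\<eta> = \<zeta>" using \<zeta> by (intro Omega_eqI) auto
  then show ?case by simp
next
  case (Suc k)
  have ge: "m \<le> (step ^^ j) f \<xi>" if "\<xi> \<in> Om" for j \<xi>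
    using that by (induction j arbitrary: \<xi>) (auto intro: f step_ge)
  have k: "k < n" using Suc.prems by simp
  define \<eta>' where "\<eta>' = (if \<eta> k = \<zeta> k then \<eta> else flip k \<eta>)"
  have \<eta>': "\<eta>' \<in> Om" using Suc.prems k by (auto simp: \<eta>'_def flip_in_Omega)
  have "\<eta>' x = \<zeta> x" if "k \<le> x" "x < n" for x
  proof (cases "x = k")
    case True
    then show ?thesis using Omega_values[OF Suc.prems(2) k] Omega_values[OF \<zeta> k] by (auto simp: \<eta>'_def flip_def)
  next
    case False
    then show ?thesis using that Suc.prems(3)[of x] by (auto simp: \<eta>'_def flip_def)
  qed
  from Suc.IH[OF _ \<eta>' this] k have "m + delta ^ k * (f \<zeta> - m) \<le> (step ^^ k) f \<eta>'" by simp
  then have "delta * (delta ^ k * (f \<zeta> - m)) \<le> delta * ((step ^^ k) f \<eta>' - m)"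
    using delta_pos by (intro mult_left_mono) auto
  moreover have "m + delta * ((step ^^ k) f \<eta>' - m) \<le> step ((step ^^ k) f) \<eta>"
    by (rule step_lower) (use ge Suc.prems k in \<open>auto simp: \<eta>'_def\<close>)
  ultimately show ?case by (simp add: mult.assoc)
qed

definition lo :: "((nat \<Rightarrow> nat) \<Rightarrow> real) \<Rightarrow> real" where "lo f = Min (f ` Om)"
definition hi :: "((nat \<Rightarrow> nat) \<Rightarrow> real) \<Rightarrow> real" where "hi f = Max (f ` Om)"

lemma lo_le: "\<eta> \<in> Om \<Longrightarrow> lo f \<le> f \<eta>" and le_hi: "\<eta> \<in> Om \<Longrightarrow> f \<eta> \<le> hi f"
  by (simp_all add: lo_def hi_def)

lemma lo_ge: "(\<And>\<eta>. \<eta> \<in> Om \<Longrightarrow> m \<le> f \<eta>) \<Longrightarrow> m \<le> lo f"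
  using Omega_nonempty by (simp add: lo_def)

lemma hi_le: "(\<And>\<eta>. \<eta> \<in> Om \<Longrightarrow> f \<eta> \<le> m) \<Longrightarrow> hi f \<le> m"
  using Omega_nonempty by (simp add: hi_def)

lemma hi_attained: "\<exists>\<zeta>\<in>Om. f \<zeta> = hi f"
proof -
  have "hi f \<in> f ` Om" unfolding hi_def using Omega_nonempty by (intro Max_in) auto
  then show ?thesis by auto
qed

lemma lo_le_hi: "lo f \<le> hi f"
  using hi_attained[of f] lo_le[of _ f] by metis

lemma lo_step: "lo f \<le> lo (step f)"
  by (intro lo_ge step_ge lo_le)

lemma hi_step: "hi (step f) \<le> hi f"
proof (rule hi_le)
  fix \<eta> assume \<eta>: "\<eta> \<in> Om"
  have "- hi f \<le> step (\<lambda>\<eta>. - f \<eta>) \<eta>" by (rule step_ge) (auto intro: le_hi \<eta>)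
  then show "step f \<eta> \<le> hi f" by (simp add: step_uminus)
qed

lemma incseq_lo: "incseq (\<lambda>k. lo ((step ^^ k) f))"
  by (rule incseq_SucI) (simp add: lo_step)

lemma decseq_hi: "decseq (\<lambda>k. hi ((step ^^ k) f))"
  by (rule decseq_SucI) (simp add: hi_step)

text \<open>\<open>iterate_lower\<close> aimed at a maximizer of \<open>f\<close> lifts the minimum
  by \<open>delta ^ n\<close> times the oscillation, while the maximum cannot grow.\<close>

lemma oscillation: "hi ((step ^^ n) f) - lo ((step ^^ n) f) \<le> (1 - delta ^ n) * (hi f - lo f)"
proof -
  obtain \<zeta> where \<zeta>: "\<zeta> \<in> Om" "f \<zeta> = hi f" using hi_attained by blast
  have "lo f + delta ^ n * (hi f - lo f) \<le> lo ((step ^^ n) f)"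
  proof (rule lo_ge)
    fix \<eta> assume "\<eta> \<in> Om"
    then have "lo f + delta ^ n * (f \<zeta> - lo f) \<le> (step ^^ n) f \<eta>"
      using \<zeta>(1) by (intro iterate_lower) (auto intro: lo_le)
    then show "lo f + delta ^ n * (hi f - lo f) \<le> (step ^^ n) f \<eta>" using \<zeta>(2) by simp
  qed
  moreover have "hi ((step ^^ n) f) \<le> hi f" using decseqD[OF decseq_hi, of 0 n f] by simp
  ultimately show ?thesis by (simp add: algebra_simps)
qed

text \<open>Minima and maxima of the iterates are monotone, and their gap contracts geometrically
  along multiples of \<open>n\<close>, so the limit is the same from every starting
  configuration.\<close>

lemma iterates_converge: "\<exists>l. \<forall>\<eta>\<in>Om. (\<lambda>k. (step ^^ k) f \<eta>) \<longlonglongrightarrow> l"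
proof -
  let ?u = "\<lambda>k. lo ((step ^^ k) f)" and ?v = "\<lambda>k. hi ((step ^^ k) f)"
  have uv: "?u k \<le> ?v k" for k by (rule lo_le_hi)
  have "?u k \<le> hi f" for k using uv[of k] decseqD[OF decseq_hi, of 0 k f] by simp
  from incseq_convergent[OF incseq_lo allI[OF this]] obtain l where l: "?u \<longlonglongrightarrow> l" by blast
  have "lo f \<le> ?v k" for k using uv[of k] incseqD[OF incseq_lo, of 0 k f] by simp
  from decseq_convergent[OF decseq_hi allI[OF this]] obtain l' where l': "?v \<longlonglongrightarrow> l'" by blast
  have geo: "?v (k * n) - ?u (k * n) \<le> (1 - delta ^ n) ^ k * (hi f - lo f)" for k
  proof (induction k)
    case (Suc k)
    have "(step ^^ (Suc k * n)) f = (step ^^ n) ((step ^^ (k * n)) f)"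
      by (simp add: funpow_add)
    then have "?v (Suc k * n) - ?u (Suc k * n) \<le> (1 - delta ^ n) * (?v (k * n) - ?u (k * n))"
      using oscillation by metis
    also have "\<dots> \<le> (1 - delta ^ n) * ((1 - delta ^ n) ^ k * (hi f - lo f))"
      using delta_pos delta_le_1 by (intro mult_left_mono Suc.IH) (simp add: power_le_one)
    finally show ?case by simp
  qed simp
  have dn: "0 < delta ^ n" "delta ^ n \<le> 1" using delta_pos delta_le_1 by (auto simp: power_le_one)
  have "(\<lambda>k. (1 - delta ^ n) ^ k * (hi f - lo f)) \<longlonglongrightarrow> 0 * (hi f - lo f)"
    by (intro tendsto_intros LIMSEQ_power_zero) (use dn in auto)
  moreover have sm: "strict_mono (\<lambda>k. k * n)" using n_pos by (simp add: strict_mono_def)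
  have "(\<lambda>k. ?v (k * n) - ?u (k * n)) \<longlonglongrightarrow> l' - l"
    using LIMSEQ_subseq_LIMSEQ[OF l' sm] LIMSEQ_subseq_LIMSEQ[OF l sm]
    by (intro tendsto_diff) (simp_all add: o_def)
  ultimately have "l' - l \<le> 0" by (intro LIMSEQ_le) (use geo in auto)
  moreover have "l \<le> l'" using l l' uv by (intro LIMSEQ_le) auto
  ultimately have "l' = l" by linarith
  with l' have v: "?v \<longlonglongrightarrow> l" by blast
  show ?thesis
  proof (intro exI ballI)
    fix \<eta> assume "\<eta> \<in> Om"
    then show "(\<lambda>k. (step ^^ k) f \<eta>) \<longlonglongrightarrow> l"
      by (intro tendsto_sandwich[OF _ _ l v] always_eventually allI lo_le le_hi)
  qed
qed

definition ind :: "(nat \<Rightarrow> nat) \<Rightarrow> (nat \<Rightarrow> nat) \<Rightarrow> real" where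
  "ind \<zeta> \<eta> = (if \<eta> = \<zeta> then 1 else 0)"

definition stat :: "(nat \<Rightarrow> nat) \<Rightarrow> real" where
  "stat \<zeta> = (SOME l. \<forall>\<eta>\<in>Om. (\<lambda>k. (step ^^ k) (ind \<zeta>) \<eta>) \<longlonglongrightarrow> l)"

lemma stat_limit: "\<eta> \<in> Om \<Longrightarrow> (\<lambda>k. (step ^^ k) (ind \<zeta>) \<eta>) \<longlonglongrightarrow> stat \<zeta>"
  using someI_ex[OF iterates_converge[of "ind \<zeta>"]] by (auto simp: stat_def)

lemma sum_ind: "\<eta> \<in> Om \<Longrightarrow> (\<Sum>\<zeta>\<in>Om. f \<zeta> * ind \<zeta> \<eta>) = f \<eta>"
  by (simp add: ind_def if_distrib[of "\<lambda>x. _ * x"] cong: if_cong)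

lemma iterate_limit:
  assumes \<eta>: "\<eta> \<in> Om"
  shows "(\<lambda>k. (step ^^ k) f \<eta>) \<longlonglongrightarrow> (\<Sum>\<zeta>\<in>Om. f \<zeta> * stat \<zeta>)"
proof -
  have cong: "(step ^^ k) f \<xi> = (step ^^ k) (\<lambda>\<eta>. \<Sum>\<zeta>\<in>Om. f \<zeta> * ind \<zeta> \<eta>) \<xi>" if "\<xi> \<in> Om" for k \<xi>
    using that by (induction k arbitrary: \<xi>) (auto simp: sum_ind intro: step_cong)
  have "(step ^^ k) (\<lambda>\<eta>. \<Sum>\<zeta>\<in>Om. f \<zeta> * ind \<zeta> \<eta>) = (\<lambda>\<eta>. \<Sum>\<zeta>\<in>Om. f \<zeta> * (step ^^ k) (ind \<zeta>) \<eta>)" for k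
    by (induction k) (auto simp: step_sum)
  then have "(step ^^ k) f \<eta> = (\<Sum>\<zeta>\<in>Om. f \<zeta> * (step ^^ k) (ind \<zeta>) \<eta>)" for k
    using cong[OF \<eta>, of k] by simp
  then show ?thesis
    by (auto intro!: tendsto_sum tendsto_mult stat_limit \<eta>)
qed

lemma stat_step: "(\<Sum>\<zeta>\<in>Om. step f \<zeta> * stat \<zeta>) = (\<Sum>\<zeta>\<in>Om. f \<zeta> * stat \<zeta>)"
proof -
  obtain \<eta> where \<eta>: "\<eta> \<in> Om" using Omega_nonempty by blast
  have "(\<lambda>k. (step ^^ k) (step f) \<eta>) = (\<lambda>k. (step ^^ Suc k) f \<eta>)"
    by (rule ext) (simp add: funpow_swap1)
  then have "(\<lambda>k. (step ^^ k) (step f) \<eta>) \<longlonglongrightarrow> (\<Sum>\<zeta>\<in>Om. f \<zeta> * stat \<zeta>)"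
    using LIMSEQ_Suc[OF iterate_limit[OF \<eta>, of f]] by simp
  then show ?thesis using LIMSEQ_unique iterate_limit[OF \<eta>, of "step f"] by blast
qed

lemma step_const: "step (\<lambda>_. b) = (\<lambda>_. b)"
  by (rule ext) (simp add: step_def generator_def L_ex_def L_G_def)

lemma stat_sum: "(\<Sum>\<zeta>\<in>Om. stat \<zeta>) = 1"
proof -
  obtain \<eta> where \<eta>: "\<eta> \<in> Om" using Omega_nonempty by blast
  have "(step ^^ k) (\<lambda>_. 1) = (\<lambda>_. 1)" for k by (induction k) (auto simp: step_const)
  then show ?thesis using iterate_limit[OF \<eta>, of "\<lambda>_. 1"] LIMSEQ_unique[OF tendsto_const] by fastforce
qed

lemma stat_nonneg: "0 \<le> stat \<zeta>"
proof -
  obtain \<eta> where \<eta>: "\<eta> \<in> Om" using Omega_nonempty by blast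
  have "0 \<le> (step ^^ k) (ind \<zeta>) \<xi>" if "\<xi> \<in> Om" for k \<xi>
    using that by (induction k arbitrary: \<xi>) (auto simp: ind_def intro: step_ge)
  then show ?thesis using stat_limit[OF \<eta>, of \<zeta>] \<eta> by (intro LIMSEQ_le_const) auto
qed

lemma stat_iterate: "(\<Sum>\<zeta>\<in>Om. (step ^^ k) f \<zeta> * stat \<zeta>) = (\<Sum>\<zeta>\<in>Om. f \<zeta> * stat \<zeta>)"
  by (induction k) (simp_all add: stat_step)

text \<open>Stationarity over \<open>n\<close> steps combined with the minorization at
  \<open>m = 0\<close>. Strict positivity is what gives the logarithm of the stationary weight a
  meaning in the entropy production.\<close>

lemma stat_pos:
  assumes "\<zeta> \<in> Om"
  shows "0 < stat \<zeta>"
proof -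
  have "delta ^ n = (\<Sum>\<eta>\<in>Om. delta ^ n * stat \<eta>)"
    by (simp add: sum_distrib_left[symmetric] stat_sum)
  also have "\<dots> \<le> (\<Sum>\<eta>\<in>Om. (step ^^ n) (ind \<zeta>) \<eta> * stat \<eta>)"
  proof (intro sum_mono mult_right_mono stat_nonneg)
    fix \<eta> assume "\<eta> \<in> Om"
    then show "delta ^ n \<le> (step ^^ n) (ind \<zeta>) \<eta>"
      using iterate_lower[where m = 0 and f = "ind \<zeta>" and \<zeta> = \<zeta> and k = n and \<eta> = \<eta>] assms by (auto simp: ind_def)
  qed
  also have "\<dots> = stat \<zeta>"
    unfolding stat_iterate using assms by (simp add: ind_def if_distrib[of "\<lambda>x. x * _"] sum.delta cong: if_cong)
  finally show ?thesis using delta_pos zero_less_power[of delta n] by linarith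
qed

lemma stat_generator: "(\<Sum>\<zeta>\<in>Om. stat \<zeta> * L f \<zeta>) = 0"
proof -
  have "(\<Sum>\<zeta>\<in>Om. step f \<zeta> * stat \<zeta>) = (\<Sum>\<zeta>\<in>Om. f \<zeta> * stat \<zeta>) + (\<Sum>\<zeta>\<in>Om. stat \<zeta> * L f \<zeta>) / lam"
    unfolding step_def by (simp add: sum.distrib algebra_simps sum_divide_distrib)
  then show ?thesis using stat_step[of f] lam_pos by simp
qed

text \<open>Such a \<open>p\<close> is preserved by every power of \<open>step\<close>, and the
  powers applied to the indicator of \<open>\<zeta>\<close> tend to the constant
  \<open>stat \<zeta>\<close>.\<close>

lemma stat_unique:
  assumes p: "\<And>f. (\<Sum>\<eta>\<in>Om. p \<eta> * L f \<eta>) = 0" and one: "(\<Sum>\<eta>\<in>Om. p \<eta>) = 1" and \<zeta>: "\<zeta> \<in> Om"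
  shows "p \<zeta> = stat \<zeta>"
proof -
  have step: "(\<Sum>\<eta>\<in>Om. p \<eta> * step f \<eta>) = (\<Sum>\<eta>\<in>Om. p \<eta> * f \<eta>)" for f
    using p[of f] by (simp add: step_def distrib_left sum.distrib sum_divide_distrib[symmetric])
  have it: "(\<Sum>\<eta>\<in>Om. p \<eta> * (step ^^ k) (ind \<zeta>) \<eta>) = p \<zeta>" for k
  proof (induction k)
    case 0
    show ?case using \<zeta> by (simp add: ind_def if_distrib[of "\<lambda>x. _ * x"] sum.delta cong: if_cong)
  qed (simp add: step)
  have "(\<lambda>k. \<Sum>\<eta>\<in>Om. p \<eta> * (step ^^ k) (ind \<zeta>) \<eta>) \<longlonglongrightarrow> (\<Sum>\<eta>\<in>Om. p \<eta> * stat \<zeta>)"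
    by (intro tendsto_sum tendsto_mult tendsto_const stat_limit)
  then have "(\<lambda>k::nat. p \<zeta>) \<longlonglongrightarrow> stat \<zeta>" using one by (simp add: it sum_distrib_right[symmetric])
  then show ?thesis using LIMSEQ_unique tendsto_const by blast
qed

section \<open>The semigroup and the characterization of its invariant distribution\<close>

lemma expectation_Omega:
  assumes "set_pmf p \<subseteq> Om"
  shows "measure_pmf.expectation p f = (\<Sum>\<eta>\<in>Om. pmf p \<eta> * f \<eta>)"
  using assms by (subst integral_measure_pmf[of Om]) auto

text \<open>\<open>L\<close> is \<open>lam\<close> times the difference of \<open>step\<close> and
  the identity, and \<open>step\<close> does not increase the supremum norm.\<close>

lemma generator_bound:
  assumes f: "\<And>\<eta>. \<eta> \<in> Om \<Longrightarrow> \<bar>f \<eta>\<bar> \<le> M" and \<eta>: "\<eta> \<in> Om"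
  shows "\<bar>L f \<eta>\<bar> \<le> 2 * lam * M"
proof -
  have M: "0 \<le> M" using f[OF \<eta>] by linarith
  have "- M \<le> step f \<eta>" by (rule step_ge) (use f \<eta> in \<open>auto dest: abs_le_D2\<close>, metis abs_le_D2 f minus_le_iff)
  moreover have "- M \<le> step (\<lambda>\<eta>. - f \<eta>) \<eta>" by (rule step_ge) (use f \<eta> in \<open>auto dest: abs_le_D1\<close>)
  ultimately have "\<bar>step f \<eta> - f \<eta>\<bar> \<le> 2 * M" using f[OF \<eta>] by (simp add: step_uminus)
  moreover have "L f \<eta> = lam * (step f \<eta> - f \<eta>)" using lam_pos by (simp add: step_def)
  ultimately show ?thesis using lam_pos by (simp add: abs_mult mult.commute mult.left_commute)
qed

lemma generator_power_bound: "\<exists>M. \<forall>k. \<forall>\<eta>\<in>Om. \<bar>(L ^^ k) f \<eta>\<bar> \<le> (2 * lam) ^ k * M"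
proof (intro exI allI ballI)
  fix k \<eta> assume "\<eta> \<in> Om"
  then show "\<bar>(L ^^ k) f \<eta>\<bar> \<le> (2 * lam) ^ k * Max ((\<lambda>\<eta>. \<bar>f \<eta>\<bar>) ` Om)"
  proof (induction k arbitrary: \<eta>)
    case (Suc k)
    have "\<bar>L ((L ^^ k) f) \<eta>\<bar> \<le> 2 * lam * ((2 * lam) ^ k * Max ((\<lambda>\<eta>. \<bar>f \<eta>\<bar>) ` Om))"
      by (rule generator_bound) (use Suc in auto)
    then show ?case by simp
  qed simp
qed

lemma semigroup_summable:
  assumes "\<eta> \<in> Om"
  shows "summable (\<lambda>k. t ^ k / fact k * (L ^^ k) f \<eta>)"
proof -
  obtain M where M: "\<And>k \<eta>. \<eta> \<in> Om \<Longrightarrow> \<bar>(L ^^ k) f \<eta>\<bar> \<le> (2 * lam) ^ k * M"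
    using generator_power_bound[of f] by blast
  have "summable (\<lambda>k. inverse (fact k) * (\<bar>t\<bar> * (2 * lam)) ^ k * M)"
    by (intro summable_mult2 summable_exp)
  then show ?thesis
  proof (rule summable_comparison_test'[where N = 0])
    fix k :: nat
    have "norm (t ^ k / fact k * (L ^^ k) f \<eta>) = \<bar>t\<bar> ^ k / fact k * \<bar>(L ^^ k) f \<eta>\<bar>"
      by (simp add: abs_mult power_abs)
    also have "\<dots> \<le> \<bar>t\<bar> ^ k / fact k * ((2 * lam) ^ k * M)"
      by (intro mult_left_mono M assms) simp
    finally show "norm (t ^ k / fact k * (L ^^ k) f \<eta>) \<le> inverse (fact k) * (\<bar>t\<bar> * (2 * lam)) ^ k * M"
      by (simp add: field_simps power_mult_distrib)
  qed
qed

lemma expectation_semigroup: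
  assumes p: "set_pmf p \<subseteq> Om"
  shows "(\<lambda>k. (\<Sum>\<eta>\<in>Om. pmf p \<eta> * (L ^^ k) f \<eta>) / fact k * t ^ k) sums
    measure_pmf.expectation p (markov_semigroup \<theta> a n t f)"
proof -
  have "(\<lambda>k. \<Sum>\<eta>\<in>Om. pmf p \<eta> * (t ^ k / fact k * (L ^^ k) f \<eta>)) sums
      (\<Sum>\<eta>\<in>Om. pmf p \<eta> * markov_semigroup \<theta> a n t f \<eta>)"
    unfolding markov_semigroup_def
    by (intro sums_sum sums_mult summable_sums semigroup_summable)
  moreover have "(\<Sum>\<eta>\<in>Om. pmf p \<eta> * (t ^ k / fact k * (L ^^ k) f \<eta>)) = (\<Sum>\<eta>\<in>Om. pmf p \<eta> * (L ^^ k) f \<eta>) / fact k * t ^ k" for k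
    by (simp add: sum_distrib_left sum_distrib_right sum_divide_distrib mult_ac)
  ultimately show ?thesis by (simp add: expectation_Omega[OF p])
qed

text \<open>For fixed \<open>p\<close> and \<open>f\<close> the expectation is an everywhere
  convergent power series in \<open>t\<close>. If it is constant for \<open>t \<ge> 0\<close>, its
  linear coefficient vanishes; conversely, annihilation of every \<open>L f\<close> kills all
  coefficients but the constant one.\<close>

lemma invariant_pmf_iff:
  "invariant_pmf \<theta> a n p \<longleftrightarrow> set_pmf p \<subseteq> Om \<and> (\<forall>f. (\<Sum>\<eta>\<in>Om. pmf p \<eta> * L f \<eta>) = 0)"
proof (intro iffI conjI allI)
  assume inv: "invariant_pmf \<theta> a n p"
  then show p: "set_pmf p \<subseteq> Om" by (simp add: invariant_pmf_def)
  fix f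
  define b where "b k = (\<Sum>\<eta>\<in>Om. pmf p \<eta> * (L ^^ k) f \<eta>) / fact k" for k
  define g where "g t = measure_pmf.expectation p (markov_semigroup \<theta> a n t f)" for t
  have sums: "(\<lambda>k. b k * t ^ k) sums g t" for t
    using expectation_semigroup[OF p, of f t] by (simp add: b_def g_def)
  have g0: "g t = g 0" if "t \<ge> 0" for t
    using inv that by (auto simp: invariant_pmf_def g_def)
  have g_eq: "g = (\<lambda>t. \<Sum>k. b k * t ^ k)" using sums by (auto simp: sums_iff)
  have "DERIV (\<lambda>t. \<Sum>k. b k * t ^ k) 0 :> (\<Sum>k. diffs b k * 0 ^ k)"
    by (rule termdiffs_strong[where K = 1]) (use sums[of 1] in \<open>auto simp: sums_iff\<close>)
  then have "(g has_real_derivative b 1) (at 0)"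
    unfolding g_eq by (simp add: diffs_def)
  then have "((\<lambda>t. (g (0 + t) - g 0) / t) \<longlongrightarrow> b 1) (at 0)"
    unfolding DERIV_def .
  \<comment> \<open>Constancy is known for \<open>t \<ge> 0\<close> only, hence the one-sided
    limit.\<close>
  then have right: "((\<lambda>t. (g (0 + t) - g 0) / t) \<longlongrightarrow> b 1) (at_right 0)"
    by (rule filterlim_mono[OF _ order_refl at_le]) simp
  have "((\<lambda>t. (g (0 + t) - g 0) / t) \<longlongrightarrow> 0) (at_right 0)"
  proof (rule tendsto_eventually)
    show "\<forall>\<^sub>F t in at_right 0. (g (0 + t) - g 0) / t = 0"
      using eventually_at_right_less[of 0]
    proof eventually_elim
      case (elim t)
      then show ?case using g0[of t] by simp
    qed
  qed
  from tendsto_unique[OF trivial_limit_at_right_real right this] have "b 1 = 0" .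
  then show "(\<Sum>\<eta>\<in>Om. pmf p \<eta> * L f \<eta>) = 0" by (simp add: b_def)
next
  assume "set_pmf p \<subseteq> Om \<and> (\<forall>f. (\<Sum>\<eta>\<in>Om. pmf p \<eta> * L f \<eta>) = 0)"
  then have p: "set_pmf p \<subseteq> Om" and z: "\<And>f. (\<Sum>\<eta>\<in>Om. pmf p \<eta> * L f \<eta>) = 0" by auto
  show "invariant_pmf \<theta> a n p"
    unfolding invariant_pmf_def
  proof (intro conjI p allI impI)
    fix t :: real and f :: "(nat \<Rightarrow> nat) \<Rightarrow> real"
    have "(\<Sum>\<eta>\<in>Om. pmf p \<eta> * (L ^^ k) f \<eta>) / fact k * t ^ k = 0" if "k \<notin> {0}" for k
      using that z[of "(L ^^ (k - 1)) f"] by (cases k) auto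
    with sums_finite[of "{0}" "\<lambda>k. (\<Sum>\<eta>\<in>Om. pmf p \<eta> * (L ^^ k) f \<eta>) / fact k * t ^ k"] have "(\<lambda>k. (\<Sum>\<eta>\<in>Om. pmf p \<eta> * (L ^^ k) f \<eta>) / fact k * t ^ k) sums
       (\<Sum>\<eta>\<in>Om. pmf p \<eta> * f \<eta>)" by simp
    from sums_unique2[OF expectation_semigroup[OF p] this]
    show "measure_pmf.expectation p (markov_semigroup \<theta> a n t f) = measure_pmf.expectation p f"
      by (simp add: expectation_Omega[OF p])
  qed
qed

lemma mu_ss_properties:
  shows set_mu_ss: "set_pmf (mu_ss \<theta> a n) \<subseteq> Om"
    and mu_ss_generator: "(\<Sum>\<eta>\<in>Om. pmf (mu_ss \<theta> a n) \<eta> * L f \<eta>) = 0"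
    and mu_ss_pos: "\<eta> \<in> Om \<Longrightarrow> 0 < pmf (mu_ss \<theta> a n) \<eta>"
proof -
  define q where "q \<eta> = (if \<eta> \<in> Om then stat \<eta> else 0)" for \<eta>
  define p where "p = embed_pmf q"
  have "(\<integral>\<^sup>+ \<eta>. ennreal (q \<eta>) \<partial>count_space UNIV) = (\<Sum>\<eta>\<in>Om. ennreal (q \<eta>))"
    by (rule nn_integral_count_space') (auto simp: q_def)
  also have "\<dots> = ennreal (\<Sum>\<eta>\<in>Om. q \<eta>)" by (rule sum_ennreal) (simp add: q_def stat_nonneg)
  also have "\<dots> = 1" by (simp add: q_def stat_sum)
  finally have pmf: "pmf p \<eta> = q \<eta>" for \<eta>
    unfolding p_def by (intro pmf_embed_pmf) (auto simp: q_def stat_nonneg)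
  have "set_pmf p \<subseteq> Om" by (auto simp: set_pmf_iff pmf q_def split: if_splits)
  moreover have "(\<Sum>\<eta>\<in>Om. pmf p \<eta> * L f \<eta>) = 0" for f
    using stat_generator[of f] by (simp add: pmf q_def)
  ultimately have inv: "invariant_pmf \<theta> a n p" by (simp add: invariant_pmf_iff)
  have "p' = p" if "invariant_pmf \<theta> a n p'" for p'
  proof (rule pmf_eqI)
    fix \<eta>
    have p': "set_pmf p' \<subseteq> Om" "\<And>f. (\<Sum>\<eta>\<in>Om. pmf p' \<eta> * L f \<eta>) = 0"
      using that by (auto simp: invariant_pmf_iff)
    have "(\<Sum>\<eta>\<in>Om. pmf p' \<eta>) = 1" by (rule sum_pmf_eq_1) (use p' in auto)
    from stat_unique[OF p'(2) this] show "pmf p' \<eta> = pmf p \<eta>"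
      using p'(1) by (auto simp: pmf q_def set_pmf_iff)
  qed
  then have "mu_ss \<theta> a n = p" unfolding mu_ss_def using inv by (intro the_equality)
  then show "set_pmf (mu_ss \<theta> a n) \<subseteq> Om" "(\<Sum>\<eta>\<in>Om. pmf (mu_ss \<theta> a n) \<eta> * L f \<eta>) = 0"
    "\<eta> \<in> Om \<Longrightarrow> 0 < pmf (mu_ss \<theta> a n) \<eta>"
    using inv stat_pos by (auto simp: invariant_pmf_iff pmf q_def)
qed

end

section \<open>Entropy production\<close>

lemma spin_at_nat: "x < n \<Longrightarrow> spin_at n \<eta> (int x) = spin \<eta> x"
  by (simp add: spin_at_def)

lemma spin_right_nb: "x < n \<Longrightarrow> spin \<eta> (right_nb n x) = spin_at n \<eta> (int x + 1)"
  using right_nb_mod[of n "int x"] by (simp add: spin_at_def)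

lemma spin_left_nb:
  assumes "x < n"
  shows "spin \<eta> (left_nb n x) = spin_at n \<eta> (int x - 1)"
proof -
  have "int (left_nb n x) = (int x - 1 + int n) mod int n"
    using assms by (simp add: left_nb_def zmod_int of_nat_diff algebra_simps)
  then have "left_nb n x = nat ((int x - 1) mod int n)" by simp
  then show ?thesis by (simp add: spin_at_def)
qed

lemma rate_spin_at:
  "x < n \<Longrightarrow> rate \<theta> n x \<eta> =
    1 - gam \<theta> n * spin_at n \<eta> (int x) * (spin_at n \<eta> (int x - 1) + spin_at n \<eta> (int x + 1))
      + (gam \<theta> n)\<^sup>2 * (spin_at n \<eta> (int x - 1) * spin_at n \<eta> (int x + 1))"
  by (simp add: rate_def spin_at_nat spin_right_nb spin_left_nb)

lemma spin_at_flip: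
  assumes "\<eta> \<in> Omega n" "x < n"
  shows "spin_at n (flip x \<eta>) i = spin_at n \<eta> i - 2 * (spin_at n \<eta> i * kron n (int x) i)"
proof -
  have i: "nat (i mod int n) < n" using assms(2) by (simp add: nat_less_iff)
  have "i mod int n = int x \<longleftrightarrow> nat (i mod int n) = x" using assms(2) by auto
  then show ?thesis
    using Omega_values[OF assms(1) i] assms(2)
    by (auto simp: spin_at_def spin_def flip_def kron_def)
qed

lemma rate_flip:
  assumes \<eta>: "\<eta> \<in> Omega n" and x: "x < n" and n: "n \<ge> 2"
  shows "rate \<theta> n x (flip x \<eta>) =
    1 + gam \<theta> n * spin_at n \<eta> (int x) * (spin_at n \<eta> (int x - 1) + spin_at n \<eta> (int x + 1))
      + (gam \<theta> n)\<^sup>2 * (spin_at n \<eta> (int x - 1) * spin_at n \<eta> (int x + 1))"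
proof -
  have "kron n (int x) (int x) = 1" by (simp add: kron_def)
  moreover have "kron n (int x) (int x + 1) = 0"
    using kron_mult_neq[of 1 n "int x" "int x + 1"] n by (auto simp: kron_def)
  moreover have "kron n (int x) (int x - 1) = 0"
    using kron_mult_neq[of 1 n "int x - 1" "int x - 1"] n by (auto simp: kron_def)
  ultimately show ?thesis
    unfolding rate_spin_at[OF x] spin_at_flip[OF \<eta> x] by simp
qed

section \<open>Particle numbers, averaged flip rates and the reference weight\<close>

definition particles :: "nat \<Rightarrow> (nat \<Rightarrow> nat) \<Rightarrow> nat" where
  "particles n \<eta> = (\<Sum>x<n. \<eta> x)"

lemma particles_flip:
  assumes "\<eta> \<in> Omega n" "x < n"
  shows "particles n (flip x \<eta>) = (if \<eta> x = 1 then particles n \<eta> - 1 else particles n \<eta> + 1)"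
    and "\<eta> x = 1 \<Longrightarrow> 1 \<le> particles n \<eta>"
proof -
  have fin: "finite {..<n}" "x \<in> {..<n}" using assms by auto
  have 1: "particles n \<zeta> = \<zeta> x + (\<Sum>y\<in>{..<n} - {x}. \<zeta> y)" for \<zeta>
    unfolding particles_def by (rule sum.remove[OF fin])
  have 2: "(\<Sum>y\<in>{..<n} - {x}. flip x \<eta> y) = (\<Sum>y\<in>{..<n} - {x}. \<eta> y)"
    by (rule sum.cong) (auto simp: flip_def)
  show "particles n (flip x \<eta>) = (if \<eta> x = 1 then particles n \<eta> - 1 else particles n \<eta> + 1)"
    unfolding 1 2 using Omega_values[OF assms] by (auto simp: flip_def)
  show "\<eta> x = 1 \<Longrightarrow> 1 \<le> particles n \<eta>" unfolding 1[of \<eta>] by simp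
qed

text \<open>The numerical ranges hold for all large \<open>n\<close>, since
  \<open>gam \<theta> n\<close> tends to 1/2; they make the constants below explicit.\<close>

locale stationary = chain \<theta> a n + ex: exclusion n "pmf (mu_ss \<theta> a n)" for \<theta> a n +
  assumes n30: "n \<ge> 30" and gam_ge: "2 / 5 \<le> gam \<theta> n" and gam_le: "gam \<theta> n \<le> 3 / 5"
begin

abbreviation "F \<equiv> pmf (mu_ss \<theta> a n)"
abbreviation "g \<equiv> gam \<theta> n"

lemma mass_eq: "ex.mass = 1"
  unfolding ex.mass_def by (rule sum_pmf_eq_1) (use set_mu_ss in auto)

lemma S_particles: "ex.S \<eta> = 2 * real (particles n \<eta>) - real n"
proof -
  have "ex.S \<eta> = (\<Sum>x<n. spin \<eta> x)"
    unfolding ex.S_def sum_int_period by (rule sum.cong) (auto simp: spin_at_nat)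
  then show ?thesis by (simp add: spin_def particles_def sum_subtractf sum_distrib_left)
qed

lemma particles_exch: "x < n \<Longrightarrow> particles n (exchange n x \<eta>) = particles n \<eta>"
  using ex.S_exch[of "int x" \<eta>] by (simp add: S_particles exch_nat)

lemma energy_nat: "ex.energy = (\<Sum>x<n. \<Sum>\<eta>\<in>Om. (sqrt (F (exchange n x \<eta>)) - sqrt (F \<eta>))\<^sup>2)"
  unfolding ex.energy_def sum_int_period ex.bond_energy_def by (rule sum.cong) (auto simp: exch_nat)

text \<open>\<open>mean_rate e t\<close> is the average of \<open>(1 + e g s) (1 + e g s')\<close>, for \<open>e = 1\<close> or \<open>e = -1\<close>, over
  two distinct spins \<open>s\<close>, \<open>s'\<close> of a uniformly chosen configuration of \<open>n - 1\<close> spins with sum \<open>t\<close>.\<close>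

definition mean_rate :: "real \<Rightarrow> real \<Rightarrow> real" where
  "mean_rate e t = 1 + e * (2 * g * t / (real n - 1)) + g\<^sup>2 * (t\<^sup>2 - (real n - 1)) / ((real n - 1) * (real n - 2))"

text \<open>With \<open>u\<close> the normalized \<open>e * t\<close>, the mean rate is nearly
  \<open>(1 + g * u)\<^sup>2\<close>, and the modulus of \<open>g * u\<close> is at most 0.642,
  which keeps the square away from 0. The finite-size correction loses at most
  \<open>g\<^sup>2 / 28\<close>.\<close>

lemma mean_rate_bounds:
  assumes e: "e = 1 \<or> e = -1" and t: "\<bar>t\<bar> \<le> real n + 1"
  shows "1 / 10 \<le> mean_rate e t" "mean_rate e t \<le> 4"
proof -
  define m where "m = real n - 1"
  define u where "u = e * t / m"
  define v where "v = (t\<^sup>2 - m) / (m * (m - 1))"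
  have m: "m \<ge> 29" using n30 by (simp add: m_def)
  \<comment> \<open>For \<open>n \<ge> 30\<close> the quotient \<open>(n + 1) / (n - 1)\<close> is
    at most 31/29.\<close>
  have "\<bar>t\<bar> / m \<le> 107 / 100" using t m by (simp add: m_def field_simps)
  then have u: "\<bar>u\<bar> \<le> 107 / 100" using e m by (auto simp: u_def)
  have t_eq: "t\<^sup>2 = u\<^sup>2 * m\<^sup>2" using e m by (auto simp: u_def power_divide)
  have v_eq: "v = (u\<^sup>2 * m - 1) / (m - 1)"
    unfolding v_def t_eq using m by (simp add: field_simps power2_eq_square)
  have usq: "u\<^sup>2 \<le> (107 / 100)\<^sup>2" using u by (subst abs_le_square_iff[symmetric]) simp
  have "u\<^sup>2 - 1 / 28 \<le> v"
  proof -
    have "(u\<^sup>2 - 1 / 28) * (m - 1) = u\<^sup>2 * m - u\<^sup>2 - (m - 1) / 28" by (simp add: field_simps)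
    moreover have "1 \<le> (m - 1) / 28" using m by simp
    ultimately have "(u\<^sup>2 - 1 / 28) * (m - 1) \<le> u\<^sup>2 * m - 1" using zero_le_power2[of u] by linarith
    then show ?thesis unfolding v_eq using m by (simp add: pos_le_divide_eq)
  qed
  moreover have "v \<le> 2"
  proof -
    have "u\<^sup>2 * m \<le> (107 / 100)\<^sup>2 * m" using usq m by (intro mult_right_mono) auto
    moreover have "(107 / 100)\<^sup>2 * m - 1 \<le> 2 * (m - 1)" using m by (simp add: power2_eq_square)
    ultimately have "u\<^sup>2 * m - 1 \<le> 2 * (m - 1)" by linarith
    then show ?thesis unfolding v_eq using m by (simp add: pos_divide_le_eq)
  qed
  moreover have g2: "0 \<le> g\<^sup>2" "g\<^sup>2 \<le> 9 / 25"
    using gam_ge gam_le power_mono[of g "3/5" 2] by (auto simp: power2_eq_square)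
  ultimately have v1: "g\<^sup>2 * (u\<^sup>2 - 1 / 28) \<le> g\<^sup>2 * v" and v2: "g\<^sup>2 * v \<le> g\<^sup>2 * 2"
    by (intro mult_left_mono; simp)+
  have gu: "\<bar>g * u\<bar> \<le> 3 / 5 * (107 / 100)"
    unfolding abs_mult using gam_ge gam_le u by (intro mult_mono) auto
  have eq: "mean_rate e t = 1 + 2 * (g * u) + g\<^sup>2 * v"
    unfolding mean_rate_def u_def v_def m_def by simp
  \<comment> \<open>The square of 0.358 is just above 16/125 = 0.128, and a loss of at most 0.36/28
    leaves more than 1/10.\<close>
  have "(1 + g * u)\<^sup>2 \<ge> (1 - 3 / 5 * (107 / 100))\<^sup>2" using gu by (intro power_mono) auto
  then have "1 + 2 * (g * u) + g\<^sup>2 * u\<^sup>2 \<ge> 16 / 125"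
    by (simp add: power2_eq_square algebra_simps)
  then show "1 / 10 \<le> mean_rate e t" unfolding eq using v1 g2 by (simp add: algebra_simps)
  show "mean_rate e t \<le> 4" unfolding eq using v2 g2 gu by (simp add: abs_le_iff)
qed

text \<open>Mean rate of downward flips over mean rate of upward flips when the other spins sum to
  \<open>t\<close>. By detailed balance it is the weight of a configuration with \<open>k\<close>
  particles divided by the weight of one with \<open>k + 1\<close>, where
  \<open>t = 2 * k + 1 - n\<close>.\<close>

definition up_ratio :: "real \<Rightarrow> real" where "up_ratio t = mean_rate (-1) t / mean_rate 1 t"

lemma ratio_bounds:
  assumes "\<bar>t\<bar> \<le> real n + 1"
  shows "0 < up_ratio t" "up_ratio t \<le> 40" "1 / up_ratio t \<le> 40"
proof -
  note b = mean_rate_bounds[of 1 t] mean_rate_bounds[of "-1" t]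
  have p: "0 < mean_rate 1 t" "0 < mean_rate (-1) t" using b assms by auto
  then show "0 < up_ratio t" by (simp add: up_ratio_def)
  have "mean_rate (-1) t \<le> 40 * mean_rate 1 t" "mean_rate 1 t \<le> 40 * mean_rate (-1) t" using b assms by auto
  then show "up_ratio t \<le> 40" "1 / up_ratio t \<le> 40" using p by (simp_all add: up_ratio_def field_simps)
qed

text \<open>The reference weight is the reversible measure of the magnetization chain obtained by averaging
  the flip rates over configurations with a given number of particles.\<close>

definition log_weight :: "nat \<Rightarrow> real" where
  "log_weight k = - (\<Sum>j<k. ln (up_ratio (2 * real j + 1 - real n)))"

definition flip_weight :: "nat \<Rightarrow> (nat \<Rightarrow> nat) \<Rightarrow> real" where
  "flip_weight x \<eta> = exp (log_weight (particles n (flip x \<eta>)) - log_weight (particles n \<eta>))"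

text \<open>\<open>flip_weight\<close> takes one value on occupied and one on empty sites, both
  depending on \<open>S\<close> only. \<open>r0\<close> and \<open>r1\<close> are half the sum and
  half the difference of these values, so that the weight becomes affine in the flipped
  spin.\<close>

definition r0 :: "(nat \<Rightarrow> nat) \<Rightarrow> real" where
  "r0 \<eta> = (up_ratio (ex.S \<eta> - 1) + 1 / up_ratio (ex.S \<eta> + 1)) / 2"
definition r1 :: "(nat \<Rightarrow> nat) \<Rightarrow> real" where
  "r1 \<eta> = (up_ratio (ex.S \<eta> - 1) - 1 / up_ratio (ex.S \<eta> + 1)) / 2"

lemma S_shift_bounds: "\<eta> \<in> Om \<Longrightarrow> \<bar>ex.S \<eta> - 1\<bar> \<le> real n + 1" "\<eta> \<in> Om \<Longrightarrow> \<bar>ex.S \<eta> + 1\<bar> \<le> real n + 1"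
  using ex.abs_S_le[of \<eta>] by (auto simp: abs_le_iff)

lemma flip_weight_eq:
  assumes \<eta>: "\<eta> \<in> Om" and x: "x < n"
  shows "flip_weight x \<eta> = r0 \<eta> + r1 \<eta> * spin_at n \<eta> (int x)"
proof (cases "\<eta> x = 1")
  case True
  then obtain k where k: "particles n \<eta> = Suc k"
    using particles_flip(2)[OF \<eta> x] by (cases "particles n \<eta>") auto
  have eq: "ex.S \<eta> - 1 = 2 * real k + 1 - real n" by (simp add: S_particles k)
  have "0 < up_ratio (2 * real k + 1 - real n)"
    using ratio_bounds(1)[OF S_shift_bounds(1)[OF \<eta>]] unfolding eq .
  then have "flip_weight x \<eta> = up_ratio (ex.S \<eta> - 1)" unfolding eq
    by (simp add: flip_weight_def particles_flip(1)[OF \<eta> x] True k log_weight_def)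
  then show ?thesis using True x by (simp add: spin_at_nat spin_def r0_def r1_def field_simps)
next
  case False
  then have 0: "\<eta> x = 0" using Omega_values[OF \<eta> x] by simp
  have eq: "ex.S \<eta> + 1 = 2 * real (particles n \<eta>) + 1 - real n" by (simp add: S_particles)
  have "0 < up_ratio (2 * real (particles n \<eta>) + 1 - real n)"
    using ratio_bounds(1)[OF S_shift_bounds(2)[OF \<eta>]] unfolding eq .
  then have "flip_weight x \<eta> = 1 / up_ratio (ex.S \<eta> + 1)" unfolding eq
    by (simp add: flip_weight_def particles_flip(1)[OF \<eta> x] 0 log_weight_def exp_minus inverse_eq_divide)
  then show ?thesis using 0 x by (simp add: spin_at_nat spin_def r0_def r1_def field_simps)
qed

text \<open>The adjoint of the flip generator applied to the reference weight, divided by that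
  weight; it would vanish identically if the weight were stationary for the flips.\<close>

definition J :: "(nat \<Rightarrow> nat) \<Rightarrow> real" where
  "J \<eta> = (\<Sum>x<n. c x (flip x \<eta>) * flip_weight x \<eta> - c x \<eta>)"

lemma sum_neighbours:
  assumes \<eta>: "\<eta> \<in> Om"
  shows "(\<Sum>x<n. spin_at n \<eta> (int x)) = ex.S \<eta>"
    and "(\<Sum>x<n. spin_at n \<eta> (int x - 1) + spin_at n \<eta> (int x + 1)) = 2 * ex.S \<eta>"
    and "(\<Sum>x<n. spin_at n \<eta> (int x) * (spin_at n \<eta> (int x - 1) + spin_at n \<eta> (int x + 1))) = 2 * ex.Q1 \<eta>"
    and "(\<Sum>x<n. spin_at n \<eta> (int x - 1) * spin_at n \<eta> (int x + 1)) = ex.Q2 \<eta>"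
    and "(\<Sum>x<n. spin_at n \<eta> (int x) * (spin_at n \<eta> (int x - 1) * spin_at n \<eta> (int x + 1))) = ex.T \<eta>"
proof -
  let ?s = "spin_at n \<eta>"
  have p: "periodic n (\<lambda>i. ?s (i + k))" for k by (rule periodic_shift) (rule periodic_spin_at)
  have sh: "(\<Sum>x<n. ?s (int x + k)) = ex.S \<eta>" for k
    using sum_period_shift[OF periodic_spin_at, of n \<eta> k] by (simp add: sum_int_period ex.S_def)
  show "(\<Sum>x<n. ?s (int x)) = ex.S \<eta>" using sh[of 0] by simp
  show "(\<Sum>x<n. ?s (int x - 1) + ?s (int x + 1)) = 2 * ex.S \<eta>"
    using sh[of 1] sh[of "-1"] by (simp add: sum.distrib)
  have q: "(\<Sum>x<n. ?s (int x + k) * ?s (int x + k + j)) = (\<Sum>x<n. ?s (int x) * ?s (int x + j))" for k j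
    using sum_period_shift[OF periodic_mult[OF periodic_spin_at[of n \<eta>] p[of j]], of k] by (simp add: sum_int_period)
  show "(\<Sum>x<n. ?s (int x) * (?s (int x - 1) + ?s (int x + 1))) = 2 * ex.Q1 \<eta>"
    using q[of "-1" 1] by (simp add: sum.distrib distrib_left ex.Q1_def sum_int_period mult.commute)
  show "(\<Sum>x<n. ?s (int x - 1) * ?s (int x + 1)) = ex.Q2 \<eta>"
    using q[of "-1" 2] by (simp add: ex.Q2_def sum_int_period add.commute)
  have "periodic n (\<lambda>i. ?s i * ?s (i + 1) * ?s (i + 2))"
    by (intro periodic_mult periodic_spin_at p)
  from sum_period_shift[OF this, of "-1"]
  show "(\<Sum>x<n. ?s (int x) * (?s (int x - 1) * ?s (int x + 1))) = ex.T \<eta>"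
    by (simp add: ex.T_def sum_int_period mult_ac add.commute)
qed

text \<open>The left side is the conditional mean of \<open>J\<close> given \<open>S\<close> under
  the uniform measure. The \<open>(n + S) / 2\<close> occupied and the \<open>(n - S) / 2\<close>
  empty sites contribute separately, and each contribution vanishes by detailed balance of the
  averaged rates.\<close>

lemma mean_drift_zero:
  assumes \<eta>: "\<eta> \<in> Om"
  shows "real n * (r0 \<eta> - 1) + r1 \<eta> * ex.S \<eta> + 2 * g * (r0 \<eta> + 1) * ex.avg2 \<eta> + 2 * g * r1 \<eta> * ex.S \<eta>
    + g\<^sup>2 * (r0 \<eta> - 1) * ex.avg2 \<eta> + g\<^sup>2 * r1 \<eta> * ex.avg3 \<eta> = 0"
proof -
  define S where "S = ex.S \<eta>"
  define a2 where "a2 = ex.avg2 \<eta>"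
  define a3 where "a3 = ex.avg3 \<eta>"
  define rp where "rp = up_ratio (S - 1)"
  define rm where "rm = 1 / up_ratio (S + 1)"
  have m: "real n - 1 > 0" "real n - 2 > 0" using n30 by auto
  have a2: "a2 = (S\<^sup>2 - real n) / (real n - 1)" by (simp add: a2_def ex.avg2_def S_def)
  have a3: "a3 = (S * a2 - 2 * S) / (real n - 2)" by (simp add: a3_def ex.avg3_def S_def a2_def)
  \<comment> \<open>The indicator \<open>(1 + s) / 2\<close> of an occupied site times the factored
    rate, summed over sites, with products of spins replaced by their conditional means.\<close>
  have plus: "(real n + S) / 2 * mean_rate e (S - 1) = (real n + S) / 2 + e * g * (S + a2) + g\<^sup>2 * (a2 + a3) / 2" for e
    unfolding mean_rate_def a3 a2 using m by (simp add: divide_simps) (simp add: power2_eq_square algebra_simps)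
  have minus: "(real n - S) / 2 * mean_rate e (S + 1) = (real n - S) / 2 + e * g * (S - a2) + g\<^sup>2 * (a2 - a3) / 2" for e
    unfolding mean_rate_def a3 a2 using m by (simp add: divide_simps) (simp add: power2_eq_square algebra_simps)
  have p: "mean_rate 1 (S - 1) > 0" "mean_rate (-1) (S + 1) > 0"
    using mean_rate_bounds(1)[of 1 "S - 1"] mean_rate_bounds(1)[of "-1" "S + 1"] S_shift_bounds[OF \<eta>]
    by (auto simp: S_def)
  have "rp * mean_rate 1 (S - 1) = mean_rate (-1) (S - 1)"
    using p by (simp add: rp_def up_ratio_def)
  then have 1: "rp * ((real n + S) / 2 * mean_rate 1 (S - 1)) = (real n + S) / 2 * mean_rate (-1) (S - 1)"
    by (metis mult.left_commute)
  have "rm * mean_rate (-1) (S + 1) = mean_rate 1 (S + 1)"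
    using p by (simp add: rm_def up_ratio_def)
  then have 2: "rm * ((real n - S) / 2 * mean_rate (-1) (S + 1)) = (real n - S) / 2 * mean_rate 1 (S + 1)"
    by (metis mult.left_commute)
  have r: "r0 \<eta> = (rp + rm) / 2" "r1 \<eta> = (rp - rm) / 2" by (auto simp: r0_def r1_def rp_def rm_def S_def)
  show ?thesis using 1 2 unfolding plus minus S_def[symmetric] a2_def[symmetric] a3_def[symmetric] r
    by (simp add: field_simps) 
qed

text \<open>The rates expand into products of at most three neighbouring spins. Subtracting the
  vanishing conditional mean centres each product, which is the form accepted by the replacement
  estimates.\<close>

lemma J_eq:
  assumes \<eta>: "\<eta> \<in> Om"
  shows "J \<eta> = 2 * g * (r0 \<eta> + 1) * (ex.Q1 \<eta> - ex.avg2 \<eta>) + g\<^sup>2 * (r0 \<eta> - 1) * (ex.Q2 \<eta> - ex.avg2 \<eta>)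
    + g\<^sup>2 * r1 \<eta> * (ex.T \<eta> - ex.avg3 \<eta>)"
proof -
  let ?s = "spin_at n \<eta>"
  have "J \<eta> = (\<Sum>x<n. (r0 \<eta> - 1) + r1 \<eta> * ?s (int x)
      + g * (r0 \<eta> + 1) * (?s (int x) * (?s (int x - 1) + ?s (int x + 1)))
      + g * r1 \<eta> * (?s (int x - 1) + ?s (int x + 1))
      + g\<^sup>2 * (r0 \<eta> - 1) * (?s (int x - 1) * ?s (int x + 1))
      + g\<^sup>2 * r1 \<eta> * (?s (int x) * (?s (int x - 1) * ?s (int x + 1))))"
    unfolding J_def
  proof (rule sum.cong)
    fix x assume "x \<in> {..<n}"
    then have x: "x < n" by simp
    have n2: "n \<ge> 2" using n30 by simp
    have sq: "?s (int x) * ?s (int x) = 1" by (rule spin_at_sq[OF \<eta> n_pos])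
    show "c x (flip x \<eta>) * flip_weight x \<eta> - c x \<eta> = (r0 \<eta> - 1) + r1 \<eta> * ?s (int x)
      + g * (r0 \<eta> + 1) * (?s (int x) * (?s (int x - 1) + ?s (int x + 1)))
      + g * r1 \<eta> * (?s (int x - 1) + ?s (int x + 1))
      + g\<^sup>2 * (r0 \<eta> - 1) * (?s (int x - 1) * ?s (int x + 1))
      + g\<^sup>2 * r1 \<eta> * (?s (int x) * (?s (int x - 1) * ?s (int x + 1)))"
      unfolding rate_flip[OF \<eta> x n2] flip_weight_eq[OF \<eta> x]
      unfolding rate_spin_at[OF x] using sq by algebra
  qed simp
  also have "\<dots> = real n * (r0 \<eta> - 1) + r1 \<eta> * ex.S \<eta> + g * (r0 \<eta> + 1) * (2 * ex.Q1 \<eta>) + g * r1 \<eta> * (2 * ex.S \<eta>)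
     + g\<^sup>2 * (r0 \<eta> - 1) * ex.Q2 \<eta> + g\<^sup>2 * r1 \<eta> * ex.T \<eta>"
    by (simp only: sum.distrib sum_distrib_left[symmetric] sum_neighbours(1,3,4,5)[OF \<eta>] sum_constant card_lessThan)
       (simp only: sum.distrib[symmetric] sum_neighbours(2)[OF \<eta>])
  finally show ?thesis using mean_drift_zero[OF \<eta>] by (simp add: algebra_simps)
qed

lemma E_J_bound: "ex.E J \<le> 31000000 * ex.bound"
proof -
  \<comment> \<open>The coefficients are at most 82 in modulus, so division by 100 makes them
    admissible weights.\<close>
  define \<kappa>1 where "\<kappa>1 \<eta> = 2 * g * (r0 \<eta> + 1) / 100" for \<eta>
  define \<kappa>2 where "\<kappa>2 \<eta> = g\<^sup>2 * (r0 \<eta> - 1) / 100" for \<eta>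
  define \<kappa>3 where "\<kappa>3 \<eta> = g\<^sup>2 * r1 \<eta> / 100" for \<eta>
  have inv: "r0 (exch n z \<eta>) = r0 \<eta>" "r1 (exch n z \<eta>) = r1 \<eta>" for z \<eta>
    by (simp_all add: r0_def r1_def)
  have g2: "0 \<le> g\<^sup>2" "g\<^sup>2 \<le> 1"
    using gam_ge gam_le by (auto simp: power_le_one)
  have b: "0 \<le> r0 \<eta>" "r0 \<eta> \<le> 40" "\<bar>r1 \<eta>\<bar> \<le> 40" if \<eta>: "\<eta> \<in> Om" for \<eta>
  proof -
    define p where "p = up_ratio (ex.S \<eta> - 1)"
    define q where "q = 1 / up_ratio (ex.S \<eta> + 1)"
    have "0 < p" "p \<le> 40" using ratio_bounds[OF S_shift_bounds(1)[OF \<eta>]] by (auto simp: p_def)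
    moreover have "0 < q" "q \<le> 40" using ratio_bounds[OF S_shift_bounds(2)[OF \<eta>]] by (auto simp: q_def)
    moreover have "r0 \<eta> = (p + q) / 2" "r1 \<eta> = (p - q) / 2" by (auto simp: r0_def r1_def p_def q_def)
    ultimately show "0 \<le> r0 \<eta>" "r0 \<eta> \<le> 40" "\<bar>r1 \<eta>\<bar> \<le> 40" by (simp_all add: abs_le_iff)
  qed
  have k1: "ex.invariant_weight \<kappa>1"
    unfolding ex.invariant_weight_def \<kappa>1_def inv
  proof (intro ballI conjI allI refl)
    fix \<eta> assume \<eta>: "\<eta> \<in> Om"
    have "\<bar>g * (r0 \<eta> + 1)\<bar> \<le> 1 * 41"
      unfolding abs_mult using b[OF \<eta>] gam_ge gam_le by (intro mult_mono) auto
    then show "\<bar>2 * g * (r0 \<eta> + 1) / 100\<bar> \<le> 1" by (simp add: abs_mult mult.assoc)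
  qed
  have k2: "ex.invariant_weight \<kappa>2"
    unfolding ex.invariant_weight_def \<kappa>2_def inv
  proof (intro ballI conjI allI refl)
    fix \<eta> assume \<eta>: "\<eta> \<in> Om"
    have "\<bar>g\<^sup>2 * (r0 \<eta> - 1)\<bar> \<le> 1 * 41"
      unfolding abs_mult using b[OF \<eta>] g2 by (intro mult_mono) auto
    then show "\<bar>g\<^sup>2 * (r0 \<eta> - 1) / 100\<bar> \<le> 1" by simp
  qed
  have k3: "ex.invariant_weight \<kappa>3"
    unfolding ex.invariant_weight_def \<kappa>3_def inv
  proof (intro ballI conjI allI refl)
    fix \<eta> assume \<eta>: "\<eta> \<in> Om"
    have "\<bar>g\<^sup>2 * r1 \<eta>\<bar> \<le> 1 * 41"
      unfolding abs_mult using b[OF \<eta>] g2 by (intro mult_mono) auto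
    then show "\<bar>g\<^sup>2 * r1 \<eta> / 100\<bar> \<le> 1" by simp
  qed
  have "ex.E J = ex.E (\<lambda>\<eta>. 100 * (\<kappa>1 \<eta> * (ex.Q1 \<eta> - ex.avg2 \<eta>)) + 100 * (\<kappa>2 \<eta> * (ex.Q2 \<eta> - ex.avg2 \<eta>))
     + 100 * (\<kappa>3 \<eta> * (ex.T \<eta> - ex.avg3 \<eta>)))"
    by (rule ex.E_cong) (simp add: J_eq \<kappa>1_def \<kappa>2_def \<kappa>3_def)
  also have "\<dots> = 100 * ex.E (\<lambda>\<eta>. \<kappa>1 \<eta> * (ex.Q1 \<eta> - ex.avg2 \<eta>)) + 100 * ex.E (\<lambda>\<eta>. \<kappa>2 \<eta> * (ex.Q2 \<eta> - ex.avg2 \<eta>))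
     + 100 * ex.E (\<lambda>\<eta>. \<kappa>3 \<eta> * (ex.T \<eta> - ex.avg3 \<eta>))"
    by (simp only: ex.E_add ex.E_cmult)
  also have "\<dots> \<le> 100 * (1300 * ex.bound) + 100 * (1310 * ex.bound) + 100 * (300000 * ex.bound)"
    using ex.E_pair[OF k1] ex.E_next_pair[OF k2] ex.E_triple[OF k3] by (intro add_mono mult_left_mono) auto
  also have "\<dots> \<le> 31000000 * ex.bound" using ex.bound_nonneg by simp
  finally show ?thesis .
qed

text \<open>Stationarity is tested on the logarithm of the density of \<open>F\<close> relative to
  the reference weight. Exchanges keep the particle number, so there the reference cancels and minus
  the energy appears; for flips, \<open>ln x \<le> x - 1\<close> moves the rates onto the reference
  weight and leaves \<open>J\<close>.\<close>

lemma entropy_production: "(real n)\<^sup>2 * ex.energy \<le> a * ex.E J"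
proof -
  define \<phi> where "\<phi> \<eta> = ln (F \<eta>) - log_weight (particles n \<eta>)" for \<eta>
  have ex_term: "(\<Sum>\<eta>\<in>Om. F \<eta> * (\<phi> (exchange n x \<eta>) - \<phi> \<eta>)) \<le> - (\<Sum>\<eta>\<in>Om. (sqrt (F (exchange n x \<eta>)) - sqrt (F \<eta>))\<^sup>2)"
    if x: "x < n" for x
  proof -
    have "(\<Sum>\<eta>\<in>Om. F \<eta> * (\<phi> (exchange n x \<eta>) - \<phi> \<eta>))
       \<le> (\<Sum>\<eta>\<in>Om. (F (exchange n x \<eta>) - F \<eta>) - (sqrt (F (exchange n x \<eta>)) - sqrt (F \<eta>))\<^sup>2)"
    proof (rule sum_mono)
      fix \<eta> assume \<eta>: "\<eta> \<in> Om"
      define u where "u = sqrt (F \<eta>)"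
      define v where "v = sqrt (F (exchange n x \<eta>))"
      have u: "u > 0" "v > 0" "F \<eta> = u\<^sup>2" "F (exchange n x \<eta>) = v\<^sup>2"
        using mu_ss_pos[OF \<eta>] mu_ss_pos[OF exchange_in_Omega[OF \<eta> x]] by (auto simp: u_def v_def)
      have "\<phi> (exchange n x \<eta>) - \<phi> \<eta> = ln (v\<^sup>2) - ln (u\<^sup>2)"
        using x by (simp add: \<phi>_def particles_exch u)
      also have "\<dots> = 2 * ln (v / u)" using u by (simp add: ln_realpow ln_div)
      also have "\<dots> \<le> 2 * (v / u - 1)" using u ln_le_minus_one[of "v / u"] by simp
      finally have "u\<^sup>2 * (\<phi> (exchange n x \<eta>) - \<phi> \<eta>) \<le> u\<^sup>2 * (2 * (v / u - 1))"
        by (rule mult_left_mono) simp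
      \<comment> \<open>The first bracket cancels after summation, by invariance under the exchange;
        the square is the bond energy.\<close>
      also have "\<dots> = (v\<^sup>2 - u\<^sup>2) - (v - u)\<^sup>2" using u by (simp add: field_simps power2_eq_square)
      finally show "F \<eta> * (\<phi> (exchange n x \<eta>) - \<phi> \<eta>)
          \<le> (F (exchange n x \<eta>) - F \<eta>) - (sqrt (F (exchange n x \<eta>)) - sqrt (F \<eta>))\<^sup>2"
        unfolding u(3,4) using u(1,2) by simp
    qed
    also have "\<dots> = - (\<Sum>\<eta>\<in>Om. (sqrt (F (exchange n x \<eta>)) - sqrt (F \<eta>))\<^sup>2)"
      using sum_exch[OF n_pos, of F "int x"] x by (simp add: sum_subtractf exch_nat)
    finally show ?thesis .
  qed
  have flip_term: "(\<Sum>\<eta>\<in>Om. F \<eta> * (c x \<eta> * (\<phi> (flip x \<eta>) - \<phi> \<eta>)))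
      \<le> (\<Sum>\<eta>\<in>Om. F \<eta> * (c x (flip x \<eta>) * flip_weight x \<eta> - c x \<eta>))" if x: "x < n" for x
  proof -
    \<comment> \<open>The upper bound carries \<open>F\<close> at the flipped configuration; written
      as \<open>h (flip x \<eta>)\<close>, it returns to \<open>F \<eta>\<close> by the
      involution.\<close>
    define h where "h \<eta> = c x (flip x \<eta>) * (F \<eta> * flip_weight x \<eta>)" for \<eta>
    have "(\<Sum>\<eta>\<in>Om. F \<eta> * (c x \<eta> * (\<phi> (flip x \<eta>) - \<phi> \<eta>))) \<le> (\<Sum>\<eta>\<in>Om. h (flip x \<eta>) - F \<eta> * c x \<eta>)"
    proof (rule sum_mono)
      fix \<eta> assume \<eta>: "\<eta> \<in> Om"
      define w where "w = log_weight (particles n \<eta>) - log_weight (particles n (flip x \<eta>))"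
      have pos: "F \<eta> > 0" "F (flip x \<eta>) > 0" using mu_ss_pos[OF \<eta>] mu_ss_pos[OF flip_in_Omega[OF \<eta> x]] by auto
      have c: "c x \<eta> \<ge> 0"
        using rate_bounds(1)[OF \<eta> x gam_pos gam_less] zero_le_power2[of "1 - g"] by linarith
      have "\<phi> (flip x \<eta>) - \<phi> \<eta> = ln (F (flip x \<eta>) * exp w / F \<eta>)"
        using pos by (simp add: \<phi>_def w_def ln_div ln_mult)
      also have "\<dots> \<le> F (flip x \<eta>) * exp w / F \<eta> - 1" using pos by (intro ln_le_minus_one) simp
      finally have "F \<eta> * c x \<eta> * (\<phi> (flip x \<eta>) - \<phi> \<eta>) \<le> F \<eta> * c x \<eta> * (F (flip x \<eta>) * exp w / F \<eta> - 1)"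
        using pos c by (intro mult_left_mono) auto
      also have "\<dots> = c x \<eta> * (F (flip x \<eta>) * exp w) - F \<eta> * c x \<eta>"
        using pos by (simp add: field_simps)
      also have "c x \<eta> * (F (flip x \<eta>) * exp w) = h (flip x \<eta>)"
        by (simp add: h_def flip_weight_def flip_flip[OF \<eta> x] w_def)
      finally show "F \<eta> * (c x \<eta> * (\<phi> (flip x \<eta>) - \<phi> \<eta>)) \<le> h (flip x \<eta>) - F \<eta> * c x \<eta>"
        by (simp add: mult.assoc)
    qed
    also have "\<dots> = (\<Sum>\<eta>\<in>Om. h \<eta>) - (\<Sum>\<eta>\<in>Om. F \<eta> * c x \<eta>)"
      unfolding sum_subtractf sum_flip[OF x] ..
    also have "\<dots> = (\<Sum>\<eta>\<in>Om. F \<eta> * (c x (flip x \<eta>) * flip_weight x \<eta> - c x \<eta>))"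
      unfolding sum_subtractf[symmetric] h_def by (rule sum.cong) (auto simp: algebra_simps)
    finally show ?thesis .
  qed
  have "0 = (\<Sum>\<eta>\<in>Om. F \<eta> * L \<phi> \<eta>)" using mu_ss_generator[of \<phi>] by simp
  also have "\<dots> = (real n)\<^sup>2 * (\<Sum>x<n. \<Sum>\<eta>\<in>Om. F \<eta> * (\<phi> (exchange n x \<eta>) - \<phi> \<eta>))
     + a * (\<Sum>x<n. \<Sum>\<eta>\<in>Om. F \<eta> * (c x \<eta> * (\<phi> (flip x \<eta>) - \<phi> \<eta>)))"
    unfolding generator_def L_ex_def L_G_def
    by (subst (1 2) sum.swap) (simp add: sum.distrib sum_distrib_left algebra_simps)
  also have "\<dots> \<le> (real n)\<^sup>2 * (\<Sum>x<n. - (\<Sum>\<eta>\<in>Om. (sqrt (F (exchange n x \<eta>)) - sqrt (F \<eta>))\<^sup>2))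
     + a * (\<Sum>x<n. \<Sum>\<eta>\<in>Om. F \<eta> * (c x (flip x \<eta>) * flip_weight x \<eta> - c x \<eta>))"
    using a_pos by (intro add_mono mult_left_mono sum_mono ex_term flip_term) auto
  also have "\<dots> = - ((real n)\<^sup>2 * ex.energy) + a * ex.E J"
  proof -
    have "ex.E J = (\<Sum>x<n. \<Sum>\<eta>\<in>Om. F \<eta> * (c x (flip x \<eta>) * flip_weight x \<eta> - c x \<eta>))"
      unfolding ex.E_def J_def sum_distrib_left by (rule sum.swap)
    then show ?thesis by (simp add: energy_nat sum_negf)
  qed
  finally show ?thesis by simp
qed

text \<open>The mass is 1, so the scaled energy satisfies \<open>X \<le> (1 + X) / 2\<close>. This
  is where \<open>a\<close> must be small; 62000000 is twice the constant of
  \<open>E_J_bound\<close>.\<close>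

lemma bound_le_2:
  assumes "62000000 * a \<le> 1"
  shows "ex.bound \<le> 2"
proof -
  define X where "X = (real n)\<^sup>2 * ex.energy"
  have "a * ex.E J \<le> a * (31000000 * ex.bound)" using a_pos by (intro mult_left_mono E_J_bound) simp
  then have "X \<le> a * (31000000 * ex.bound)" using entropy_production by (simp add: X_def)
  also have "\<dots> \<le> (1 / 2) * ex.bound"
    using mult_right_mono[OF assms ex.bound_nonneg] by simp
  finally show ?thesis by (simp add: ex.bound_def mass_eq X_def)
qed

end

section \<open>The drift of the rescaled magnetization\<close>

lemma second_order_Taylor:
  fixes \<phi> f k :: "real \<Rightarrow> real"
  assumes \<phi>: "\<And>y. (\<phi> has_real_derivative f y) (at y)" and f: "\<And>y. (f has_real_derivative k y) (at y)"
  shows "\<exists>\<xi>. \<bar>\<xi> - y\<bar> \<le> \<bar>h\<bar> \<and> \<phi> (y + h) = \<phi> y + h * f y + h\<^sup>2 / 2 * k \<xi>"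
proof (cases "h = 0")
  case False
  define D where "D m = (if m = 0 then \<phi> else if m = 1 then f else k)" for m :: nat
  have "\<exists>t. (if y + h < y then y + h < t \<and> t < y else y < t \<and> t < y + h) \<and>
    \<phi> (y + h) = (\<Sum>m<2. D m y / fact m * (y + h - y) ^ m) + D 2 t / fact 2 * (y + h - y) ^ 2"
    by (rule Taylor[where a = "y - \<bar>h\<bar>" and b = "y + \<bar>h\<bar>"])
       (use False in \<open>auto simp: D_def less_2_cases_iff intro!: \<phi> f\<close>)
  then obtain t where "if y + h < y then y + h < t \<and> t < y else y < t \<and> t < y + h"
    and "\<phi> (y + h) = \<phi> y + h * f y + h\<^sup>2 / 2 * k t"
    by (auto simp: D_def numeral_2_eq_2 algebra_simps)
  then show ?thesis by (intro exI[of _ t]) (auto split: if_splits)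
qed (auto intro!: exI[of _ y])

context stationary begin

abbreviation "Y \<equiv> magnetization n"

text \<open>In terms of the fourth root of \<open>n\<close> the scalings are integral powers: one
  flip changes the magnetization by \<open>1 / q ^ 3\<close>, and \<open>1 - 2 * g\<close> is
  \<open>\<theta> / q\<^sup>2\<close>.\<close>

definition q :: real where "q = real n powr (1 / 4)"

lemma q_pos: "q > 0"
  using n_pos by (simp add: q_def)

lemma q_powers: "q ^ 4 = real n" "sqrt (real n) = q\<^sup>2" "real n powr (- 3 / 4) = 1 / q ^ 3"
proof -
  have n: "real n > 0" using n_pos by simp
  have p: "q ^ k = real n powr (real k / 4)" for k
    using n by (simp add: q_def powr_realpow[symmetric] powr_powr)
  show "q ^ 4 = real n" unfolding p using n by simp
  show "sqrt (real n) = q\<^sup>2" unfolding p using n by (simp add: powr_half_sqrt)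
  show "real n powr (- 3 / 4) = 1 / q ^ 3" unfolding p by (simp add: powr_minus_divide)
qed

lemma q_ge1: "q \<ge> 1"
  unfolding q_def using n30 by (intro ge_one_powr_ge_zero) auto

lemma Y_eq: "Y \<eta> = ex.S \<eta> / (2 * q ^ 3)"
proof -
  have half: "(\<Sum>x<n. real (\<eta> x) - 1 / 2) = ex.S \<eta> / 2"
    by (simp add: S_particles particles_def sum_subtractf)
  show ?thesis unfolding magnetization_def q_powers(3) half by simp
qed

lemma S_eq: "ex.S \<eta> = 2 * q ^ 3 * Y \<eta>"
  using q_pos by (simp add: Y_eq)

lemma Y_exch: "Y (exch n z \<eta>) = Y \<eta>"
  by (simp add: Y_eq)

lemma Y_flip:
  assumes \<eta>: "\<eta> \<in> Om" and x: "x < n"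
  shows "Y (flip x \<eta>) = Y \<eta> + - (spin_at n \<eta> (int x) / q ^ 3)"
proof -
  have "ex.S (flip x \<eta>) = ex.S \<eta> - 2 * (\<Sum>i\<in>{0..<int n}. spin_at n \<eta> i * kron n (int x) i)"
    unfolding ex.S_def spin_at_flip[OF \<eta> x] by (simp add: sum_subtractf sum_distrib_left)
  also have "(\<Sum>i\<in>{0..<int n}. spin_at n \<eta> i * kron n (int x) i) = spin_at n \<eta> (int x)"
    by (rule sum_kron[OF periodic_spin_at n_pos])
  finally show ?thesis using q_pos by (simp add: Y_eq field_simps)
qed

lemma sum_rate_spin:
  assumes "\<eta> \<in> Om"
  shows "(\<Sum>x<n. c x \<eta> * spin_at n \<eta> (int x)) = \<theta> / q\<^sup>2 * ex.S \<eta> + g\<^sup>2 * ex.T \<eta>"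
proof -
  let ?s = "spin_at n \<eta>"
  have "(\<Sum>x<n. c x \<eta> * ?s (int x)) = (\<Sum>x<n. ?s (int x) - g * (?s (int x - 1) + ?s (int x + 1))
      + g\<^sup>2 * (?s (int x) * (?s (int x - 1) * ?s (int x + 1))))"
  proof (rule sum.cong)
    fix x assume "x \<in> {..<n}"
    then have x: "x < n" by simp
    have "?s (int x) * ?s (int x) = 1" by (rule spin_at_sq[OF assms n_pos])
    then show "c x \<eta> * ?s (int x) = ?s (int x) - g * (?s (int x - 1) + ?s (int x + 1))
      + g\<^sup>2 * (?s (int x) * (?s (int x - 1) * ?s (int x + 1)))"
      unfolding rate_spin_at[OF x] by algebra
  qed simp
  also have "\<dots> = ex.S \<eta> - g * (2 * ex.S \<eta>) + g\<^sup>2 * ex.T \<eta>"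
    unfolding sum.distrib[of "\<lambda>x. _ x - _ x"] sum_subtractf sum_distrib_left[symmetric] sum_neighbours[OF assms] ..
  also have "ex.S \<eta> - g * (2 * ex.S \<eta>) = (1 - 2 * g) * ex.S \<eta>" by (simp add: algebra_simps)
  also have "2 * g = 1 - \<theta> / q\<^sup>2" unfolding gam_def q_powers(2) by simp
  finally show ?thesis by simp
qed

lemma sum_rate:
  assumes "\<eta> \<in> Om"
  shows "(\<Sum>x<n. c x \<eta>) = real n - 2 * g * ex.Q1 \<eta> + g\<^sup>2 * ex.Q2 \<eta>"
proof -
  let ?s = "spin_at n \<eta>"
  have "(\<Sum>x<n. c x \<eta>) = (\<Sum>x<n. 1 - g * (?s (int x) * (?s (int x - 1) + ?s (int x + 1))) + g\<^sup>2 * (?s (int x - 1) * ?s (int x + 1)))"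
    by (rule sum.cong) (auto simp: rate_spin_at)
  then show ?thesis
    by (simp only: sum.distrib sum_subtractf sum_distrib_left[symmetric] sum_neighbours(3,4)[OF assms]) simp
qed

text \<open>Functions of the magnetization do not see the exchanges, and the remaining factor
  \<open>a\<close> cancels.\<close>

lemma generator_identity: "ex.E (\<lambda>\<eta>. \<Sum>x<n. c x \<eta> * (\<phi> (Y (flip x \<eta>)) - \<phi> (Y \<eta>))) = 0"
proof -
  have "L (\<lambda>\<eta>. \<phi> (Y \<eta>)) \<eta> = a * (\<Sum>x<n. c x \<eta> * (\<phi> (Y (flip x \<eta>)) - \<phi> (Y \<eta>)))" for \<eta>
  proof -
    have "L_ex n (\<lambda>\<eta>. \<phi> (Y \<eta>)) \<eta> = 0"
      unfolding L_ex_def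
    proof (rule sum.neutral, rule ballI)
      fix x assume "x \<in> {..<n}"
      then show "\<phi> (Y (exchange n x \<eta>)) - \<phi> (Y \<eta>) = 0" using Y_exch[of "int x" \<eta>] by (simp add: exch_nat)
    qed
    then show ?thesis by (simp add: generator_def L_G_def)
  qed
  then have "ex.E (\<lambda>\<eta>. a * (\<Sum>x<n. c x \<eta> * (\<phi> (Y (flip x \<eta>)) - \<phi> (Y \<eta>)))) = 0"
    using mu_ss_generator[of "\<lambda>\<eta>. \<phi> (Y \<eta>)"] by (simp add: ex.E_def)
  then have "a * ex.E (\<lambda>\<eta>. \<Sum>x<n. c x \<eta> * (\<phi> (Y (flip x \<eta>)) - \<phi> (Y \<eta>))) = 0"
    unfolding ex.E_cmult .
  then show ?thesis using a_pos by simp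
qed

text \<open>The stationarity identity is scaled by \<open>2 * q\<^sup>2\<close>; the first order
  term then carries \<open>2 / q\<close>, the second order one \<open>1 / n\<close> times the total
  rate. The \<open>n\<close> rates are at most 4, and
  \<open>n * 4 * (2 * q\<^sup>2) * \<omega> / (2 * q ^ 6)\<close> is
  \<open>4 * \<omega>\<close>.\<close>

lemma Taylor_estimate:
  assumes tay: "\<And>y h. \<bar>h\<bar> = 1 / q ^ 3 \<Longrightarrow> \<bar>\<phi> (y + h) - \<phi> y - h * f y - h\<^sup>2 / 2 * k y\<bar> \<le> h\<^sup>2 / 2 * \<omega>"
  shows "\<bar>ex.E (\<lambda>\<eta>. 2 / q * f (Y \<eta>) * (\<Sum>x<n. c x \<eta> * spin_at n \<eta> (int x)) - k (Y \<eta>) / real n * (\<Sum>x<n. c x \<eta>))\<bar> \<le> 4 * \<omega>"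
proof -
  let ?s = "spin_at n"
  have n: "real n = q ^ 4" by (simp add: q_powers)
  have \<omega>: "0 \<le> \<omega>"
  proof -
    have "0 \<le> (1 / q ^ 3)\<^sup>2 / 2 * \<omega>" using tay[of "1 / q ^ 3" 0] q_pos by (smt (verit) abs_of_pos zero_less_power zero_less_divide_1_iff)
    then show ?thesis using q_pos by (simp add: zero_le_mult_iff)
  qed
  have pt: "\<bar>2 / q * f (Y \<eta>) * (\<Sum>x<n. c x \<eta> * ?s \<eta> (int x)) - k (Y \<eta>) / real n * (\<Sum>x<n. c x \<eta>)
      + 2 * q\<^sup>2 * (\<Sum>x<n. c x \<eta> * (\<phi> (Y (flip x \<eta>)) - \<phi> (Y \<eta>)))\<bar> \<le> 4 * \<omega>" if \<eta>: "\<eta> \<in> Om" for \<eta>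
  proof -
    have term_eq: "2 / q * f (Y \<eta>) * (c x \<eta> * ?s \<eta> (int x)) - k (Y \<eta>) / real n * c x \<eta>
      + 2 * q\<^sup>2 * (c x \<eta> * (\<phi> (Y (flip x \<eta>)) - \<phi> (Y \<eta>)))
      = 2 * q\<^sup>2 * c x \<eta> * (\<phi> (Y \<eta> + h) - \<phi> (Y \<eta>) - h * f (Y \<eta>) - h\<^sup>2 / 2 * k (Y \<eta>))"
      if x: "x < n" and h: "h = - (?s \<eta> (int x) / q ^ 3)" for x h
    proof -
      have h2: "h\<^sup>2 = 1 / q ^ 6" unfolding h using spin_at_values[OF \<eta> n_pos, of "int x"]
        by (auto simp: power_divide power_mult[symmetric])
      have e1: "2 * q\<^sup>2 * c x \<eta> * (h * f (Y \<eta>)) = - (2 / q * f (Y \<eta>) * (c x \<eta> * ?s \<eta> (int x)))"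
        unfolding h using q_pos by (simp add: field_simps power2_eq_square power3_eq_cube)
      have e2: "2 * q\<^sup>2 * c x \<eta> * (h\<^sup>2 / 2 * k (Y \<eta>)) = k (Y \<eta>) / real n * c x \<eta>"
        unfolding h2 n using q_pos by (simp add: field_simps power_add[symmetric])
      show ?thesis unfolding Y_flip[OF \<eta> x] h[symmetric] right_diff_distrib e1 e2 by (simp add: algebra_simps)
    qed
    have eq: "2 / q * f (Y \<eta>) * (\<Sum>x<n. c x \<eta> * ?s \<eta> (int x)) - k (Y \<eta>) / real n * (\<Sum>x<n. c x \<eta>)
      + 2 * q\<^sup>2 * (\<Sum>x<n. c x \<eta> * (\<phi> (Y (flip x \<eta>)) - \<phi> (Y \<eta>)))
      = (\<Sum>x<n. 2 / q * f (Y \<eta>) * (c x \<eta> * ?s \<eta> (int x)) - k (Y \<eta>) / real n * c x \<eta>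
      + 2 * q\<^sup>2 * (c x \<eta> * (\<phi> (Y (flip x \<eta>)) - \<phi> (Y \<eta>))))"
      by (simp only: sum.distrib sum_subtractf sum_distrib_left)
    show ?thesis unfolding eq
    proof (rule order_trans)
      show "\<bar>\<Sum>x<n. 2 / q * f (Y \<eta>) * (c x \<eta> * ?s \<eta> (int x)) - k (Y \<eta>) / real n * c x \<eta>
        + 2 * q\<^sup>2 * (c x \<eta> * (\<phi> (Y (flip x \<eta>)) - \<phi> (Y \<eta>)))\<bar> \<le> (\<Sum>x<n. 2 * q\<^sup>2 * 4 * (1 / q ^ 6 / 2 * \<omega>))"
    proof (rule order_trans[OF sum_abs], rule sum_mono)
      fix x assume "x \<in> {..<n}"
      then have x: "x < n" by simp
      define h where "h = - (?s \<eta> (int x) / q ^ 3)"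
      have h: "\<bar>h\<bar> = 1 / q ^ 3" using spin_at_values[OF \<eta> n_pos, of "int x"] q_pos by (auto simp: h_def)
      have "h\<^sup>2 = \<bar>h\<bar>\<^sup>2" by simp
      then have h2: "h\<^sup>2 = 1 / q ^ 6" unfolding h by (simp add: power_divide power_mult[symmetric])
      have cx: "\<bar>c x \<eta>\<bar> \<le> 4"
        using rate_bounds[OF \<eta> x gam_pos gam_less] zero_le_power2[of "1 - g"] by linarith
      show "\<bar>2 / q * f (Y \<eta>) * (c x \<eta> * ?s \<eta> (int x)) - k (Y \<eta>) / real n * c x \<eta>
        + 2 * q\<^sup>2 * (c x \<eta> * (\<phi> (Y (flip x \<eta>)) - \<phi> (Y \<eta>)))\<bar> \<le> 2 * q\<^sup>2 * 4 * (1 / q ^ 6 / 2 * \<omega>)"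
      proof -
        define R where "R = \<phi> (Y \<eta> + h) - \<phi> (Y \<eta>) - h * f (Y \<eta>) - h\<^sup>2 / 2 * k (Y \<eta>)"
        have "\<bar>R\<bar> \<le> h\<^sup>2 / 2 * \<omega>" unfolding R_def by (rule tay[OF h])
        then have R: "\<bar>R\<bar> \<le> 1 / q ^ 6 / 2 * \<omega>" unfolding h2 .
        have "\<bar>2 * q\<^sup>2 * c x \<eta> * R\<bar> = 2 * q\<^sup>2 * (\<bar>c x \<eta>\<bar> * \<bar>R\<bar>)" by (simp add: abs_mult)
        also have "\<dots> \<le> 2 * q\<^sup>2 * (4 * (1 / q ^ 6 / 2 * \<omega>))"
          by (rule mult_left_mono[OF mult_mono[OF cx R]]) auto
        finally show ?thesis unfolding term_eq[OF x h_def] R_def by (simp only: mult.assoc)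
      qed
    qed
    have "(\<Sum>x<n. 2 * q\<^sup>2 * 4 * (1 / q ^ 6 / 2 * \<omega>)) = 4 * \<omega>"
    proof -
      have "(\<Sum>x<n. 2 * q\<^sup>2 * 4 * (1 / q ^ 6 / 2 * \<omega>)) = q ^ 4 * (2 * q\<^sup>2 * 4 * (1 / q ^ 6 / 2 * \<omega>))"
        by (simp only: sum_constant card_lessThan n)
      also have "\<dots> = 4 * \<omega>"
      proof -
        have "q ^ 6 = q ^ 4 * q\<^sup>2" by (simp flip: power_add)
        then show ?thesis using q_pos by (simp only:) (simp add: divide_simps)
      qed
      finally show ?thesis .
    qed
    then show "(\<Sum>x<n. 2 * q\<^sup>2 * 4 * (1 / q ^ 6 / 2 * \<omega>)) \<le> 4 * \<omega>" by simp
    qed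
  qed
  have "\<bar>ex.E (\<lambda>\<eta>. 2 / q * f (Y \<eta>) * (\<Sum>x<n. c x \<eta> * ?s \<eta> (int x)) - k (Y \<eta>) / real n * (\<Sum>x<n. c x \<eta>)
      + 2 * q\<^sup>2 * (\<Sum>x<n. c x \<eta> * (\<phi> (Y (flip x \<eta>)) - \<phi> (Y \<eta>))))\<bar> \<le> ex.E (\<lambda>_. 4 * \<omega>)"
    by (rule ex.abs_E_le) (rule pt)
  then show ?thesis
    by (simp only: ex.E_add ex.E_cmult generator_identity ex.E_const mass_eq)
qed

lemma invariant_weight_Y:
  assumes "\<And>y. \<bar>f y\<bar> \<le> 1"
  shows "ex.invariant_weight (\<lambda>\<eta>. f (Y \<eta>))"
  using assms by (simp add: ex.invariant_weight_def Y_exch)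

text \<open>Together with \<open>linear_coeff\<close>, the coefficients of \<open>avg3\<close> as a
  polynomial in the rescaled magnetization. They tend to 4 and 0 as \<open>g\<close> tends to
  1/2.\<close>

definition cubic_coeff :: real where
  "cubic_coeff = 16 * g\<^sup>2 * (real n)\<^sup>2 / ((real n - 1) * (real n - 2))"

definition linear_coeff :: real where
  "linear_coeff = 4 * g\<^sup>2 * q\<^sup>2 * (3 * real n - 2) / ((real n - 1) * (real n - 2))"

abbreviation drift :: "real \<Rightarrow> real" where
  "drift y \<equiv> 4 * \<theta> * y + (cubic_coeff * y ^ 3 - linear_coeff * y)"

lemma avg3_Y: "2 / q * (\<theta> / q\<^sup>2 * ex.S \<eta> + g\<^sup>2 * ex.avg3 \<eta>)
   = drift (Y \<eta>)"
proof -
  define N where "N = real n"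
  have N: "N - 1 \<noteq> 0" "N - 2 \<noteq> 0" using n30 by (auto simp: N_def)
  have "ex.avg3 \<eta> = (ex.S \<eta> ^ 3 - (3 * N - 2) * ex.S \<eta>) / ((N - 1) * (N - 2))"
    unfolding ex.avg3_def ex.avg2_def N_def[symmetric] using N
    by (simp add: divide_simps) (simp add: algebra_simps power2_eq_square power3_eq_cube)
  also have "\<dots> = q * ((8 * N\<^sup>2 * Y \<eta> ^ 3 - 2 * q\<^sup>2 * (3 * N - 2) * Y \<eta>) / ((N - 1) * (N - 2)))"
  proof -
    have "ex.S \<eta> ^ 3 = q * (8 * N\<^sup>2 * Y \<eta> ^ 3)" "ex.S \<eta> = q * (2 * q\<^sup>2 * Y \<eta>)"
      unfolding S_eq N_def q_powers(1)[symmetric] by (simp_all add: power_mult_distrib eval_nat_numeral)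
    then show ?thesis by (simp add: algebra_simps)
  qed
  finally have "2 / q * (g\<^sup>2 * ex.avg3 \<eta>) = 2 * g\<^sup>2 * ((8 * N\<^sup>2 * Y \<eta> ^ 3 - 2 * q\<^sup>2 * (3 * N - 2) * Y \<eta>) / ((N - 1) * (N - 2)))"
    using q_pos by simp
  also have "\<dots> = cubic_coeff * Y \<eta> ^ 3 - linear_coeff * Y \<eta>"
    by (simp add: cubic_coeff_def linear_coeff_def N_def diff_divide_distrib add_divide_distrib algebra_simps)
  finally have "2 / q * (g\<^sup>2 * ex.avg3 \<eta>) = cubic_coeff * Y \<eta> ^ 3 - linear_coeff * Y \<eta>" .
  moreover have "2 / q * (\<theta> / q\<^sup>2 * ex.S \<eta>) = 4 * \<theta> * Y \<eta>"
    unfolding S_eq using q_pos by (simp add: field_simps power2_eq_square power3_eq_cube)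
  ultimately show ?thesis by (simp add: distrib_left)
qed

text \<open>For \<open>P\<close> equal to \<open>Q1\<close> or \<open>Q2\<close> this shows that the
  total rate divided by \<open>n\<close> is nearly 1. Given the magnetization,
  \<open>avg2 / n\<close> has order \<open>(1 + Y\<^sup>2) / q\<^sup>2\<close>, whence the bound
  demanded of \<open>k y * y\<^sup>2\<close>.\<close>

lemma pair_estimate:
  assumes a_small: "62000000 * a \<le> 1" and k: "\<And>y. \<bar>k y\<bar> \<le> K" "\<And>y. \<bar>k y * y\<^sup>2\<bar> \<le> K"
    and K: "K > 0"
    and dev: "\<And>\<kappa>. ex.invariant_weight \<kappa> \<Longrightarrow> \<bar>ex.E (\<lambda>\<eta>. \<kappa> \<eta> * (P \<eta> - ex.avg2 \<eta>))\<bar> \<le> 1310 * ex.bound"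
  shows "\<bar>ex.E (\<lambda>\<eta>. k (Y \<eta>) / real n * P \<eta>)\<bar> \<le> 3000 * K / q\<^sup>2"
proof -
  have n: "real n = q ^ 4" by (simp add: q_powers)
  have n30': "real n \<ge> 30" using n30 by simp
  have "ex.invariant_weight (\<lambda>\<eta>. k (Y \<eta>) / K)"
    by (rule invariant_weight_Y) (use k K in \<open>auto simp: field_simps\<close>)
  from dev[OF this] have 1: "\<bar>ex.E (\<lambda>\<eta>. k (Y \<eta>) / K * (P \<eta> - ex.avg2 \<eta>))\<bar> \<le> 2620"
    using bound_le_2[OF a_small] by linarith
  have "\<bar>ex.E (\<lambda>\<eta>. k (Y \<eta>) / real n * ex.avg2 \<eta>)\<bar> \<le> ex.E (\<lambda>_. 10 * K / q\<^sup>2)"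
  proof (rule ex.abs_E_le)
    fix \<eta>
    have q2: "q\<^sup>2 \<ge> 1" using q_ge1 by simp
    have n1: "real n - 1 \<ge> q ^ 4 / 2" using n30' n by simp
    have "ex.avg2 \<eta> = (4 * q ^ 6 * (Y \<eta>)\<^sup>2 - q ^ 4) / (real n - 1)"
      unfolding ex.avg2_def S_eq n by (simp add: power_mult_distrib power_mult[symmetric])
    also have "4 * q ^ 6 * (Y \<eta>)\<^sup>2 - q ^ 4 = q ^ 4 * (4 * q\<^sup>2 * (Y \<eta>)\<^sup>2 - 1)"
      by (simp add: algebra_simps power_add[symmetric])
    finally have "k (Y \<eta>) / q ^ 4 * ex.avg2 \<eta> = k (Y \<eta>) * (4 * q\<^sup>2 * (Y \<eta>)\<^sup>2 - 1) / (real n - 1)"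
      using q_pos by simp
    then have "k (Y \<eta>) / real n * ex.avg2 \<eta> = (4 * q\<^sup>2 * (k (Y \<eta>) * (Y \<eta>)\<^sup>2) - k (Y \<eta>)) / (real n - 1)"
      unfolding n by (simp add: algebra_simps)
    moreover have "\<bar>4 * q\<^sup>2 * (k (Y \<eta>) * (Y \<eta>)\<^sup>2) - k (Y \<eta>)\<bar> \<le> 5 * q\<^sup>2 * K"
    proof -
      have "\<bar>4 * q\<^sup>2 * (k (Y \<eta>) * (Y \<eta>)\<^sup>2)\<bar> \<le> 4 * q\<^sup>2 * K"
        unfolding abs_mult[of "4 * q\<^sup>2"] using k(2)[of "Y \<eta>"] by (intro mult_mono) auto
      moreover have "\<bar>k (Y \<eta>)\<bar> \<le> q\<^sup>2 * K" using k(1)[of "Y \<eta>"] mult_right_mono[OF q2, of K] K by linarith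
      ultimately show ?thesis by linarith
    qed
    ultimately have "\<bar>k (Y \<eta>) / real n * ex.avg2 \<eta>\<bar> \<le> 5 * q\<^sup>2 * K / (q ^ 4 / 2)"
      using n1 n30' q_pos K by (simp only: abs_divide) (intro frac_le, auto)
    also have "\<dots> = 10 * K / q\<^sup>2" using q_pos by (simp add: field_simps eval_nat_numeral)
    finally show "\<bar>k (Y \<eta>) / real n * ex.avg2 \<eta>\<bar> \<le> 10 * K / q\<^sup>2" .
  qed
  then have 2: "\<bar>ex.E (\<lambda>\<eta>. k (Y \<eta>) / real n * ex.avg2 \<eta>)\<bar> \<le> 10 * K / q\<^sup>2"
    by (simp add: ex.E_const mass_eq)
  have "ex.E (\<lambda>\<eta>. k (Y \<eta>) / real n * P \<eta>)
     = K / real n * ex.E (\<lambda>\<eta>. k (Y \<eta>) / K * (P \<eta> - ex.avg2 \<eta>)) + ex.E (\<lambda>\<eta>. k (Y \<eta>) / real n * ex.avg2 \<eta>)"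
    unfolding ex.E_cmult[symmetric] ex.E_add[symmetric]
    by (rule ex.E_cong) (use K n30' in \<open>simp add: field_simps\<close>)
  moreover have "\<bar>K / real n * ex.E (\<lambda>\<eta>. k (Y \<eta>) / K * (P \<eta> - ex.avg2 \<eta>))\<bar> \<le> K / q\<^sup>2 * 2620"
  proof -
    have "q\<^sup>2 * 1 \<le> q\<^sup>2 * q\<^sup>2" using q_ge1 by (intro mult_left_mono) auto
    then have "q\<^sup>2 \<le> real n" by (simp add: n power2_eq_square eval_nat_numeral mult.assoc)
    then have "\<bar>K / real n\<bar> \<le> K / q\<^sup>2" using K q_pos by (simp add: frac_le)
    then show ?thesis unfolding abs_mult using 1 K by (intro mult_mono) auto
  qed
  moreover have "K / q\<^sup>2 * 2620 + 10 * K / q\<^sup>2 \<le> 3000 * K / q\<^sup>2"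
    using K q_pos by (simp add: field_simps)
  ultimately show ?thesis using 2 by linarith
qed

text \<open>Replacing \<open>T\<close> costs order \<open>K / q\<close> and the pair sums order
  \<open>K / q\<^sup>2\<close>. Of \<open>f\<close> only boundedness is asked, so that a test
  function without compact support can serve for the tail bound.\<close>

lemma drift_estimate:
  assumes a_small: "62000000 * a \<le> 1"
    and tay: "\<And>y h. \<bar>h\<bar> = 1 / q ^ 3 \<Longrightarrow> \<bar>\<phi> (y + h) - \<phi> y - h * f y - h\<^sup>2 / 2 * k y\<bar> \<le> h\<^sup>2 / 2 * \<omega>"
    and f: "\<And>y. \<bar>f y\<bar> \<le> K" and k: "\<And>y. \<bar>k y\<bar> \<le> K" "\<And>y. \<bar>k y * y\<^sup>2\<bar> \<le> K" and K: "K > 0"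
  shows "\<bar>ex.E (\<lambda>\<eta>. f (Y \<eta>) * drift (Y \<eta>) - k (Y \<eta>))\<bar>
    \<le> 4 * \<omega> + 1300000 * K / q"
proof -
  have n: "real n > 0" using n_pos by simp
  have "ex.invariant_weight (\<lambda>\<eta>. f (Y \<eta>) / K)"
    by (rule invariant_weight_Y) (use f K in \<open>auto simp: field_simps\<close>)
  from ex.E_triple[OF this] have 1: "\<bar>ex.E (\<lambda>\<eta>. f (Y \<eta>) / K * (ex.T \<eta> - ex.avg3 \<eta>))\<bar> \<le> 600000"
    using bound_le_2[OF a_small] by linarith
  have 2: "\<bar>ex.E (\<lambda>\<eta>. k (Y \<eta>) / real n * ex.Q1 \<eta>)\<bar> \<le> 3000 * K / q\<^sup>2"
  proof (rule pair_estimate[OF a_small k K])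
    fix \<kappa> assume "ex.invariant_weight \<kappa>"
    from ex.E_pair[OF this] show "\<bar>ex.E (\<lambda>\<eta>. \<kappa> \<eta> * (ex.Q1 \<eta> - ex.avg2 \<eta>))\<bar> \<le> 1310 * ex.bound"
      using ex.bound_nonneg by linarith
  qed
  have 3: "\<bar>ex.E (\<lambda>\<eta>. k (Y \<eta>) / real n * ex.Q2 \<eta>)\<bar> \<le> 3000 * K / q\<^sup>2"
    by (rule pair_estimate[OF a_small k K]) (rule ex.E_next_pair)
  let ?main = "\<lambda>\<eta>. f (Y \<eta>) * drift (Y \<eta>) - k (Y \<eta>)"
  let ?tay = "\<lambda>\<eta>. 2 / q * f (Y \<eta>) * (\<Sum>x<n. c x \<eta> * spin_at n \<eta> (int x)) - k (Y \<eta>) / real n * (\<Sum>x<n. c x \<eta>)"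
  have "ex.E ?main = ex.E (\<lambda>\<eta>. ?tay \<eta> - 2 * g\<^sup>2 * K / q * (f (Y \<eta>) / K * (ex.T \<eta> - ex.avg3 \<eta>))
      - 2 * g * (k (Y \<eta>) / real n * ex.Q1 \<eta>) + g\<^sup>2 * (k (Y \<eta>) / real n * ex.Q2 \<eta>))"
  proof (rule ex.E_cong)
    fix \<eta> assume \<eta>: "\<eta> \<in> Om"
    show "?main \<eta> = ?tay \<eta> - 2 * g\<^sup>2 * K / q * (f (Y \<eta>) / K * (ex.T \<eta> - ex.avg3 \<eta>))
      - 2 * g * (k (Y \<eta>) / real n * ex.Q1 \<eta>) + g\<^sup>2 * (k (Y \<eta>) / real n * ex.Q2 \<eta>)"
      unfolding avg3_Y[symmetric] sum_rate_spin[OF \<eta>] sum_rate[OF \<eta>]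
      using K n by (simp add: algebra_simps diff_divide_distrib add_divide_distrib)
  qed
  also have "\<dots> = ex.E ?tay - 2 * g\<^sup>2 * K / q * ex.E (\<lambda>\<eta>. f (Y \<eta>) / K * (ex.T \<eta> - ex.avg3 \<eta>))
      - 2 * g * ex.E (\<lambda>\<eta>. k (Y \<eta>) / real n * ex.Q1 \<eta>) + g\<^sup>2 * ex.E (\<lambda>\<eta>. k (Y \<eta>) / real n * ex.Q2 \<eta>)"
    by (simp only: ex.E_add ex.E_diff ex.E_cmult)
  finally have eq: "ex.E ?main = \<dots>" .
  have g1: "0 \<le> g" "g \<le> 1" "0 \<le> g\<^sup>2" "g\<^sup>2 \<le> 1" using gam_ge gam_le by (auto simp: power_le_one)
  have q2: "K / q\<^sup>2 \<le> K / q" using q_ge1 q_pos K by (intro divide_left_mono) (auto simp: power2_eq_square)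
  have "\<bar>2 * g\<^sup>2 * K / q * ex.E (\<lambda>\<eta>. f (Y \<eta>) / K * (ex.T \<eta> - ex.avg3 \<eta>))\<bar> \<le> (2 * K / q) * 600000"
    unfolding abs_mult[of _ "ex.E _"] using g1 K q_pos 1
    by (intro mult_mono) (auto simp: abs_mult mult_left_le_one_le divide_right_mono)
  moreover have "\<bar>2 * g * ex.E (\<lambda>\<eta>. k (Y \<eta>) / real n * ex.Q1 \<eta>)\<bar> \<le> 2 * (3000 * K / q\<^sup>2)"
    unfolding abs_mult[of _ "ex.E _"] using g1 2 by (intro mult_mono) auto
  moreover have "\<bar>g\<^sup>2 * ex.E (\<lambda>\<eta>. k (Y \<eta>) / real n * ex.Q2 \<eta>)\<bar> \<le> 1 * (3000 * K / q\<^sup>2)"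
    unfolding abs_mult[of _ "ex.E _"] using g1 3 by (intro mult_mono) auto
  moreover have "\<bar>ex.E ?tay\<bar> \<le> 4 * \<omega>" by (rule Taylor_estimate) (rule tay)
  moreover have "(2 * K / q) * 600000 = 1200000 * (K / q)" "1300000 * K / q = 1300000 * (K / q)"
    "3000 * K / q\<^sup>2 = 3000 * (K / q\<^sup>2)" by simp_all
  moreover have "0 \<le> K / q" using K q_pos by simp
  ultimately show ?thesis unfolding eq using q2 by linarith
qed

lemma coeff_bounds: "1 \<le> cubic_coeff" "linear_coeff \<le> 2"
proof -
  define N where "N = real n"
  have N: "N \<ge> 30" using n30 by (simp add: N_def)
  have g2: "4 / 25 \<le> g\<^sup>2" "g\<^sup>2 \<le> 9 / 25"
    using power_mono[OF gam_ge, of 2] power_mono[OF gam_le, of 2] gam_pos by (auto simp: power2_eq_square)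
  have pos: "(N - 1) * (N - 2) > 0" using N by simp
  have "(N - 1) * (N - 2) \<le> 1 * N\<^sup>2" using N by (simp add: power2_eq_square algebra_simps)
  moreover have "1 * N\<^sup>2 \<le> 16 * g\<^sup>2 * N\<^sup>2" using g2 by (intro mult_right_mono) auto
  ultimately have "1 * ((N - 1) * (N - 2)) \<le> 16 * g\<^sup>2 * N\<^sup>2" by linarith
  then show "1 \<le> cubic_coeff" using pos by (simp add: cubic_coeff_def N_def[symmetric] pos_le_divide_eq)
  have q4: "q\<^sup>2 * q\<^sup>2 = N" using q_powers(1) by (simp add: N_def eval_nat_numeral mult.assoc)
  have qN: "q\<^sup>2 \<le> N / 5"
  proof (rule ccontr)
    assume "\<not> q\<^sup>2 \<le> N / 5"
    then have "N / 5 * (N / 5) \<le> q\<^sup>2 * q\<^sup>2" using N by (intro mult_mono) auto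
    then have "N * N \<le> 25 * N" using q4 by simp
    then show False using N by simp
  qed
  have "4 * g\<^sup>2 * q\<^sup>2 * (3 * N - 2) \<le> 4 * (9 / 25) * (N / 5) * (3 * N)"
    using g2 qN N q_pos by (intro mult_mono) auto
  also have "\<dots> \<le> 2 * ((N - 1) * (N - 2))"
  proof -
    have "30 * N \<le> N * N" using N by (intro mult_right_mono) auto
    moreover have "4 * (9 / 25) * (N / 5) * (3 * N) = 108 / 125 * (N * N)"
      "2 * ((N - 1) * (N - 2)) = 2 * (N * N) - 6 * N + 4" by (simp_all add: algebra_simps)
    ultimately show ?thesis using N by linarith
  qed
  finally show "linear_coeff \<le> 2" using pos by (simp add: linear_coeff_def N_def[symmetric] pos_divide_le_eq)
qed

text \<open>Lyapunov argument with \<open>w\<close>, whose slope \<open>f\<close> is bounded: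
  \<open>f y * drift y\<close> is at least \<open>- b\<^sup>2\<close> everywhere and at least
  \<open>R / 2\<close> where the modulus of \<open>y\<close> is at least \<open>R\<close>. The
  second derivative of \<open>w\<close> lies between 0 and 1 and goes wholly into the Taylor error,
  with \<open>k = 0\<close> and \<open>\<omega> = 1\<close>.\<close>

lemma tail_bound:
  assumes a_small: "62000000 * a \<le> 1" and R: "R \<ge> 1" "R\<^sup>2 \<ge> 4 * \<bar>\<theta>\<bar> + 3"
  shows "ex.E (\<lambda>\<eta>. if R \<le> \<bar>Y \<eta>\<bar> then 1 else 0) \<le> 2 * (1300004 + (4 * \<bar>\<theta>\<bar> + 2)\<^sup>2) / R"
proof -
  \<comment> \<open>The summand 2 bounds \<open>linear_coeff\<close>; the assumption on
    \<open>R\<close> then says \<open>R\<^sup>2 \<ge> b + 1\<close>.\<close>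
  define b where "b = 4 * \<bar>\<theta>\<bar> + 2"
  define w where "w y = sqrt (1 + y\<^sup>2)" for y :: real
  define f where "f y = y / w y" for y
  have w: "w y > 0" "w y * w y = 1 + y\<^sup>2" for y
    using add_pos_nonneg[of 1 "y\<^sup>2"] by (auto simp: w_def)
  have dw: "(w has_real_derivative f y) (at y)" for y
    unfolding w_def[abs_def] f_def using add_pos_nonneg[of 1 "y\<^sup>2"]
    by (auto intro!: derivative_eq_intros simp: field_simps)
  have df: "(f has_real_derivative (1 / w y ^ 3)) (at y)" for y
  proof -
    have "(f has_real_derivative ((1 * w y - y * f y) / (w y * w y))) (at y)"
      unfolding f_def[abs_def] by (rule derivative_eq_intros dw[unfolded f_def] refl | simp add: w less_imp_neq[OF w(1), symmetric])+
    moreover have "(1 * w y - y * f y) / (w y * w y) = 1 / w y ^ 3"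
    proof -
      have "(1 * w y - y * f y) * w y = 1"
        using w[of y] by (simp add: f_def left_diff_distrib power2_eq_square)
      then have "1 * w y - y * f y = 1 / w y" using w(1)[of y] by (simp add: eq_divide_eq)
      then show ?thesis by (simp add: power3_eq_cube)
    qed
    ultimately show ?thesis by simp
  qed
  have w1: "w y \<ge> 1" "\<bar>y\<bar> \<le> w y" for y by (auto simp: w_def real_le_rsqrt)
  have w3: "\<bar>1 / w y ^ 3\<bar> \<le> 1" for y using w1[of y] by simp
  have f1: "\<bar>f y\<bar> \<le> 1" for y using w1[of y] w[of y] by (simp add: f_def)
  have fy: "f y * y = y\<^sup>2 / w y" for y by (simp add: f_def power2_eq_square)
  have tay: "\<bar>w (y + h) - w y - h * f y - h\<^sup>2 / 2 * 0\<bar> \<le> h\<^sup>2 / 2 * 1" for y h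
  proof -
    obtain \<xi> where "w (y + h) = w y + h * f y + h\<^sup>2 / 2 * (1 / w \<xi> ^ 3)"
      using second_order_Taylor[of w f "\<lambda>y. 1 / w y ^ 3" y h, OF dw df] by blast
    then have "\<bar>w (y + h) - w y - h * f y - h\<^sup>2 / 2 * 0\<bar> = h\<^sup>2 / 2 * \<bar>1 / w \<xi> ^ 3\<bar>" by (simp add: abs_mult)
    then show ?thesis using mult_left_mono[OF w3, of "h\<^sup>2 / 2" \<xi>] by simp
  qed
  have "ex.E (\<lambda>\<eta>. f (Y \<eta>) * drift (Y \<eta>) - 0) \<le> 4 * 1 + 1300000 * 1 / q"
  proof -
    have "\<bar>ex.E (\<lambda>\<eta>. f (Y \<eta>) * drift (Y \<eta>) - 0)\<bar> \<le> 4 * 1 + 1300000 * 1 / q"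
      by (rule drift_estimate[where \<phi> = w and f = f and k = "\<lambda>_. 0" and K = 1 and \<omega> = 1, OF a_small])
         (use tay f1 in auto)
    then show ?thesis by linarith
  qed
  also have "\<dots> \<le> 1300004" using q_ge1 q_pos by (simp add: pos_divide_le_eq)
  finally have up: "ex.E (\<lambda>\<eta>. f (Y \<eta>) * drift (Y \<eta>)) \<le> 1300004" by simp
  have "ex.E (\<lambda>\<eta>. R / 2 * (if R \<le> \<bar>Y \<eta>\<bar> then 1 else 0) - b\<^sup>2)
     \<le> ex.E (\<lambda>\<eta>. f (Y \<eta>) * drift (Y \<eta>))"
  proof (rule ex.E_mono)
    fix \<eta>
    define y where "y = Y \<eta>"
    define p where "p = y\<^sup>2 / w y"
    have p: "0 \<le> p" using w[of y] by (simp add: p_def)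
    have py: "p \<le> y\<^sup>2" using w1[of y] w[of y] by (simp add: p_def divide_le_eq mult_left_le mult_le_cancel_left1)
    have "f y * drift y = p * (4 * \<theta> + cubic_coeff * y\<^sup>2 - linear_coeff)"
      unfolding p_def fy[symmetric] by (simp add: algebra_simps power2_eq_square power3_eq_cube)
    moreover have "4 * \<theta> + cubic_coeff * y\<^sup>2 - linear_coeff \<ge> y\<^sup>2 - b"
    proof -
      have "1 * y\<^sup>2 \<le> cubic_coeff * y\<^sup>2" by (intro mult_right_mono coeff_bounds) simp
      moreover have "- \<bar>4 * \<theta>\<bar> \<le> 4 * \<theta>" by linarith
      ultimately show ?thesis using coeff_bounds(2) by (simp add: b_def abs_mult)
    qed
    ultimately have low: "p * (y\<^sup>2 - b) \<le> f y * drift y"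
      using p by (simp add: mult_left_mono)
    have b0: "b \<ge> 2" by (simp add: b_def)
    have "R / 2 * (if R \<le> \<bar>y\<bar> then 1 else 0) - b\<^sup>2 \<le> p * (y\<^sup>2 - b)"
    proof (cases "R \<le> \<bar>y\<bar>")
      case True
      then have "R\<^sup>2 \<le> y\<^sup>2" using R by (metis abs_le_square_iff abs_of_nonneg order_trans zero_le_one)
      then have y2: "1 \<le> y\<^sup>2 - b" using R(2) by (simp add: b_def)
      have "w y \<le> 2 * \<bar>y\<bar>"
      proof -
        have "1 \<le> y\<^sup>2" using y2 b0 by simp
        then have "1 + y\<^sup>2 \<le> (2 * \<bar>y\<bar>)\<^sup>2" by (simp add: power_mult_distrib)
        then show ?thesis unfolding w_def by (intro real_le_lsqrt) auto
      qed
      then have "\<bar>y\<bar> * w y \<le> \<bar>y\<bar> * (2 * \<bar>y\<bar>)" by (rule mult_left_mono) simp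
      also have "\<dots> = 2 * y\<^sup>2" by (simp add: power2_eq_square)
      finally have "\<bar>y\<bar> / 2 \<le> p"
        using w(1)[of y] by (simp add: p_def pos_le_divide_eq)
      then have "R / 2 \<le> p" using True by simp
      moreover have "p * 1 \<le> p * (y\<^sup>2 - b)" using p y2 by (intro mult_left_mono) auto
      moreover have "0 \<le> b\<^sup>2" by simp
      ultimately have "R / 2 - b\<^sup>2 \<le> p * (y\<^sup>2 - b)" by linarith
      then show ?thesis using True by simp
    next
      case False
      have "- b\<^sup>2 \<le> p * (y\<^sup>2 - b)"
      proof (cases "b \<le> y\<^sup>2")
        case True
        then have "0 \<le> p * (y\<^sup>2 - b)" using p by simp
        moreover have "- b\<^sup>2 \<le> 0" by simp
        ultimately show ?thesis by linarith
      next
        case False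
        then have "p * (b - y\<^sup>2) \<le> b * b" using p py b0 by (intro mult_mono) auto
        then show ?thesis by (simp add: power2_eq_square algebra_simps)
      qed
      then show ?thesis using False by simp
    qed
    then show "R / 2 * (if R \<le> \<bar>Y \<eta>\<bar> then 1 else 0) - b\<^sup>2
       \<le> f (Y \<eta>) * drift (Y \<eta>)"
      using low unfolding y_def by linarith
  qed
  then have "R / 2 * ex.E (\<lambda>\<eta>. if R \<le> \<bar>Y \<eta>\<bar> then 1 else 0) - b\<^sup>2 \<le> 1300004"
    using up by (simp only: ex.E_diff ex.E_cmult ex.E_const mass_eq)
  then show ?thesis using R unfolding b_def[symmetric] by (simp add: field_simps)
qed

end

section \<open>The limit\<close>

lemma eventually_stationary:
  assumes "a > 0"
  shows "\<forall>\<^sub>F n in sequentially. stationary \<theta> a n"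
proof -
  have "(\<lambda>n. \<theta> / sqrt (real n)) \<longlonglongrightarrow> 0"
    by (intro tendsto_divide_0[OF tendsto_const] filterlim_at_top_imp_at_infinity) real_asymp
  from tendstoD[OF this, of "1 / 5"] have "\<forall>\<^sub>F n in sequentially. \<bar>\<theta> / sqrt (real n)\<bar> < 1 / 5"
    by (simp add: dist_real_def)
  then show ?thesis using eventually_ge_at_top[of 30]
  proof eventually_elim
    case (elim n)
    define t where "t = \<theta> / sqrt (real n)"
    have t: "gam \<theta> n = (1 / 2) * (1 - t)" "\<bar>t\<bar> < 1 / 5" using elim(1) by (simp_all add: gam_def t_def)
    have g: "2 / 5 \<le> gam \<theta> n" using t by (simp add: abs_less_iff)
    have g': "gam \<theta> n \<le> 3 / 5" using t by (simp add: abs_less_iff)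
    show ?case using elim(2) assms g g' by unfold_locales auto
  qed
qed

lemma gam_tendsto: "gam \<theta> \<longlonglongrightarrow> 1 / 2"
proof -
  have "(\<lambda>n. \<theta> / sqrt (real n)) \<longlonglongrightarrow> 0"
    by (intro tendsto_divide_0[OF tendsto_const] filterlim_at_top_imp_at_infinity) real_asymp
  then have "(\<lambda>n. (1 / 2) * (1 - \<theta> / sqrt (real n))) \<longlonglongrightarrow> (1 / 2) * (1 - 0)"
    by (intro tendsto_intros)
  then show ?thesis by (simp add: gam_def[abs_def])
qed

lemma real_distribution_alpha: "real_distribution (alpha \<theta> a n)"
  unfolding alpha_def real_distribution_def real_distribution_axioms_def
  by (auto intro!: prob_space.prob_space_distr measure_pmf.prob_space_axioms)

lemma real_distribution_alpha_star: "real_distribution (alpha_star \<theta>)"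
  unfolding real_distribution_def real_distribution_axioms_def
  by (auto intro: prob_space_alpha_star) (auto simp: alpha_star_def)

lemma (in stationary) integral_alpha:
  assumes "h \<in> borel_measurable borel"
  shows "integral\<^sup>L (alpha \<theta> a n) h = ex.E (\<lambda>\<eta>. h (Y \<eta>))"
proof -
  have "integral\<^sup>L (alpha \<theta> a n) h = measure_pmf.expectation (mu_ss \<theta> a n) (\<lambda>\<eta>. h (Y \<eta>))"
    unfolding alpha_def by (rule integral_distr) (use assms in auto)
  then show ?thesis by (simp add: expectation_Omega[OF set_mu_ss] ex.E_def)
qed

lemma uniformly_continuous_compact_support:
  fixes k :: "real \<Rightarrow> real"
  assumes k: "continuous_on UNIV k" and supp: "\<And>y. B < \<bar>y\<bar> \<Longrightarrow> k y = 0" and e: "e > 0"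
  shows "\<exists>d>0. \<forall>y z. \<bar>y - z\<bar> < d \<longrightarrow> \<bar>k y - k z\<bar> \<le> e"
proof -
  have "uniformly_continuous_on {- B - 1..B + 1} k"
    by (intro compact_uniformly_continuous continuous_on_subset[OF k]) auto
  then obtain d where d: "d > 0" "\<And>y z. y \<in> {- B - 1..B + 1} \<Longrightarrow> z \<in> {- B - 1..B + 1} \<Longrightarrow> \<bar>z - y\<bar> < d \<Longrightarrow> \<bar>k z - k y\<bar> < e"
    using e unfolding uniformly_continuous_on_def dist_real_def by metis
  show ?thesis
  proof (intro exI[of _ "min d 1"] conjI allI impI)
    fix y z assume yz: "\<bar>y - z\<bar> < min d 1"
    show "\<bar>k y - k z\<bar> \<le> e"
    proof (cases "\<bar>y\<bar> \<le> B \<or> \<bar>z\<bar> \<le> B")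
      case True
      then have "y \<in> {- B - 1..B + 1}" "z \<in> {- B - 1..B + 1}" using yz by (auto simp: abs_le_iff abs_less_iff)
      then show ?thesis using d(2)[of z y] yz by simp
    next
      case False
      then show ?thesis using supp[of y] supp[of z] e by simp
    qed
  qed (use d in auto)
qed

lemma exists_antiderivative:
  fixes f :: "real \<Rightarrow> real"
  assumes "continuous_on UNIV f"
  shows "\<exists>\<phi>. \<forall>y. (\<phi> has_real_derivative f y) (at y)"
proof -
  have "\<exists>\<phi>. \<forall>x. - \<infinity> < ereal x \<longrightarrow> ereal x < \<infinity> \<longrightarrow> (\<phi> has_vector_derivative f x) (at x)"
    by (rule einterval_antiderivative) (use assms in \<open>auto simp: continuous_on_eq_continuous_at\<close>)
  then show ?thesis by (auto simp: has_real_derivative_iff_has_vector_derivative)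
qed

lemma bounded_compact_support:
  fixes k :: "real \<Rightarrow> real"
  assumes k: "continuous_on UNIV k" and supp: "\<And>y. B < \<bar>y\<bar> \<Longrightarrow> k y = 0"
  shows "\<exists>C\<ge>0. \<forall>y. \<bar>k y\<bar> \<le> C"
proof -
  have "bounded (k ` {- B..B})"
    by (intro compact_imp_bounded compact_continuous_image continuous_on_subset[OF k]) auto
  then obtain C where C: "\<forall>y\<in>{- B..B}. \<bar>k y\<bar> \<le> C" by (auto simp: bounded_iff)
  have "\<bar>k y\<bar> \<le> max C 0" for y
  proof (cases "B < \<bar>y\<bar>")
    case False
    then have "y \<in> {- B..B}" by auto
    then show ?thesis using C by fastforce
  qed (simp add: supp)
  then show ?thesis by (intro exI[of _ "max C 0"]) auto
qed

text \<open>Compact support bounds all the moments needed by one constant \<open>K\<close>. Since a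
  flip moves the magnetization by \<open>1 / q ^ 3\<close> only, uniform continuity of
  \<open>k\<close> makes the Taylor error small.\<close>

lemma limit_generator:
  fixes f k :: "real \<Rightarrow> real"
  assumes a: "0 < a" "62000000 * a \<le> 1"
    and f: "\<And>y. (f has_real_derivative k y) (at y)" and k: "continuous_on UNIV k"
    and B: "B \<ge> 1" and supp: "\<And>y. B < \<bar>y\<bar> \<Longrightarrow> f y = 0" "\<And>y. B < \<bar>y\<bar> \<Longrightarrow> k y = 0"
  shows "(\<lambda>n. integral\<^sup>L (alpha \<theta> a n) (\<lambda>y. f y * (4 * \<theta> * y + 4 * y ^ 3) - k y)) \<longlonglongrightarrow> 0"
proof -
  have fc: "continuous_on UNIV f"
    using f by (intro continuous_at_imp_continuous_on) (auto intro: DERIV_isCont)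
  obtain C1 where C1: "C1 \<ge> 0" "\<And>y. \<bar>f y\<bar> \<le> C1" using bounded_compact_support[OF fc supp(1)] by blast
  obtain C2 where C2: "C2 \<ge> 0" "\<And>y. \<bar>k y\<bar> \<le> C2" using bounded_compact_support[OF k supp(2)] by blast
  define K where "K = (C1 + C2) * B ^ 3 + 1"
  have K: "K > 0" using C1 C2 B by (simp add: K_def add_nonneg_pos)
  have pow: "\<bar>u y * y ^ j\<bar> \<le> K" if "\<And>y. \<bar>u y\<bar> \<le> C" "0 \<le> C" "C \<le> C1 + C2" "j \<le> 3" "\<And>y. B < \<bar>y\<bar> \<Longrightarrow> u y = 0" for u y C j
  proof (cases "B < \<bar>y\<bar>")
    case True
    then show ?thesis using that K by simp
  next
    case False
    have "\<bar>y\<bar> ^ j \<le> B ^ j" using False by (intro power_mono) auto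
    also have "\<dots> \<le> B ^ 3" using B that by (intro power_increasing) auto
    finally have "\<bar>u y\<bar> * \<bar>y\<bar> ^ j \<le> (C1 + C2) * B ^ 3"
      using that C1 C2 by (intro mult_mono) (auto intro: order_trans[OF that(1) that(3)])
    then show ?thesis by (simp add: abs_mult power_abs K_def)
  qed
  have fK: "\<bar>f y\<bar> \<le> K" "\<bar>f y * y\<bar> \<le> K" "\<bar>f y * y ^ 3\<bar> \<le> K" for y
    using pow[of f C1 0 y] pow[of f C1 1 y] pow[of f C1 3 y] C1 C2 supp by auto
  have kK: "\<bar>k y\<bar> \<le> K" "\<bar>k y * y\<^sup>2\<bar> \<le> K" for y
    using pow[of k C2 0 y] pow[of k C2 2 y] C1 C2 supp by auto
  obtain \<phi> where \<phi>: "\<And>y. (\<phi> has_real_derivative f y) (at y)"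
    using exists_antiderivative[OF fc] by blast
  define cub where "cub n = 16 * (gam \<theta> n)\<^sup>2 * ((real n)\<^sup>2 / ((real n - 1) * (real n - 2)))" for n
  define lin where "lin n = 4 * (gam \<theta> n)\<^sup>2 * ((real n powr (1 / 4))\<^sup>2 * (3 * real n - 2) / ((real n - 1) * (real n - 2)))" for n
  define u where "u n = 1 / real n powr (1 / 4)" for n
  have "(\<lambda>n. (real n)\<^sup>2 / ((real n - 1) * (real n - 2))) \<longlonglongrightarrow> 1" by real_asymp
  then have "cub \<longlonglongrightarrow> 16 * (1 / 2)\<^sup>2 * 1"
    unfolding cub_def[abs_def] by (intro tendsto_mult tendsto_power gam_tendsto tendsto_const)
  then have cub: "cub \<longlonglongrightarrow> 4" by (simp add: power2_eq_square)
  have "(\<lambda>n. (real n powr (1 / 4))\<^sup>2 * (3 * real n - 2) / ((real n - 1) * (real n - 2))) \<longlonglongrightarrow> 0" by real_asymp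
  then have "lin \<longlonglongrightarrow> 4 * (1 / 2)\<^sup>2 * 0"
    unfolding lin_def[abs_def] by (intro tendsto_mult tendsto_power gam_tendsto tendsto_const)
  then have lin: "lin \<longlonglongrightarrow> 0" by simp
  have u: "u \<longlonglongrightarrow> 0" unfolding u_def[abs_def] by real_asymp
  show ?thesis
  proof (rule tendstoI)
    fix e :: real assume e: "e > 0"
    \<comment> \<open>The Taylor error \<open>4 * \<omega>\<close> then takes half of
      \<open>e\<close>.\<close>
    define \<omega> where "\<omega> = e / 8"
    have "\<exists>d>0. \<forall>y z. \<bar>y - z\<bar> < d \<longrightarrow> \<bar>k y - k z\<bar> \<le> \<omega>"
      by (rule uniformly_continuous_compact_support[OF k supp(2)]) (use e in \<open>auto simp: \<omega>_def\<close>)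
    then obtain d where d: "d > 0" "\<And>y z. \<bar>y - z\<bar> < d \<Longrightarrow> \<bar>k y - k z\<bar> \<le> \<omega>" by blast
    have "(\<lambda>n. 4 * \<omega> + 1300000 * K * u n + \<bar>cub n - 4\<bar> * K + \<bar>lin n\<bar> * K) \<longlonglongrightarrow> 4 * \<omega> + 1300000 * K * 0 + \<bar>4 - 4\<bar> * K + \<bar>0\<bar> * K"
      by (intro tendsto_intros u cub lin)
    then have small: "\<forall>\<^sub>F n in sequentially. 4 * \<omega> + 1300000 * K * u n + \<bar>cub n - 4\<bar> * K + \<bar>lin n\<bar> * K < e"
      by (rule order_tendstoD) (use e in \<open>simp add: \<omega>_def\<close>)
    have "(\<lambda>n. u n ^ 3) \<longlonglongrightarrow> 0 ^ 3" by (intro tendsto_power u)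
    then have "\<forall>\<^sub>F n in sequentially. u n ^ 3 < d" by (rule order_tendstoD) (use d in simp)
    then show "\<forall>\<^sub>F n in sequentially. dist (integral\<^sup>L (alpha \<theta> a n) (\<lambda>y. f y * (4 * \<theta> * y + 4 * y ^ 3) - k y)) 0 < e"
      using small eventually_stationary[OF a(1), of \<theta>]
    proof eventually_elim
      case (elim n)
      then interpret stationary \<theta> a n by simp
      have uq: "u n = 1 / q" by (simp add: u_def q_def)
      have cubn: "cub n = cubic_coeff" and linn: "lin n = linear_coeff"
        by (simp_all add: cub_def lin_def cubic_coeff_def linear_coeff_def q_def)
      have "\<bar>ex.E (\<lambda>\<eta>. f (Y \<eta>) * drift (Y \<eta>) - k (Y \<eta>))\<bar>
          \<le> 4 * \<omega> + 1300000 * K / q"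
      proof (rule drift_estimate[OF a(2) _ fK(1) kK K])
        fix y h :: real assume h: "\<bar>h\<bar> = 1 / q ^ 3"
        obtain \<xi> where \<xi>: "\<bar>\<xi> - y\<bar> \<le> \<bar>h\<bar>" "\<phi> (y + h) = \<phi> y + h * f y + h\<^sup>2 / 2 * k \<xi>"
          using second_order_Taylor[OF \<phi> f] by blast
        have "\<bar>h\<bar> < d" using elim(1) unfolding h uq by (simp add: power_one_over)
        then have "\<bar>k \<xi> - k y\<bar> \<le> \<omega>" using \<xi>(1) by (intro d(2)) simp
        then have "h\<^sup>2 / 2 * \<bar>k \<xi> - k y\<bar> \<le> h\<^sup>2 / 2 * \<omega>" by (intro mult_left_mono) auto
        moreover have "\<bar>\<phi> (y + h) - \<phi> y - h * f y - h\<^sup>2 / 2 * k y\<bar> = \<bar>h\<^sup>2 / 2 * (k \<xi> - k y)\<bar>"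
          unfolding \<xi>(2) by (rule arg_cong[where f = abs]) (simp add: algebra_simps)
        ultimately show "\<bar>\<phi> (y + h) - \<phi> y - h * f y - h\<^sup>2 / 2 * k y\<bar> \<le> h\<^sup>2 / 2 * \<omega>"
          by (simp add: abs_mult)
      qed
      moreover have "\<bar>ex.E (\<lambda>\<eta>. (4 - cubic_coeff) * (f (Y \<eta>) * Y \<eta> ^ 3) + linear_coeff * (f (Y \<eta>) * Y \<eta>))\<bar>
         \<le> ex.E (\<lambda>_. \<bar>cub n - 4\<bar> * K + \<bar>lin n\<bar> * K)"
      proof (rule ex.abs_E_le)
        fix \<eta>
        have "\<bar>(4 - cubic_coeff) * (f (Y \<eta>) * Y \<eta> ^ 3)\<bar> \<le> \<bar>cub n - 4\<bar> * K"
          unfolding abs_mult[of "4 - _"] cubn abs_minus_commute[of 4] by (intro mult_left_mono fK) auto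
        moreover have "\<bar>linear_coeff * (f (Y \<eta>) * Y \<eta>)\<bar> \<le> \<bar>lin n\<bar> * K"
          unfolding abs_mult[of linear_coeff] linn by (intro mult_left_mono fK) auto
        ultimately show "\<bar>(4 - cubic_coeff) * (f (Y \<eta>) * Y \<eta> ^ 3) + linear_coeff * (f (Y \<eta>) * Y \<eta>)\<bar> \<le> \<bar>cub n - 4\<bar> * K + \<bar>lin n\<bar> * K"
          by linarith
      qed
      moreover have "ex.E (\<lambda>_. \<bar>cub n - 4\<bar> * K + \<bar>lin n\<bar> * K) = \<bar>cub n - 4\<bar> * K + \<bar>lin n\<bar> * K"
        by (simp only: ex.E_const mass_eq mult_1_right)
      moreover have "integral\<^sup>L (alpha \<theta> a n) (\<lambda>y. f y * (4 * \<theta> * y + 4 * y ^ 3) - k y)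
         = ex.E (\<lambda>\<eta>. f (Y \<eta>) * drift (Y \<eta>) - k (Y \<eta>))
         + ex.E (\<lambda>\<eta>. (4 - cubic_coeff) * (f (Y \<eta>) * Y \<eta> ^ 3) + linear_coeff * (f (Y \<eta>) * Y \<eta>))"
      proof -
        have m: "(\<lambda>y. f y * (4 * \<theta> * y + 4 * y ^ 3) - k y) \<in> borel_measurable borel"
          by (intro borel_measurable_continuous_onI continuous_intros fc k)
        show ?thesis unfolding integral_alpha[OF m] ex.E_add[symmetric]
          by (intro ex.E_cong) (simp add: algebra_simps)
      qed
      moreover have "1300000 * K / q = 1300000 * K * u n" by (simp add: uq)
      ultimately show ?case using elim(2) unfolding dist_real_def by linarith
    qed
  qed
qed

text \<open>Stein's method: \<open>f\<close>, which is \<open>exp (2 * potential \<theta> y)\<close>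
  times the primitive of \<open>\<psi>\<close> against the unnormalized density, solves the first
  order equation with right-hand side \<open>\<psi>\<close>. The primitive vanishes to the left of
  the support by normalization and to the right because \<open>\<psi>\<close> is centred, so
  \<open>f\<close> has compact support.\<close>

lemma limit_centred:
  fixes \<psi> :: "real \<Rightarrow> real"
  assumes a: "0 < a" "62000000 * a \<le> 1" and \<psi>: "continuous_on UNIV \<psi>"
    and B: "B \<ge> 1" and supp: "\<And>y. B < \<bar>y\<bar> \<Longrightarrow> \<psi> y = 0"
    and zero: "(\<integral>y. \<psi> y * exp (- 2 * potential \<theta> y) \<partial>lborel) = 0"
  shows "(\<lambda>n. integral\<^sup>L (alpha \<theta> a n) \<psi>) \<longlonglongrightarrow> 0"
proof -
  define g where "g y = \<psi> y * exp (- 2 * potential \<theta> y)" for y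
  have g: "continuous_on UNIV g"
    unfolding g_def potential_def by (intro continuous_intros \<psi>)
  have g_supp: "g y = 0" if "B < \<bar>y\<bar>" for y using supp[OF that] by (simp add: g_def)
  obtain P where P: "\<And>y. (P has_real_derivative g y) (at y)"
    using exists_antiderivative[OF g] by blast
  \<comment> \<open>The support hypothesis is strict, so the end points are reached by
    continuity.\<close>
  have gB: "g B = 0" "g (- B) = 0"
  proof -
    have "g y = 0" if y: "\<bar>y\<bar> = B" for y
    proof (rule ccontr)
      assume "g y \<noteq> 0"
      moreover have "isCont g y" using g by (simp add: continuous_on_eq_continuous_at)
      ultimately have "\<forall>\<^sub>F z in at y. g z \<noteq> 0"
        unfolding isCont_def by (intro tendsto_imp_eventually_ne) auto
      then obtain d where d: "d > 0" "\<And>z. z \<noteq> y \<Longrightarrow> \<bar>z - y\<bar> < d \<Longrightarrow> g z \<noteq> 0"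
        unfolding eventually_at dist_real_def by auto
      define z where "z = y + sgn y * (d / 2)"
      have "B < \<bar>z\<bar>" "\<bar>z - y\<bar> < d" "z \<noteq> y"
        using d(1) y B by (auto simp: z_def sgn_if abs_if split: if_splits)
      then show False using d(2)[of z] g_supp[of z] by simp
    qed
    then show "g B = 0" "g (- B) = 0" using B by auto
  qed
  have const: "P y = P z" if "\<And>x. x \<in> {min y z..max y z} \<Longrightarrow> g x = 0" for y z
  proof -
    have "P (min y z) = P (max y z)"
    proof (cases "min y z < max y z")
      case True
      have "P (max y z) = P (min y z)"
      proof (rule DERIV_isconst2[OF True])
        show "continuous_on {min y z..max y z} P"
          by (intro continuous_at_imp_continuous_on) (auto intro: DERIV_isCont P)
        show "(P has_real_derivative 0) (at x)" if "min y z < x" "x < max y z" for x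
          using P[of x] \<open>\<And>x. x \<in> {min y z..max y z} \<Longrightarrow> g x = 0\<close>[of x] that by simp
      qed (use True in auto)
      then show ?thesis by simp
    next
      case False
      then have "min y z = max y z" by simp
      then show ?thesis by simp
    qed
    then show ?thesis by (auto simp: min_def max_def split: if_splits)
  qed
  have left: "P y = P (- B)" if "y \<le> - B" for y
  proof (rule const)
    fix x assume "x \<in> {min y (- B)..max y (- B)}"
    then have "x = - B \<or> B < \<bar>x\<bar>" using that by auto
    then show "g x = 0" using gB g_supp by blast
  qed
  have right: "P y = P B" if "B \<le> y" for y
  proof (rule const)
    fix x assume "x \<in> {min y B..max y B}"
    then have "x = B \<or> B < \<bar>x\<bar>" using that B by auto
    then show "g x = 0" using gB g_supp by blast
  qed
  have "(\<integral>x. g x * indicator {- B..B} x \<partial>lborel) = P B - P (- B)"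
    by (rule integral_FTC_Icc_real) (use B P g in \<open>auto simp: continuous_on_eq_continuous_at\<close>)
  moreover have "(\<lambda>x. g x * indicator {- B..B} x) = g"
  proof
    fix x show "g x * indicator {- B..B} x = g x"
    proof (cases "B < \<bar>x\<bar>")
      case False
      then have "x \<in> {- B..B}" by auto
      then show ?thesis by simp
    qed (simp add: g_supp)
  qed
  moreover have "integral\<^sup>L lborel g = 0" using zero by (simp only: g_def[abs_def])
  ultimately have PB: "P B = P (- B)" by simp
  define f where "f y = exp (2 * potential \<theta> y) * (P y - P (- B))" for y
  define k where "k y = (4 * \<theta> * y + 4 * y ^ 3) * f y + \<psi> y" for y
  have df: "(f has_real_derivative k y) (at y)" for y
  proof -
    have "exp (2 * potential \<theta> y) * g y = \<psi> y"
      by (simp add: g_def exp_minus field_simps)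
    moreover have "(f has_real_derivative (exp (2 * potential \<theta> y) * (2 * (\<theta> * (2 * y) + (1 / 2) * (4 * y ^ 3))) * (P y - P (- B)) + exp (2 * potential \<theta> y) * g y)) (at y)"
      unfolding f_def[abs_def] potential_def
      by (auto intro!: derivative_eq_intros P)
    ultimately show ?thesis by (simp add: k_def f_def algebra_simps)
  qed
  have fc: "continuous_on UNIV f"
    using df by (intro continuous_at_imp_continuous_on) (auto intro: DERIV_isCont)
  have f_supp: "f y = 0" if "B < \<bar>y\<bar>" for y
  proof -
    have "P y = P (- B)" using left[of y] right[of y] that PB by (cases "y \<ge> 0") auto
    then show ?thesis by (simp add: f_def)
  qed
  have kc: "continuous_on UNIV k"
    unfolding k_def by (intro continuous_intros fc \<psi>)
  have "(\<lambda>n. integral\<^sup>L (alpha \<theta> a n) (\<lambda>y. f y * (4 * \<theta> * y + 4 * y ^ 3) - k y)) \<longlonglongrightarrow> 0"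
    by (rule limit_generator[OF a df kc B f_supp]) (simp_all add: k_def f_supp supp)
  then have "(\<lambda>n. - integral\<^sup>L (alpha \<theta> a n) \<psi>) \<longlonglongrightarrow> 0"
    by (simp add: k_def algebra_simps)
  then show ?thesis using tendsto_minus by fastforce
qed

section \<open>Truncation and weak convergence\<close>

definition cutoff :: "real \<Rightarrow> real \<Rightarrow> real" where
  "cutoff R y = max 0 (min 1 (R + 1 - \<bar>y\<bar>))"

lemma cutoff_bounds: "0 \<le> cutoff R y" "cutoff R y \<le> 1"
  by (auto simp: cutoff_def)

lemma continuous_cutoff: "continuous_on A (cutoff R)"
  unfolding cutoff_def by (intro continuous_intros)

text \<open>Applied with the same \<open>c\<close> to the law at \<open>n\<close> and to the limit
  law, so that the two integrals of \<open>h\<close> are compared through \<open>c\<close>. The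
  removed part is at most \<open>2 * (1 - cutoff R y)\<close> in modulus.\<close>

lemma (in real_distribution) cutoff_error:
  assumes h: "continuous_on UNIV h" "\<And>y. \<bar>h y\<bar> \<le> 1" and c: "\<bar>c\<bar> \<le> 1"
  shows "\<bar>integral\<^sup>L M h - c\<bar> \<le> \<bar>integral\<^sup>L M (\<lambda>y. cutoff R y * (h y - c))\<bar> + 2 * integral\<^sup>L M (\<lambda>y. 1 - cutoff R y)"
proof -
  have m: "u \<in> borel_measurable M" if "continuous_on UNIV u" for u :: "real \<Rightarrow> real"
    using borel_measurable_continuous_onI[OF that] measurable_cong_sets[OF events_eq_borel refl] by blast
  have int: "integrable M u" if u: "continuous_on UNIV u" "\<And>y. \<bar>u y\<bar> \<le> 2" for u :: "real \<Rightarrow> real"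
  proof (rule integrable_const_bound[where B = 2])
    show "AE y in M. norm (u y) \<le> 2" using u(2) by (intro AE_I2) simp
    show "u \<in> borel_measurable M" by (rule m[OF u(1)])
  qed
  have hc: "\<bar>h y - c\<bar> \<le> 2" for y using h(2)[of y] c by linarith
  have pt: "\<bar>v * (h y - c)\<bar> \<le> 2 * v" if "0 \<le> v" for v y
    using mult_left_mono[OF hc that, of y] that by (simp add: abs_mult mult.commute)
  have i1: "integrable M (\<lambda>y. cutoff R y * (h y - c))"
  proof (rule int)
    show "\<bar>cutoff R y * (h y - c)\<bar> \<le> 2" for y
      using order_trans[OF pt[OF cutoff_bounds(1)[of R y], of y]] cutoff_bounds[of R y] by simp
  qed (intro continuous_intros continuous_cutoff h)
  have i2: "integrable M (\<lambda>y. (1 - cutoff R y) * (h y - c))"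
  proof (rule int)
    show "\<bar>(1 - cutoff R y) * (h y - c)\<bar> \<le> 2" for y
    proof -
      have "0 \<le> 1 - cutoff R y" using cutoff_bounds[of R y] by simp
      from order_trans[OF pt[OF this, of y]] show ?thesis using cutoff_bounds[of R y] by simp
    qed
  qed (intro continuous_intros continuous_cutoff h)
  have i3: "integrable M (\<lambda>y. 2 * (1 - cutoff R y))"
  proof (rule int)
    show "\<bar>2 * (1 - cutoff R y)\<bar> \<le> 2" for y using cutoff_bounds[of R y] by simp
  qed (intro continuous_intros continuous_cutoff)
  have "\<bar>h y\<bar> \<le> 2" for y using h(2)[of y] by linarith
  then have i4: "integrable M h" by (intro int h(1))
  have "integral\<^sup>L M h - c = integral\<^sup>L M (\<lambda>y. h y - c)"
  proof -
    have "prob UNIV = 1" using prob_space space_eq_univ by metis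
    then show ?thesis using i4 by simp
  qed
  also have "\<dots> = integral\<^sup>L M (\<lambda>y. cutoff R y * (h y - c) + (1 - cutoff R y) * (h y - c))"
    by (rule Bochner_Integration.integral_cong) (auto simp: algebra_simps)
  also have "\<dots> = integral\<^sup>L M (\<lambda>y. cutoff R y * (h y - c)) + integral\<^sup>L M (\<lambda>y. (1 - cutoff R y) * (h y - c))"
    by (rule Bochner_Integration.integral_add[OF i1 i2])
  finally have "\<bar>integral\<^sup>L M h - c\<bar> \<le> \<bar>integral\<^sup>L M (\<lambda>y. cutoff R y * (h y - c))\<bar> + \<bar>integral\<^sup>L M (\<lambda>y. (1 - cutoff R y) * (h y - c))\<bar>"
    by linarith
  moreover have "\<bar>integral\<^sup>L M (\<lambda>y. (1 - cutoff R y) * (h y - c))\<bar> \<le> integral\<^sup>L M (\<lambda>y. 2 * (1 - cutoff R y))"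
    using cutoff_bounds by (intro integral_abs_bound[THEN order_trans] integral_mono integrable_abs i2 i3 pt) auto
  moreover have "integral\<^sup>L M (\<lambda>y. 2 * (1 - cutoff R y)) = 2 * integral\<^sup>L M (\<lambda>y. 1 - cutoff R y)"
    by (rule Bochner_Integration.integral_mult_right_zero)
  ultimately show ?thesis by linarith
qed

lemma integral_alpha_star:
  assumes "h \<in> borel_measurable borel"
  shows "integral\<^sup>L (alpha_star \<theta>) h = (\<integral>y. h y * exp (- 2 * potential \<theta> y) \<partial>lborel) / partition_const \<theta>"
proof -
  have "integral\<^sup>L (alpha_star \<theta>) h = (\<integral>y. (exp (- 2 * potential \<theta> y) / partition_const \<theta>) *\<^sub>R h y \<partial>lborel)"
    unfolding alpha_star_def
    by (rule integral_density) (use assms partition_const_pos[of \<theta>] in \<open>auto simp: potential_def less_imp_le\<close>)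
  also have "\<dots> = (\<integral>y. h y * exp (- 2 * potential \<theta> y) / partition_const \<theta> \<partial>lborel)"
    by (rule Bochner_Integration.integral_cong) auto
  finally show ?thesis by simp
qed

text \<open>\<open>limit_centred\<close> reaches only centred functions of compact support. A
  bounded \<open>h\<close> is therefore reduced to \<open>cutoff R y * (h y - c)\<close>, with
  \<open>c\<close> chosen to give mean zero under the limit law; \<open>tail_bound\<close> controls
  the truncation for all large \<open>n\<close> at once.\<close>

lemma weak_convergence:
  assumes a: "0 < a" "62000000 * a \<le> 1"
  shows "weak_conv_m (alpha \<theta> a) (alpha_star \<theta>)"
proof (rule integral_bdd_continuous_conv_imp_weak_conv[OF real_distribution_alpha real_distribution_alpha_star])
  fix h :: "real \<Rightarrow> real" assume "\<And>x. isCont h x" and h1: "\<And>x. \<bar>h x\<bar> \<le> 1"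
  then have hc: "continuous_on UNIV h" by (simp add: continuous_on_eq_continuous_at)
  interpret A: real_distribution "alpha_star \<theta>" by (rule real_distribution_alpha_star)
  define tail where "tail R = integral\<^sup>L (alpha_star \<theta>) (\<lambda>y. 1 - cutoff R y)" for R
  define D where "D = 2 * (1300004 + (4 * \<bar>\<theta>\<bar> + 2)\<^sup>2)"
  have meas: "u \<in> borel_measurable (alpha_star \<theta>)" if "continuous_on UNIV u" for u :: "real \<Rightarrow> real"
    using borel_measurable_continuous_onI[OF that] measurable_cong_sets[OF A.events_eq_borel refl] by blast
  have tail_lim: "(\<lambda>m. tail (real m)) \<longlonglongrightarrow> 0"
  proof -
    have "(\<lambda>m. tail (real m)) \<longlonglongrightarrow> integral\<^sup>L (alpha_star \<theta>) (\<lambda>y. 0)"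
      unfolding tail_def
    proof (rule integral_dominated_convergence[where w = "\<lambda>_. 1"])
      show "AE y in alpha_star \<theta>. (\<lambda>m. 1 - cutoff (real m) y) \<longlonglongrightarrow> 0"
      proof (rule AE_I2)
        fix y :: real
        obtain m0 where m0: "\<bar>y\<bar> \<le> real m0" using real_arch_simple by blast
        have "\<forall>\<^sub>F m in sequentially. 1 - cutoff (real m) y = 0"
          using eventually_ge_at_top[of m0] by eventually_elim (use m0 in \<open>auto simp: cutoff_def\<close>)
        then show "(\<lambda>m. 1 - cutoff (real m) y) \<longlonglongrightarrow> 0" by (rule tendsto_eventually)
      qed
    qed (auto intro!: meas continuous_intros continuous_cutoff simp: cutoff_bounds)
    then show ?thesis by simp
  qed
  show "(\<lambda>n. integral\<^sup>L (alpha \<theta> a n) h) \<longlonglongrightarrow> integral\<^sup>L (alpha_star \<theta>) h"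
  proof (rule tendstoI)
    fix e :: real assume e: "e > 0"
    \<comment> \<open>The bound 1/2 keeps the mass \<open>w\<close>, by which \<open>c\<close>
      divides, positive. The thresholds \<open>e / 8\<close> make the errors below add up to three
      quarters of \<open>e\<close>.\<close>
    have "\<forall>\<^sub>F m in sequentially. tail (real m) < min (e / 8) (1 / 2)"
      by (rule order_tendstoD(2)[OF tail_lim]) (use e in simp)
    moreover have "(\<lambda>m. D / real m) \<longlonglongrightarrow> 0" by real_asymp
    then have "\<forall>\<^sub>F m in sequentially. D / real m < e / 8" using order_tendstoD(2) e by (metis divide_pos_pos zero_less_numeral)
    moreover have "\<forall>\<^sub>F m in sequentially. real m \<ge> 4 * \<bar>\<theta>\<bar> + 3" by real_asymp
    ultimately have "\<forall>\<^sub>F m in sequentially. tail (real m) < min (e / 8) (1 / 2) \<and> D / real m < e / 8 \<and> real m \<ge> 4 * \<bar>\<theta>\<bar> + 3"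
      by eventually_elim auto
    then obtain m where m: "tail (real m) < min (e / 8) (1 / 2)" "D / real m < e / 8" "real m \<ge> 4 * \<bar>\<theta>\<bar> + 3"
      using eventually_happens by fastforce
    define R where "R = real m"
    have R: "R \<ge> 1" "R\<^sup>2 \<ge> 4 * \<bar>\<theta>\<bar> + 3"
    proof -
      show "R \<ge> 1" using m(3) by (simp add: R_def)
      then have "R * 1 \<le> R * R" by (intro mult_left_mono) auto
      then show "R\<^sup>2 \<ge> 4 * \<bar>\<theta>\<bar> + 3" using m(3) by (simp add: R_def power2_eq_square)
    qed
    define w where "w = integral\<^sup>L (alpha_star \<theta>) (cutoff R)"
    have icut: "integrable (alpha_star \<theta>) (cutoff R)"
      by (rule A.integrable_const_bound[where B = 1]) (auto intro!: meas continuous_cutoff simp: cutoff_bounds)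
    have icuth: "integrable (alpha_star \<theta>) (\<lambda>y. cutoff R y * h y)"
      by (rule A.integrable_const_bound[where B = 1])
         (auto intro!: meas continuous_intros continuous_cutoff hc mult_le_one simp: cutoff_bounds abs_mult h1)
    have "A.prob UNIV = 1" using A.prob_space A.space_eq_univ by metis
    then have "tail R = 1 - w" using icut by (simp add: w_def tail_def)
    then have w: "w > 0" using m(1) by (simp add: R_def)
    define c where "c = integral\<^sup>L (alpha_star \<theta>) (\<lambda>y. cutoff R y * h y) / w"
    have "\<bar>integral\<^sup>L (alpha_star \<theta>) (\<lambda>y. cutoff R y * h y)\<bar> \<le> w"
    proof -
      have "\<bar>cutoff R y * h y\<bar> \<le> cutoff R y" for y
        using h1[of y] cutoff_bounds[of R y] by (simp add: abs_mult mult_left_le)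
      then show ?thesis unfolding w_def
        by (intro integral_abs_bound[THEN order_trans] integral_mono integrable_abs icuth icut)
    qed
    then have c: "\<bar>c\<bar> \<le> 1" using w by (simp add: c_def abs_divide)
    define \<psi> where "\<psi> y = cutoff R y * (h y - c)" for y
    have \<psi>c: "continuous_on UNIV \<psi>" unfolding \<psi>_def by (intro continuous_intros continuous_cutoff hc)
    have "integral\<^sup>L (alpha_star \<theta>) \<psi> = integral\<^sup>L (alpha_star \<theta>) (\<lambda>y. cutoff R y * h y) - w * c"
      unfolding \<psi>_def right_diff_distrib w_def using icut icuth by simp
    also have "\<dots> = 0" using w by (simp add: c_def)
    finally have \<psi>0: "integral\<^sup>L (alpha_star \<theta>) \<psi> = 0" .
    then have "(\<integral>y. \<psi> y * exp (- 2 * potential \<theta> y) \<partial>lborel) = 0"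
      using integral_alpha_star[OF borel_measurable_continuous_onI[OF \<psi>c], of \<theta>] partition_const_pos[of \<theta>] by simp
    then have "(\<lambda>n. integral\<^sup>L (alpha \<theta> a n) \<psi>) \<longlonglongrightarrow> 0"
      using R by (intro limit_centred[OF a \<psi>c, where B = "R + 1"]) (auto simp: \<psi>_def cutoff_def)
    from tendstoD[OF this, of "e / 4"] have "\<forall>\<^sub>F n in sequentially. \<bar>integral\<^sup>L (alpha \<theta> a n) \<psi>\<bar> < e / 4"
      using e by (simp add: dist_real_def)
    then show "\<forall>\<^sub>F n in sequentially. dist (integral\<^sup>L (alpha \<theta> a n) h) (integral\<^sup>L (alpha_star \<theta>) h) < e"
      using eventually_stationary[OF a(1), of \<theta>]
    proof eventually_elim
      case (elim n)
      then interpret stationary \<theta> a n by simp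
      interpret N: real_distribution "alpha \<theta> a n" by (rule real_distribution_alpha)
      have "integral\<^sup>L (alpha \<theta> a n) (\<lambda>y. 1 - cutoff R y) = ex.E (\<lambda>\<eta>. 1 - cutoff R (Y \<eta>))"
        by (rule integral_alpha) (intro borel_measurable_continuous_onI continuous_intros continuous_cutoff)
      also have "\<dots> \<le> ex.E (\<lambda>\<eta>. if R \<le> \<bar>Y \<eta>\<bar> then 1 else 0)"
        by (rule ex.E_mono) (auto simp: cutoff_def)
      also have "\<dots> \<le> D / R" using tail_bound[OF a(2) R] by (simp add: D_def)
      also have "\<dots> < e / 8" using m(2) unfolding R_def .
      finally have 1: "integral\<^sup>L (alpha \<theta> a n) (\<lambda>y. 1 - cutoff R y) < e / 8" .
      have "\<bar>integral\<^sup>L (alpha \<theta> a n) h - c\<bar> < e / 4 + 2 * (e / 8)"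
        using N.cutoff_error[OF hc h1 c, of R] 1 elim(1) unfolding \<psi>_def by linarith
      moreover have "\<bar>integral\<^sup>L (alpha_star \<theta>) h - c\<bar> < 2 * (e / 8)"
        using A.cutoff_error[OF hc h1 c, of R] m(1) \<psi>0 unfolding \<psi>_def tail_def R_def by simp
      ultimately show ?case using e unfolding dist_real_def by linarith
    qed
  qed
qed

theorem theorem2p1:
  fixes \<theta> :: real
  shows "\<exists>a0>0. \<forall>a. 0 < a \<and> a < a0 \<longrightarrow> weak_conv_m (alpha \<theta> a) (alpha_star \<theta>)"
proof (intro exI[of _ "1 / 62000000"] conjI allI impI)
  fix a :: real assume "0 < a \<and> a < 1 / 62000000"
  then show "weak_conv_m (alpha \<theta> a) (alpha_star \<theta>)" by (intro weak_convergence) auto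
qed simp

end
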